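(* Let $F$ be a non-Archimedean local field of characteristic zero, let $\pi$ be an irreducible smooth representation of $\mathrm{GL}_n(F)$, and let $\chi$ be a quasi-character of $F^\times$, with $\chi_s(x)=\chi(x)|x|_F^s$. The principal value integral $$\int^{\mathrm{pv}}_{F^\times}k_{\pi,\psi}(x)\chi_s(x^{-1})\,d^\times x:=\lim_{\ell\to\infty}\sum_{m=-\ell}^{\ell}\int_{S_m}k_{\pi,\psi}(x)\chi_s(x^{-1})\,d^\times x,\qquad S_m:=\{x\in F^\times\mid |x|_F=q^{-m}\},$$ is convergent for $\mathrm{Re}(s)$ sufficiently small (i.e. sufficiently negative), admits a meromorphic continuation to $s\in\mathbb{C}$, and is equal to $\gamma(s+\frac12,\pi\times\chi,\psi)$.
   Context: $\mathfrak{o}_F$ is the ring of integers of $F$, $\mathfrak{p}$ its maximal ideal, $\varpi$ a uniformizer, $q$ the residue cardinality, $|\cdot|_F$ the normalized absolute value. $\psi$ is an additive character of $F$ trivial on $\mathfrak{o}_F$ and non-trivial on $\varpi^{-1}\mathfrak{o}_F$. $d^+x$ is the self-dual Haar measure on $F$ for $\psi$, $d^+g$ the induced measure on $\mathrm{M}_n(F)$, $dg=|\det g|_F^{-n}d^+g$ on $\mathrm{GL}_n(F)$, $d^\times x=|x|_F^{-1}d^+x$. For $x\in F^\times$, $d_xg$ is the $\mathrm{SL}_n(F)$-invariant measure on $\{g\in\mathrm{GL}_n(F):\det g=x\}$ with $\int_{\mathrm{GL}_n(F)}f\,dg=\int_{F^\times}\int_{\det g=x}f(g)\,d_xg\,d^\times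 x$. Put $f^\vee(g)=f(g^{-1})$ and $(f_1*f_2)(g)=\int_{\mathrm{GL}_n(F)}f_1(h)f_2(h^{-1}g)\,dh$. $\widetilde\pi$ is the contragredient of $\pi$ and $\mathcal{C}(\widetilde\pi)$ its space of matrix coefficients. $\gamma(s,\pi\times\chi,\psi)$ is the Godement–Jacquet gamma factor of $\pi\otimes\chi(\det)$. Let $\Phi_{\mathrm{GJ}}(g)=\psi(\mathrm{tr}\,g)|\det g|_F^{n/2}$ on $\mathrm{GL}_n(F)$, $K_\ell=\mathrm{I}_n+\mathrm{M}_n(\mathfrak{p}^\ell)$ and $\mathfrak{c}_\ell=\mathrm{vol}(K_\ell)^{-1}\mathbf{1}_{K_\ell}$ for $\ell\ge1$. Fix $\varphi_{\widetilde\pi}\in\mathcal{C}(\widetilde\pi)$ with $\varphi_{\widetilde\pi}(\mathrm{I}_n)=1$. The $\pi$-kernel function is $$k_{\pi,\psi}(x)=\lim_{\ell\to\infty}\int_{\det g=x}(\Phi_{\mathrm{GJ}}*\mathfrak{c}_\ell^\vee)(g)\,\varphi_{\widetilde\pi}(g)\,d_xg ,\qquad x\in F^\times,$$ where each integral converges absolutely and the limit exists and is a smooth function of $x$. *)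

theory Defs
  imports "HOL-Complex_Analysis.Complex_Analysis"
begin

section \<open>Non-Archimedean local fields of characteristic zero\<close>

text \<open>A field of characteristic zero that is complete for a discrete, nontrivial, non-Archimedean
  absolute value with finite residue field. The residue field is rendered as the set of cosets
  \<open>x + \<pp>\<close>, \<open>x \<in> \<oo>\<close>. The last axiom says that the value group is generated by the residue
  cardinality, i.e. the absolute value is the normalized one.\<close>

class nonarch_local_field = field_char_0 + complete_space +
  fixes nabs :: "'a \<Rightarrow> real"
  assumes dist_nabs: "dist x y = nabs (x - y)"
    and nabs_mult: "nabs (x * y) = nabs x * nabs y"
    and nabs_ultrametric: "nabs (x + y) \<le> max (nabs x) (nabs y)"
    and finite_residue_field: "finite ((\<lambda>x. {y. nabs (y - x) < 1}) ` {x. nabs x \<le> 1})"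
    and value_group: "nabs ` (UNIV - {0}) =
      range (\<lambda>k::int. real (card ((\<lambda>x. {y. nabs (y - x) < 1}) ` {x. nabs x \<le> 1})) powi k)"

definition residue_card :: "'f::nonarch_local_field itself \<Rightarrow> nat" where
  "residue_card _ = card ((\<lambda>x::'f. {y. nabs (y - x) < 1}) ` {x. nabs x \<le> 1})"

text \<open>The fractional ideals \<open>\<pp>\<^sup>l = \<varpi>\<^sup>l \<oo>\<close>, \<open>l \<in> \<int>\<close>; \<open>l = 0\<close> gives the ring of integers.\<close>

definition prime_power :: "int \<Rightarrow> 'f::nonarch_local_field set" where
  "prime_power l = {x. nabs x \<le> real (residue_card TYPE('f)) powi (- l)}"

definition shell :: "int \<Rightarrow> 'f::nonarch_local_field set" where
  "shell m = {x. x \<noteq> 0 \<and> nabs x = real (residue_card TYPE('f)) powi (- m)}"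


section \<open>Characters\<close>

definition additive_character :: "('f::nonarch_local_field \<Rightarrow> complex) \<Rightarrow> bool" where
  "additive_character \<psi> \<longleftrightarrow>
     continuous_on UNIV \<psi> \<and> (\<forall>x. norm (\<psi> x) = 1) \<and> (\<forall>x y. \<psi> (x + y) = \<psi> x * \<psi> y)"

definition conductor_integers :: "('f::nonarch_local_field \<Rightarrow> complex) \<Rightarrow> bool" where
  "conductor_integers \<psi> \<longleftrightarrow> (\<forall>x\<in>prime_power 0. \<psi> x = 1) \<and> (\<exists>x\<in>prime_power (-1). \<psi> x \<noteq> 1)"

definition quasi_character :: "('f::nonarch_local_field \<Rightarrow> complex) \<Rightarrow> bool" where
  "quasi_character chi \<longleftrightarrow>
     continuous_on (UNIV - {0}) chi \<and> (\<forall>x. x \<noteq> 0 \<longrightarrow> chi x \<noteq> 0) \<and>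
     (\<forall>x y. x \<noteq> 0 \<longrightarrow> y \<noteq> 0 \<longrightarrow> chi (x * y) = chi x * chi y)"

definition char_shift :: "('f::nonarch_local_field \<Rightarrow> complex) \<Rightarrow> complex \<Rightarrow> 'f \<Rightarrow> complex" where
  "char_shift chi s x = chi x * of_real (nabs x) powr s"


section \<open>Schwartz--Bruhat functions and measures\<close>

definition schwartz_bruhat :: "('a::topological_space \<Rightarrow> complex) \<Rightarrow> bool" where
  "schwartz_bruhat f \<longleftrightarrow>
     (\<forall>x. \<exists>U. open U \<and> x \<in> U \<and> (\<forall>y\<in>U. f y = f x)) \<and> compact (closure {x. f x \<noteq> 0})"

definition haar_measure :: "'f::nonarch_local_field measure \<Rightarrow> bool" where
  "haar_measure \<mu> \<longleftrightarrow> sets \<mu> = sets borel \<and> (\<forall>a. distr \<mu> \<mu> (\<lambda>x. a + x) = \<mu>) \<and>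
     (\<forall>K. compact K \<longrightarrow> emeasure \<mu> K < \<infinity>) \<and> (\<forall>U. open U \<longrightarrow> U \<noteq> {} \<longrightarrow> 0 < emeasure \<mu> U)"

definition self_dual_haar ::
    "('f::nonarch_local_field \<Rightarrow> complex) \<Rightarrow> 'f measure \<Rightarrow> bool" where
  "self_dual_haar \<psi> \<mu> \<longleftrightarrow> haar_measure \<mu> \<and>
     (\<forall>f. schwartz_bruhat f \<longrightarrow>
        (\<forall>x. (LINT y|\<mu>. (LINT z|\<mu>. f z * \<psi> (y * z)) * \<psi> (x * y)) = f (- x)))"

definition mult_measure :: "'f::nonarch_local_field measure \<Rightarrow> 'f measure" where
  "mult_measure \<mu> =
     restrict_space (density \<mu> (\<lambda>x. ennreal (inverse (nabs x)))) (UNIV - {0})"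

definition matrix_measure ::
    "'f::nonarch_local_field measure \<Rightarrow> ('f^'n^'n::finite) measure" where
  "matrix_measure \<mu> = distr (Pi\<^sub>M UNIV (\<lambda>_::'n \<times> 'n. \<mu>)) borel (\<lambda>a. \<chi> i j. a (i, j))"

definition GL :: "('f::nonarch_local_field^'n^'n::finite) set" where
  "GL = {g. invertible g}"

definition gl_measure ::
    "'f::nonarch_local_field measure \<Rightarrow> ('f^'n^'n::finite) measure" where
  "gl_measure \<mu> =
     restrict_space
       (density (matrix_measure \<mu>) (\<lambda>g. ennreal (nabs (det g) powi (- int CARD('n))))) GL"

text \<open>The family of measures \<open>d\<^sub>x g\<close> on the fibres of the determinant. Invariance determines each
  \<open>d\<^sub>x g\<close> up to a scalar, and the integration formula determines these scalars for almost every
  \<open>x\<close>; the last clause (continuity in \<open>x\<close> of the integrals of locally constant compactly supported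
  functions on \<open>GL\<^sub>n\<close>) is what makes the normalization well defined at every single \<open>x\<close>.
  A Schwartz--Bruhat function on all matrices that vanishes outside \<open>GL\<^sub>n\<close> has compact support
  contained in \<open>GL\<^sub>n\<close>, because the support of a locally constant function is open and closed.\<close>

definition det_fibre_measures ::
    "'f::nonarch_local_field measure \<Rightarrow> ('f \<Rightarrow> ('f^'n^'n::finite) measure) \<Rightarrow> bool" where
  "det_fibre_measures \<mu> D \<longleftrightarrow>
     (\<forall>x. x \<noteq> 0 \<longrightarrow>
        sets (D x) = sets (restrict_space borel {g. det g = x}) \<and>
        (\<forall>K. compact K \<longrightarrow> K \<subseteq> {g. det g = x} \<longrightarrow> emeasure (D x) K < \<infinity>) \<and>
        (\<forall>h. det h = 1 \<longrightarrow>
           distr (D x) (D x) (\<lambda>g. h ** g) = D x \<and> distr (D x) (D x) (\<lambda>g. g ** h) = D x)) \<and>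
     (\<forall>f\<in>borel_measurable (gl_measure \<mu>).
        (\<integral>\<^sup>+ g. f g \<partial>gl_measure \<mu>) = (\<integral>\<^sup>+ x. (\<integral>\<^sup>+ g. f g \<partial>D x) \<partial>mult_measure \<mu>)) \<and>
     (\<forall>f. schwartz_bruhat f \<longrightarrow> (\<forall>g. g \<notin> GL \<longrightarrow> f g = 0) \<longrightarrow>
        continuous_on (UNIV - {0}) (\<lambda>x. LINT g|D x. f g))"


section \<open>Smooth representations of \<open>GL\<^sub>n\<close>\<close>

text \<open>A representation acts on the complex vector space given by the type \<open>'v\<close> with scalar
  multiplication \<open>smul\<close>. Here and for all functions on \<open>GL\<^sub>n\<close> below, values at singular
  matrices are irrelevant.\<close>

definition smooth_representation ::
    "(complex \<Rightarrow> 'v::ab_group_add \<Rightarrow> 'v) \<Rightarrow>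
     ('f::nonarch_local_field^'n^'n::finite \<Rightarrow> 'v \<Rightarrow> 'v) \<Rightarrow> bool" where
  "smooth_representation smul \<pi> \<longleftrightarrow>
     vector_space smul \<and>
     (\<forall>g\<in>GL. Vector_Spaces.linear smul smul (\<pi> g)) \<and>
     \<pi> (mat 1) = id \<and>
     (\<forall>g\<in>GL. \<forall>h\<in>GL. \<pi> (g ** h) = \<pi> g \<circ> \<pi> h) \<and>
     (\<forall>v. open {g\<in>GL. \<pi> g v = v})"

definition irreducible_smooth_representation ::
    "(complex \<Rightarrow> 'v::ab_group_add \<Rightarrow> 'v) \<Rightarrow>
     ('f::nonarch_local_field^'n^'n::finite \<Rightarrow> 'v \<Rightarrow> 'v) \<Rightarrow> bool" where
  "irreducible_smooth_representation smul \<pi> \<longleftrightarrow>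
     smooth_representation smul \<pi> \<and> (UNIV :: 'v set) \<noteq> {0} \<and>
     (\<forall>W. module.subspace smul W \<longrightarrow> (\<forall>g\<in>GL. \<pi> g ` W \<subseteq> W) \<longrightarrow> W = {0} \<or> W = UNIV)"

definition twist ::
    "(complex \<Rightarrow> 'v::ab_group_add \<Rightarrow> 'v) \<Rightarrow> ('f::nonarch_local_field \<Rightarrow> complex) \<Rightarrow>
     ('f^'n^'n::finite \<Rightarrow> 'v \<Rightarrow> 'v) \<Rightarrow> 'f^'n^'n \<Rightarrow> 'v \<Rightarrow> 'v" where
  "twist smul chi \<pi> g v = smul (chi (det g)) (\<pi> g v)"

text \<open>The action on linear functionals, and the contragredient space of smooth functionals.\<close>

definition dual_action ::
    "('f::nonarch_local_field^'n^'n::finite \<Rightarrow> 'v \<Rightarrow> 'v) \<Rightarrow>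
     'f^'n^'n \<Rightarrow> ('v \<Rightarrow> complex) \<Rightarrow> 'v \<Rightarrow> complex" where
  "dual_action \<pi> g \<xi> v = \<xi> (\<pi> (matrix_inv g) v)"

definition smooth_dual ::
    "(complex \<Rightarrow> 'v::ab_group_add \<Rightarrow> 'v) \<Rightarrow>
     ('f::nonarch_local_field^'n^'n::finite \<Rightarrow> 'v \<Rightarrow> 'v) \<Rightarrow> ('v \<Rightarrow> complex) set" where
  "smooth_dual smul \<pi> =
     {\<xi>. Vector_Spaces.linear smul (*) \<xi> \<and> open {g\<in>GL. dual_action \<pi> g \<xi> = \<xi>}}"

text \<open>Matrix coefficients of \<open>\<pi>\<close> and of its contragredient, both taken with respect to the
  canonical pairing between the space of \<open>\<pi>\<close> and its smooth dual: they are the finite sums of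
  functions \<open>g \<mapsto> \<langle>\<pi>(g) v, \<xi>\<rangle>\<close> and \<open>g \<mapsto> \<langle>v, \<pi>\<^sup>\<or>(g) \<xi>\<rangle>\<close>, respectively (scalars are
  absorbed into \<open>v\<close>).\<close>

definition matrix_coefficients ::
    "(complex \<Rightarrow> 'v::ab_group_add \<Rightarrow> 'v) \<Rightarrow>
     ('f::nonarch_local_field^'n^'n::finite \<Rightarrow> 'v \<Rightarrow> 'v) \<Rightarrow> ('f^'n^'n \<Rightarrow> complex) set" where
  "matrix_coefficients smul \<pi> =
     {\<phi>. \<exists>(N::nat) v \<xi>. (\<forall>i<N. \<xi> i \<in> smooth_dual smul \<pi>) \<and>
           (\<forall>g\<in>GL. \<phi> g = (\<Sum>i<N. \<xi> i (\<pi> g (v i))))}"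

definition contragredient_coefficients ::
    "(complex \<Rightarrow> 'v::ab_group_add \<Rightarrow> 'v) \<Rightarrow>
     ('f::nonarch_local_field^'n^'n::finite \<Rightarrow> 'v \<Rightarrow> 'v) \<Rightarrow> ('f^'n^'n \<Rightarrow> complex) set" where
  "contragredient_coefficients smul \<pi> =
     {\<phi>. \<exists>(N::nat) v \<xi>. (\<forall>i<N. \<xi> i \<in> smooth_dual smul \<pi>) \<and>
           (\<forall>g\<in>GL. \<phi> g = (\<Sum>i<N. dual_action \<pi> g (\<xi> i) (v i)))}"


section \<open>Godement--Jacquet theory\<close>

definition vee :: "('f::nonarch_local_field^'n^'n::finite \<Rightarrow> complex) \<Rightarrow> 'f^'n^'n \<Rightarrow> complex" where
  "vee f g = f (matrix_inv g)"

definition matrix_fourier ::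
    "'f::nonarch_local_field measure \<Rightarrow> ('f \<Rightarrow> complex) \<Rightarrow>
     ('f^'n^'n::finite \<Rightarrow> complex) \<Rightarrow> 'f^'n^'n \<Rightarrow> complex" where
  "matrix_fourier \<mu> \<psi> f x = (LINT y|matrix_measure \<mu>. f y * \<psi> (trace (x ** y)))"

definition zeta_integrand ::
    "('f::nonarch_local_field^'n^'n::finite \<Rightarrow> complex) \<Rightarrow> ('f^'n^'n \<Rightarrow> complex) \<Rightarrow>
     complex \<Rightarrow> 'f^'n^'n \<Rightarrow> complex" where
  "zeta_integrand f \<phi> s g =
     f g * \<phi> g * of_real (nabs (det g)) powr (s + (of_nat CARD('n) - 1) / 2)"

text \<open>\<open>Z\<close> is the zeta integral \<open>Z(s, f, \<phi>)\<close>: absolutely convergent for \<open>Re s\<close> large, and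
  extended meromorphically to the whole plane.\<close>

definition is_zeta_function ::
    "'f::nonarch_local_field measure \<Rightarrow> ('f^'n^'n::finite \<Rightarrow> complex) \<Rightarrow>
     ('f^'n^'n \<Rightarrow> complex) \<Rightarrow> (complex \<Rightarrow> complex) \<Rightarrow> bool" where
  "is_zeta_function \<mu> f \<phi> Z \<longleftrightarrow> Z meromorphic_on UNIV \<and>
     (\<exists>c. \<forall>s. Re s > c \<longrightarrow>
        integrable (gl_measure \<mu>) (zeta_integrand f \<phi> s) \<and>
        Z s = (LINT g|gl_measure \<mu>. zeta_integrand f \<phi> s g))"

text \<open>The gamma factor of \<open>\<tau>\<close> is the meromorphic function determined by the local functional
  equation \<open>Z(1 - s, F f, \<phi>\<^sup>\<or>) = \<gamma>(s) Z(s, f, \<phi>)\<close>, \<open>F\<close> the Fourier transform. An identity of meromorphic functions is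
  required away from a discrete set; the value of \<open>\<gamma>\<close> itself is fixed everywhere by the library
  convention for poles (\<^const>\<open>nicely_meromorphic_on\<close>).\<close>

definition godement_jacquet_gamma ::
    "'f::nonarch_local_field measure \<Rightarrow> ('f \<Rightarrow> complex) \<Rightarrow>
     (complex \<Rightarrow> 'v::ab_group_add \<Rightarrow> 'v) \<Rightarrow> ('f^'n^'n::finite \<Rightarrow> 'v \<Rightarrow> 'v) \<Rightarrow>
     (complex \<Rightarrow> complex) \<Rightarrow> bool" where
  "godement_jacquet_gamma \<mu> \<psi> smul \<tau> \<gamma> \<longleftrightarrow> \<gamma> nicely_meromorphic_on UNIV \<and>
     (\<forall>f \<phi>. schwartz_bruhat f \<longrightarrow> \<phi> \<in> matrix_coefficients smul \<tau> \<longrightarrow>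
        (\<exists>Z Z'. is_zeta_function \<mu> f \<phi> Z \<and>
                is_zeta_function \<mu> (matrix_fourier \<mu> \<psi> f) (vee \<phi>) Z' \<and>
                (\<forall>\<^sub>\<approx>s\<in>UNIV. Z' (1 - s) = \<gamma> s * Z s)))"


section \<open>The kernel function and principal value integrals\<close>

definition Phi_GJ ::
    "('f::nonarch_local_field \<Rightarrow> complex) \<Rightarrow> 'f^'n^'n::finite \<Rightarrow> complex" where
  "Phi_GJ \<psi> g = \<psi> (trace g) * of_real (nabs (det g) powr (real CARD('n) / 2))"

definition K_sub :: "nat \<Rightarrow> ('f::nonarch_local_field^'n^'n::finite) set" where
  "K_sub l = {g. \<forall>i j. (g - mat 1) $ i $ j \<in> prime_power (int l)}"

definition c_fun ::
    "'f::nonarch_local_field measure \<Rightarrow> nat \<Rightarrow> 'f^'n^'n::finite \<Rightarrow> complex" where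
  "c_fun \<mu> l g =
     of_real (inverse (measure (gl_measure \<mu>) (K_sub l :: ('f^'n^'n) set))) * indicator (K_sub l) g"

definition gl_convolution ::
    "'f::nonarch_local_field measure \<Rightarrow> ('f^'n^'n::finite \<Rightarrow> complex) \<Rightarrow>
     ('f^'n^'n \<Rightarrow> complex) \<Rightarrow> 'f^'n^'n \<Rightarrow> complex" where
  "gl_convolution \<mu> f1 f2 g = (LINT h|gl_measure \<mu>. f1 h * f2 (matrix_inv h ** g))"

definition pi_kernel ::
    "'f::nonarch_local_field measure \<Rightarrow> ('f \<Rightarrow> ('f^'n^'n::finite) measure) \<Rightarrow> ('f \<Rightarrow> complex) \<Rightarrow>
     ('f^'n^'n \<Rightarrow> complex) \<Rightarrow> 'f \<Rightarrow> complex" where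
  "pi_kernel \<mu> D \<psi> \<phi> x =
     lim (\<lambda>l. LINT g|D x. gl_convolution \<mu> (Phi_GJ \<psi>) (vee (c_fun \<mu> l)) g * \<phi> g)"

definition has_pv_integral ::
    "'f::nonarch_local_field measure \<Rightarrow> ('f \<Rightarrow> complex) \<Rightarrow> complex \<Rightarrow> bool" where
  "has_pv_integral \<mu> f L \<longleftrightarrow>
     (\<forall>m. set_integrable (mult_measure \<mu>) (shell m) f) \<and>
     (\<lambda>l::nat. \<Sum>m\<in>{- int l..int l}. LINT x:shell m|mult_measure \<mu>. f x) \<longlonglongrightarrow> L"

end

theory Submission
  imports Defs
begin

text \<open>
  The gamma factor is read off from the local functional equation by testing it on
  \<open>f = \<cc>\<^sub>l\<close>, the normalized indicator of the congruence subgroup \<open>K\<^sub>l\<close>, and on the coefficient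
  \<open>\<beta>(g) = \<chi>(det g) \<phi>(g\<^sup>-\<^sup>1)\<close> of \<open>\<pi> \<otimes> \<chi>(det)\<close>. For large \<open>l\<close> the coefficient is \<open>1\<close> on \<open>K\<^sub>l\<close>, so
  \<open>Z(s, f, \<beta>) = 1\<close> and \<open>\<gamma>(s)\<close> continues the zeta integral \<open>Z(1 - s, F f, \<beta>\<^sup>\<or>)\<close>. The Fourier transform
  of \<open>\<cc>\<^sub>l\<close> is \<open>\<psi>(tr g)\<close> cut off to \<open>M\<^sub>n(\<pp>\<^sup>-\<^sup>l)\<close> (\<open>matrix_fourier_c_fun\<close>), and \<open>\<Phi>\<^sub>G\<^sub>J * \<cc>\<^sub>l\<^sup>\<or>\<close> is the same
  function times \<open>|det g|\<^sup>n\<^sup>/\<^sup>2\<close> (\<open>gl_convolution_Phi_GJ\<close>). Hence, for \<open>Re s\<close> small, \<open>\<gamma>(s + 1/2)\<close> is the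
  integral over \<open>GL\<^sub>n\<close> of the \<open>l\<close>-th truncated kernel integrand against \<open>\<chi>\<^sub>s(det g)\<^sup>-\<^sup>1\<close>. Sorted by
  \<open>|det g|\<close> it is a Laurent series in \<open>q\<^sup>s\<close> with finitely many negative powers, whose terms are integrals
  over the shells \<open>|det g| = q\<^sup>-\<^sup>j\<close>.

  What remains is an interchange: in the kernel function the limit in \<open>l\<close> is taken at each \<open>x\<close> before
  integrating over \<open>x\<close>. It is justified by stationary phase. Raising the truncation to \<open>r\<close> adds the annulus
  of matrices of norm \<open>q\<^sup>r\<close>, which is cut into cosets \<open>g\<^sub>0 + M\<^sub>n(\<pp>\<^sup>-\<^sup>m)\<close> with \<open>m = \<lceil>r/2\<rceil>\<close>. On such a
  coset, right multiplication by \<open>1 + X\<close> with \<open>X \<in> M\<^sub>n(\<pp>\<^sup>m)\<close> multiplies \<open>\<psi>(tr g)\<close> by the constant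
  \<open>\<psi>(tr g\<^sub>0 X)\<close>. Taking \<open>1 + X\<close> to be a transvection, or a conjugate of one, shows that the integral over
  the coset in the fibre \<open>det g = x\<close> vanishes unless the coset contains a scalar matrix
  (\<open>annulus_coset_zero_or_scalar\<close>). Scalar cosets have \<open>|det g| = q\<^sup>n\<^sup>r\<close>, so for fixed \<open>x\<close> only finitely
  many \<open>r\<close> matter, and the limit defining the kernel is attained at a finite level that depends only on
  \<open>|x|\<close> (\<open>phase_fibre_stable\<close>). On the shell \<open>|det g| = q\<^sup>n\<^sup>r\<close> itself the scalar cosets do contribute to
  individual fibres, but their contribution to the integral over the shell is zero, because only the phase
  \<open>\<psi>(tr g)\<close> varies on them (\<open>phase_scalar_coset_zero\<close>). So the integral of the kernel over every shell is
  the corresponding term of the Laurent series at one fixed level (\<open>kernel_shell_integral\<close>), and the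
  principal value is the sum of that series.

  The identity with the gamma factor is first obtained off a discrete set; as \<open>\<gamma>\<close> takes its limit value
  wherever the limit is finite, it extends to the whole half-plane.
\<close>

section \<open>Arithmetic of a non-Archimedean local field\<close>

abbreviation resq :: "'f::nonarch_local_field itself \<Rightarrow> real" where
  "resq F \<equiv> real (residue_card F)"

lemma nabs_0 [simp]: "nabs (0::'f::nonarch_local_field) = 0"
  using dist_nabs[of "0::'f" 0] by simp

lemma nabs_nonneg [simp]: "0 \<le> nabs (x::'f::nonarch_local_field)"
  using dist_nabs[of x 0] by (metis diff_zero zero_le_dist)

lemma nabs_eq_0_iff [simp]: "nabs (x::'f::nonarch_local_field) = 0 \<longleftrightarrow> x = 0"
  using dist_nabs[of x 0] by (metis diff_zero dist_eq_0_iff)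

lemma nabs_pos: "x \<noteq> 0 \<Longrightarrow> 0 < nabs (x::'f::nonarch_local_field)"
  using nabs_nonneg[of x] nabs_eq_0_iff[of x] by linarith

lemma nabs_1 [simp]: "nabs (1::'f::nonarch_local_field) = 1"
proof -
  have "nabs (1::'f) * nabs (1::'f) = nabs (1::'f)" using nabs_mult[of "1::'f" 1] by simp
  moreover have "nabs (1::'f) \<noteq> 0" by simp
  ultimately show ?thesis by simp
qed

lemma nabs_minus [simp]: "nabs (- x) = nabs (x::'f::nonarch_local_field)"
  using dist_nabs[of x 0] dist_nabs[of 0 x] by (simp add: dist_commute)

lemma nabs_diff_commute: "nabs (x - y) = nabs (y - (x::'f::nonarch_local_field))"
  using dist_nabs[of x y] dist_nabs[of y x] by (simp add: dist_commute)

lemma nabs_inverse: "nabs (inverse x) = inverse (nabs (x::'f::nonarch_local_field))"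
proof (cases "x = 0")
  case False
  then have "nabs x * nabs (inverse x) = 1" by (metis nabs_mult nabs_1 right_inverse)
  then show ?thesis by (metis inverse_unique)
qed simp

lemma nabs_divide: "nabs (x / y) = nabs x / nabs (y::'f::nonarch_local_field)"
  by (simp add: divide_inverse nabs_mult nabs_inverse)

lemma nabs_power: "nabs (x ^ k) = nabs (x::'f::nonarch_local_field) ^ k"
  by (induction k) (simp_all add: nabs_mult)

text \<open>\<open>0\<close> and \<open>1\<close> lie in different residue classes.\<close>
lemma residue_card_ge_2: "2 \<le> residue_card TYPE('f::nonarch_local_field)"
proof -
  let ?c = "\<lambda>x::'f. {y. nabs (y - x) < 1}"
  have "?c 0 \<noteq> ?c 1" using nabs_1[where 'f='f] by (auto simp: set_eq_iff intro!: exI[of _ "0::'f"])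
  moreover have "?c 0 \<in> ?c ` {x. nabs x \<le> 1}" "?c 1 \<in> ?c ` {x. nabs x \<le> 1}"
    by (intro imageI; simp)+
  ultimately have "card {?c 0, ?c 1} \<le> residue_card TYPE('f)"
    unfolding residue_card_def using finite_residue_field[where 'a='f]
    by (intro card_mono) auto
  then show ?thesis using \<open>?c 0 \<noteq> ?c 1\<close> by simp
qed

lemma resq_gt_1: "1 < resq TYPE('f::nonarch_local_field)"
  using residue_card_ge_2[where 'f='f] by linarith

lemma resq_pos: "0 < resq TYPE('f::nonarch_local_field)"
  using resq_gt_1[where 'f='f] by linarith

lemma nabs_eq_powi:
  fixes x :: "'f::nonarch_local_field"
  assumes "x \<noteq> 0"
  obtains k where "nabs x = resq TYPE('f) powi k"
  using value_group[where 'a='f] assms unfolding residue_card_def by blast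

lemma ex_nabs_powi:
  obtains x :: "'f::nonarch_local_field" where "x \<noteq> 0" "nabs x = resq TYPE('f) powi k"
proof -
  have "resq TYPE('f) powi k \<in> nabs ` (UNIV - {0::'f})"
    unfolding value_group residue_card_def by blast
  then show ?thesis using that by (metis DiffE imageE singletonI)
qed

lemma resq_powi_le_iff:
  "resq TYPE('f::nonarch_local_field) powi a \<le> resq TYPE('f) powi b \<longleftrightarrow> a \<le> b"
  using resq_gt_1[where 'f='f] power_int_increasing[of a b "resq TYPE('f)"]
    power_int_strict_increasing[of b a "resq TYPE('f)"] by linarith

lemma resq_powi_less_iff:
  "resq TYPE('f::nonarch_local_field) powi a < resq TYPE('f) powi b \<longleftrightarrow> a < b"
  using resq_powi_le_iff[where 'f='f, of b a] by auto

lemma resq_powi_inject: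
  "resq TYPE('f::nonarch_local_field) powi a = resq TYPE('f) powi b \<longleftrightarrow> a = b"
  using resq_powi_le_iff[where 'f='f, of b a] resq_powi_le_iff[where 'f='f, of a b] by linarith

lemma resq_powi_pos: "0 < resq TYPE('f::nonarch_local_field) powi a"
  using resq_pos[where 'f='f] by simp

lemma resq_powi_add:
  "resq TYPE('f::nonarch_local_field) powi (a + b) = resq TYPE('f) powi a * resq TYPE('f) powi b"
  using resq_pos[where 'f='f] by (simp add: power_int_add)

lemma prime_power_0_mem [simp]: "0 \<in> prime_power k"
  using resq_powi_pos by (simp add: prime_power_def less_imp_le)

lemma prime_power_uminus: "x \<in> prime_power k \<Longrightarrow> - x \<in> prime_power k"
  by (simp add: prime_power_def)

lemma prime_power_add: "x \<in> prime_power k \<Longrightarrow> y \<in> prime_power k \<Longrightarrow> x + y \<in> prime_power k"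
  using nabs_ultrametric[of x y] by (auto simp: prime_power_def)

lemma prime_power_diff: "x \<in> prime_power k \<Longrightarrow> y \<in> prime_power k \<Longrightarrow> x - y \<in> prime_power k"
  using prime_power_add[of x k "- y"] prime_power_uminus[of y k] by simp

lemma prime_power_diff_commute: "x - y \<in> prime_power k \<longleftrightarrow> y - x \<in> prime_power k"
  by (simp add: prime_power_def nabs_diff_commute)

lemma prime_power_sum: "(\<And>i. i \<in> I \<Longrightarrow> f i \<in> prime_power k) \<Longrightarrow> sum f I \<in> prime_power k"
  by (induction I rule: infinite_finite_induct) (auto intro: prime_power_add)

lemma prime_power_mult:
  fixes x y :: "'a::nonarch_local_field"
  assumes "x \<in> prime_power j" "y \<in> prime_power k"
  shows "x * y \<in> prime_power (j + k)"
proof -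
  have "nabs x * nabs y \<le> resq TYPE('a) powi (- j) * resq TYPE('a) powi (- k)"
    using assms less_imp_le[OF resq_powi_pos[where 'f='a]] by (intro mult_mono) (auto simp: prime_power_def)
  also have "\<dots> = resq TYPE('a) powi (- (j + k))" by (simp flip: resq_powi_add)
  finally show ?thesis by (simp add: prime_power_def nabs_mult)
qed

lemma prime_power_antimono: "j \<le> k \<Longrightarrow> prime_power k \<subseteq> (prime_power j :: 'a::nonarch_local_field set)"
  using resq_powi_le_iff[where 'f='a, of "- k" "- j"] by (auto simp: prime_power_def intro: order_trans)

lemma one_mem_prime_power [simp]: "1 \<in> prime_power 0"
  by (simp add: prime_power_def)

lemma prime_power_prod:
  assumes "finite I" "\<And>i. i \<in> I \<Longrightarrow> f i \<in> prime_power k"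
  shows "prod f I \<in> prime_power (int (card I) * k)"
  using assms
proof (induction I rule: finite_induct)
  case (insert i I)
  then show ?case using prime_power_mult[of "f i" k "prod f I" "int (card I) * k"]
    by (simp add: algebra_simps)
qed simp

text \<open>The value group is discrete, so leaving an ideal costs a full factor of the residue
  cardinality.\<close>
lemma not_mem_prime_power:
  fixes x :: "'f::nonarch_local_field"
  assumes "x \<notin> prime_power k"
  shows "resq TYPE('f) powi (1 - k) \<le> nabs x"
proof -
  have "x \<noteq> 0" using assms by auto
  then obtain j where j: "nabs x = resq TYPE('f) powi j" by (rule nabs_eq_powi)
  then have "- k < j" using assms resq_powi_le_iff[where 'f='f, of j "-k"] by (simp add: prime_power_def)
  then show ?thesis using resq_powi_le_iff[where 'f='f, of "1-k" j] j by simp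
qed

text \<open>The isosceles triangle principle.\<close>
lemma nabs_eq_if_diff_less:
  fixes x y :: "'f::nonarch_local_field"
  assumes "nabs (x - y) < nabs y"
  shows "nabs x = nabs y"
proof -
  have "nabs x \<le> max (nabs (x - y)) (nabs y)" using nabs_ultrametric[of "x - y" y] by simp
  moreover have "nabs y \<le> max (nabs (y - x)) (nabs x)" using nabs_ultrametric[of "y - x" x] by simp
  ultimately show ?thesis using assms nabs_diff_commute[of x y] by linarith
qed

lemma prime_power_unit_scale:
  fixes c x :: "'f::nonarch_local_field"
  assumes "nabs c = resq TYPE('f) powi (- j)"
  shows "c * x \<in> prime_power (j + k) \<longleftrightarrow> x \<in> prime_power k"
proof -
  have "- (j + k) = - j + - k" by simp
  then show ?thesis using resq_powi_pos[where 'f='f, of "-j"]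
    unfolding prime_power_def by (simp only: mem_Collect_eq nabs_mult assms resq_powi_add mult_le_cancel_left_pos)
qed


section \<open>Topology of the field\<close>

lemma resq_powi_small:
  assumes "0 < e"
  obtains k :: nat where "resq TYPE('f::nonarch_local_field) powi (- int k) < e"
proof -
  obtain k where "(inverse (resq TYPE('f))) ^ k < e"
    using real_arch_pow_inv[OF assms, of "inverse (resq TYPE('f))"] resq_gt_1[where 'f='f]
    by (auto simp: inverse_less_1_iff)
  then show ?thesis using that[of k] by (simp add: power_int_minus power_inverse)
qed

lemma resq_powi_large:
  obtains k :: nat where "e < resq TYPE('f::nonarch_local_field) powi (int k)"
proof -
  obtain k where "e < resq TYPE('f) ^ k"
    using real_arch_pow[of "resq TYPE('f)" e] resq_gt_1[where 'f='f] by auto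
  then show ?thesis using that[of k] by simp
qed

lemma open_coset: "open {y::'f::nonarch_local_field. y - x \<in> prime_power k}"
  unfolding open_dist
proof
  fix y :: 'f assume "y \<in> {y. y - x \<in> prime_power k}"
  then have y: "y - x \<in> prime_power k" by simp
  have "z - x \<in> prime_power k" if "dist z y < resq TYPE('f) powi (- k)" for z
    using prime_power_add[of "z - y" k "y - x"] y that by (simp add: prime_power_def dist_nabs)
  then show "\<exists>e>0. \<forall>z. dist z y < e \<longrightarrow> z \<in> {y. y - x \<in> prime_power k}"
    using resq_powi_pos[where 'f='f, of "-k"] by blast
qed

lemma coset_basis:
  fixes x :: "'f::nonarch_local_field"
  assumes "open U" "x \<in> U"
  obtains k :: nat where "{y. y - x \<in> prime_power (int k)} \<subseteq> U"
proof -
  obtain e where e: "e > 0" "\<And>y. dist y x < e \<Longrightarrow> y \<in> U" using assms unfolding open_dist by blast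
  obtain k where k: "resq TYPE('f) powi (- int k) < e" using resq_powi_small[OF e(1)] by blast
  have "{y. y - x \<in> prime_power (int k)} \<subseteq> U"
    using k by (auto intro!: e(2) simp: prime_power_def dist_nabs)
  then show ?thesis by (rule that)
qed

lemma open_cosetI:
  fixes S :: "'f::nonarch_local_field set"
  assumes "\<And>x. x \<in> S \<Longrightarrow> \<exists>k. {y. y - x \<in> prime_power k} \<subseteq> S"
  shows "open S"
proof (subst open_subopen, intro ballI)
  fix x assume "x \<in> S"
  then obtain k where "{y. y - x \<in> prime_power k} \<subseteq> S" using assms by blast
  then show "\<exists>T. open T \<and> x \<in> T \<and> T \<subseteq> S"
    by (intro exI[of _ "{y. y - x \<in> prime_power k}"]) (auto simp: open_coset)
qed

text \<open>With the next two instances, determinants, traces and matrix products are continuous by the general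
  rules for topological rings.\<close>
instance nonarch_local_field \<subseteq> topological_ab_group_add
proof
  fix a b :: "'a::nonarch_local_field"
  show "((\<lambda>x. fst x + snd x) \<longlongrightarrow> a + b) (nhds a \<times>\<^sub>F nhds b)"
    unfolding nhds_prod[symmetric]
  proof (rule tendstoI)
    fix e :: real assume e: "e > 0"
    have "eventually (\<lambda>x. dist x a < e) (nhds a)" "eventually (\<lambda>x. dist x b < e) (nhds b)"
      using e by (auto simp: eventually_nhds_metric)
    then have "eventually (\<lambda>x. dist (fst x) a < e \<and> dist (snd x) b < e) (nhds a \<times>\<^sub>F nhds b)"
      unfolding eventually_prod_filter by fastforce
    then show "eventually (\<lambda>x. dist (fst x + snd x) (a + b) < e) (nhds (a, b))"
      unfolding nhds_prod
    proof (rule eventually_mono)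
      fix x :: "'a \<times> 'a" assume x: "dist (fst x) a < e \<and> dist (snd x) b < e"
      have "nabs ((fst x - a) + (snd x - b)) \<le> max (nabs (fst x - a)) (nabs (snd x - b))"
        by (rule nabs_ultrametric)
      also have "\<dots> < e" using x by (simp add: dist_nabs)
      finally show "dist (fst x + snd x) (a + b) < e" by (simp add: dist_nabs algebra_simps)
    qed
  qed
  show "(uminus \<longlongrightarrow> - a) (nhds a)"
  proof (rule tendstoI)
    fix e :: real assume e: "e > 0"
    have "dist (- x) (- a) = dist x a" for x :: 'a
      using nabs_minus[of "x - a"] by (simp add: dist_nabs)
    then show "eventually (\<lambda>x. dist (- x) (- a) < e) (nhds a)"
      using e by (auto simp: eventually_nhds_metric)
  qed
qed

instance nonarch_local_field \<subseteq> topological_comm_monoid_mult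
proof
  fix a b :: "'a::nonarch_local_field"
  show "((\<lambda>x. fst x * snd x) \<longlongrightarrow> a * b) (nhds a \<times>\<^sub>F nhds b)"
    unfolding nhds_prod[symmetric]
  proof (rule tendstoI)
    fix e :: real assume e: "e > 0"
    define B where "B = max 1 (max (nabs a) (nabs b))"
    define d where "d = min 1 (e / B)"
    have B: "1 \<le> B" "nabs a \<le> B" "nabs b \<le> B" by (auto simp: B_def)
    have d: "0 < d" "d \<le> 1" "d * B \<le> e" using e B(1) by (auto simp: d_def min_def field_simps)
    have "eventually (\<lambda>x. dist x a < d) (nhds a)" "eventually (\<lambda>x. dist x b < d) (nhds b)"
      using d by (auto simp: eventually_nhds_metric)
    then have "eventually (\<lambda>x. dist (fst x) a < d \<and> dist (snd x) b < d) (nhds a \<times>\<^sub>F nhds b)"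
      unfolding eventually_prod_filter by fastforce
    then show "eventually (\<lambda>x. dist (fst x * snd x) (a * b) < e) (nhds (a, b))"
      unfolding nhds_prod
    proof (rule eventually_mono)
      fix x :: "'a \<times> 'a" assume x: "dist (fst x) a < d \<and> dist (snd x) b < d"
      have "nabs (snd x) \<le> max (nabs (snd x - b)) (nabs b)"
        using nabs_ultrametric[of "snd x - b" b] by simp
      also have "\<dots> \<le> B" using x d B by (auto simp: dist_nabs)
      finally have s: "nabs (snd x) \<le> B" .
      have "nabs (fst x - a) * nabs (snd x) \<le> nabs (fst x - a) * B" using s by (simp add: mult_left_mono)
      also have "\<dots> < d * B" using x B by (simp add: dist_nabs)
      finally have "nabs (fst x - a) * nabs (snd x) < e" using d by linarith
      moreover have "nabs a * nabs (snd x - b) < e"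
      proof -
        have "nabs a * nabs (snd x - b) \<le> B * nabs (snd x - b)" using B by (simp add: mult_right_mono)
        also have "\<dots> < B * d" using x B by (simp add: dist_nabs)
        finally show ?thesis using d by (simp add: mult.commute)
      qed
      ultimately have "max (nabs (fst x - a) * nabs (snd x)) (nabs a * nabs (snd x - b)) < e" by simp
      moreover have "(fst x - a) * snd x + a * (snd x - b) = fst x * snd x - a * b"
        by (simp add: algebra_simps)
      ultimately have "nabs (fst x * snd x - a * b) < e"
        using nabs_ultrametric[of "(fst x - a) * snd x" "a * (snd x - b)"] unfolding nabs_mult by simp linarith
      then show "dist (fst x * snd x) (a * b) < e" by (simp add: dist_nabs)
    qed
  qed
qed

text \<open>Each layer \<open>\<pp>\<^sup>k / \<pp>\<^sup>k\<^sup>+\<^sup>1\<close> is a scaled copy of the residue field.\<close>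
lemma prime_power_layer:
  fixes c :: "'f::nonarch_local_field"
  assumes c: "nabs c = resq TYPE('f) powi (- k)"
  defines "R \<equiv> (\<lambda>x::'f. {y. nabs (y - x) < 1}) ` {x. nabs x \<le> 1}"
  shows "prime_power k = (\<Union>A\<in>R. (*) c ` A)"
    and "disjoint_family_on (\<lambda>A. (*) c ` A) R"
    and "A \<in> R \<Longrightarrow> \<exists>a. (*) c ` A = {y. y - a \<in> prime_power (k + 1)}"
proof -
  have c0: "c \<noteq> 0" using c resq_powi_pos[where 'f='f, of "-k"] by auto
  have lt1: "nabs (z::'f) < 1 \<longleftrightarrow> z \<in> prime_power 1" for z
  proof -
    have "z \<notin> prime_power 1 \<Longrightarrow> 1 \<le> nabs z" using not_mem_prime_power[of z 1] by simp
    moreover have "z \<in> prime_power 1 \<Longrightarrow> nabs z < 1"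
      using resq_powi_less_iff[where 'f='f, of "-1" 0] by (auto simp: prime_power_def)
    ultimately show ?thesis by fastforce
  qed
  have sc: "c * x \<in> prime_power (k + j) \<longleftrightarrow> x \<in> prime_power j" for x j
    using prime_power_unit_scale[OF c] by simp
  have le1: "nabs (z::'f) \<le> 1 \<longleftrightarrow> z \<in> prime_power 0" for z by (simp add: prime_power_def)
  have res: "nabs (y::'f) \<le> 1" if "nabs (y - x) < 1" "nabs x \<le> 1" for x y
    using nabs_ultrametric[of "y - x" x] that by auto
  show "prime_power k = (\<Union>A\<in>R. (*) c ` A)"
  proof (intro equalityI subsetI)
    fix y :: 'f assume y: "y \<in> prime_power k"
    have "y = c * (y / c)" using c0 by simp
    then have "nabs (y / c) \<le> 1" using sc[of "y/c" 0] y by (simp add: le1)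
    then have "{z. nabs (z - y/c) < 1} \<in> R" "y / c \<in> {z. nabs (z - y/c) < 1}"
      by (auto simp: R_def)
    with \<open>y = c * (y / c)\<close> show "y \<in> (\<Union>A\<in>R. (*) c ` A)" by blast
  next
    fix y assume "y \<in> (\<Union>A\<in>R. (*) c ` A)"
    then obtain x z where "nabs x \<le> 1" "nabs (z - x) < 1" "y = c * z" by (auto simp: R_def)
    then show "y \<in> prime_power k" using res[of z x] sc[of z 0] by (simp add: le1)
  qed
  have same: "A = B" if AB: "A \<in> R" "B \<in> R" and z: "z \<in> A" "z \<in> B" for A B z
  proof -
    obtain a b where ab: "A = {y. nabs (y - a) < 1}" "B = {y. nabs (y - b) < 1}"
      using AB by (auto simp: R_def)
    have "nabs (y - a) < 1 \<longleftrightarrow> nabs (y - b) < 1" for y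
    proof -
      have d: "a - b \<in> prime_power 1" using prime_power_diff[of "z - b" 1 "z - a"] z ab by (simp add: lt1)
      show ?thesis using prime_power_add[OF _ d, of "y - a"] prime_power_diff[OF _ d, of "y - b"]
        by (auto simp: lt1 algebra_simps)
    qed
    then show ?thesis by (simp add: ab)
  qed
  show "disjoint_family_on (\<lambda>A. (*) c ` A) R"
    unfolding disjoint_family_on_def
  proof (intro ballI impI)
    fix A B assume AB: "A \<in> R" "B \<in> R" "A \<noteq> B"
    have "z = z'" if "c * z = c * z'" for z z' using that c0 by simp
    then show "(*) c ` A \<inter> (*) c ` B = {}" using same[OF AB(1,2)] AB(3) by blast
  qed
  show "\<exists>a. (*) c ` A = {y. y - a \<in> prime_power (k + 1)}" if A: "A \<in> R"
  proof -
    obtain a where a: "A = {y. nabs (y - a) < 1}" using A by (auto simp: R_def)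
    have "(*) c ` A = {y. y - c * a \<in> prime_power (k + 1)}"
    proof (intro equalityI subsetI)
      fix y assume "y \<in> (*) c ` A"
      then show "y \<in> {y. y - c * a \<in> prime_power (k + 1)}"
        using sc[of _ 1] by (auto simp: a lt1 right_diff_distrib[symmetric])
    next
      fix y assume y: "y \<in> {y. y - c * a \<in> prime_power (k + 1)}"
      have e: "y - c * a = c * (y / c - a)" using c0 by (simp add: field_simps)
      then have "y / c \<in> A" using y sc[of "y/c - a" 1] by (simp add: a lt1)
      moreover have "y = c * (y / c)" using c0 by simp
      ultimately show "y \<in> (*) c ` A" by blast
    qed
    then show ?thesis by blast
  qed
qed

text \<open>The finiteness of \<open>\<pp>\<^sup>j / \<pp>\<^sup>j\<^sup>+\<^sup>m\<close>, by refining one layer at a time.\<close>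
lemma prime_power_finite_cover:
  "\<exists>B. finite B \<and> prime_power j \<subseteq> (\<Union>b\<in>B. {y::'f::nonarch_local_field. y - b \<in> prime_power (j + int m)})"
proof (induction m)
  case 0
  show ?case by (rule exI[of _ "{0}"]) simp
next
  case (Suc m)
  then obtain B where B: "finite B"
    "prime_power j \<subseteq> (\<Union>b\<in>B. {y::'f. y - b \<in> prime_power (j + int m)})" by blast
  obtain c :: 'f where c: "nabs c = resq TYPE('f) powi (- (j + int m))" using ex_nabs_powi by metis
  let ?R = "(\<lambda>x::'f. {y. nabs (y - x) < 1}) ` {x. nabs x \<le> 1}"
  obtain f where f: "\<And>A. A \<in> ?R \<Longrightarrow> (*) c ` A = {y. y - f A \<in> prime_power (j + int m + 1)}"
    using prime_power_layer(3)[OF c] by metis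
  have "prime_power j \<subseteq> (\<Union>b\<in>(\<lambda>(b, A). b + f A) ` (B \<times> ?R). {y::'f. y - b \<in> prime_power (j + int (Suc m))})"
  proof
    fix y :: 'f assume "y \<in> prime_power j"
    then obtain b where b: "b \<in> B" "y - b \<in> prime_power (j + int m)" using B by blast
    then obtain A where A: "A \<in> ?R" "y - b \<in> (*) c ` A" using prime_power_layer(1)[OF c] by blast
    then have "y - (b + f A) \<in> prime_power (j + int (Suc m))" using f[OF A(1)] by (simp add: algebra_simps)
    then show "y \<in> (\<Union>b\<in>(\<lambda>(b, A). b + f A) ` (B \<times> ?R). {y::'f. y - b \<in> prime_power (j + int (Suc m))})"
      using b A by auto
  qed
  moreover have "finite ((\<lambda>(b, A). b + f A) ` (B \<times> ?R))"
    using B finite_residue_field[where 'a='f] by blast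
  ultimately show ?case by blast
qed

lemma closed_prime_power: "closed (prime_power k :: 'f::nonarch_local_field set)"
proof -
  have "prime_power k = cball (0::'f) (resq TYPE('f) powi (- k))"
    by (auto simp: prime_power_def dist_nabs)
  then show ?thesis by simp
qed

text \<open>Completeness together with finiteness of the quotients gives compactness.\<close>
lemma compact_prime_power: "compact (prime_power j :: 'f::nonarch_local_field set)"
  unfolding compact_eq_totally_bounded
proof (intro conjI allI impI)
  show "complete (prime_power j :: 'f set)" by (rule closed_prime_power[unfolded complete_eq_closed[symmetric]])
  fix e :: real assume e: "e > 0"
  obtain m where m: "resq TYPE('f) powi (- int m) < e" using resq_powi_small[OF e] by blast
  obtain B where B: "finite B"
    "prime_power j \<subseteq> (\<Union>b\<in>B. {y::'f. y - b \<in> prime_power (j + int (m + nat (- j)))})"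
    using prime_power_finite_cover by blast
  have cb: "{y::'f. y - b \<in> prime_power (j + int (m + nat (- j)))} \<subseteq> ball b e" for b
  proof
    fix y assume "y \<in> {y::'f. y - b \<in> prime_power (j + int (m + nat (- j)))}"
    moreover have "int m \<le> j + int (m + nat (- j))" by simp
    ultimately have "y - b \<in> prime_power (int m)" using prime_power_antimono by blast
    then show "y \<in> ball b e" using m by (simp add: prime_power_def dist_nabs nabs_diff_commute[of b y])
  qed
  have "(\<Union>b\<in>B. {y::'f. y - b \<in> prime_power (j + int (m + nat (- j)))}) \<subseteq> (\<Union>b\<in>B. ball b e)"
    using cb by (intro UN_mono) auto
  with B(2) have "prime_power j \<subseteq> (\<Union>b\<in>B. ball b e)" by (rule order_trans)
  then show "\<exists>k. finite k \<and> (prime_power j :: 'f set) \<subseteq> (\<Union>x\<in>k. ball x e)"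
    using B(1) by (intro exI[of _ B] conjI)
qed

instance nonarch_local_field \<subseteq> heine_borel
proof
  fix f :: "nat \<Rightarrow> 'a::nonarch_local_field"
  assume "bounded (range f)"
  then obtain e where e: "\<And>n. dist 0 (f n) \<le> e" using bounded_any_center[of "range f" 0] by auto
  obtain k where k: "e < resq TYPE('a) powi (int k)" using resq_powi_large by blast
  have "f n \<in> prime_power (- int k)" for n
    using e[of n] k by (simp add: prime_power_def dist_nabs)
  moreover have "seq_compact (prime_power (- int k) :: 'a set)"
    using compact_prime_power compact_imp_seq_compact by blast
  ultimately show "\<exists>l r. strict_mono (r::nat\<Rightarrow>nat) \<and> ((f \<circ> r) \<longlongrightarrow> l) sequentially"
    unfolding seq_compact_def by metis
qed

lemma continuous_on_nabs [continuous_intros]: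
  "continuous_on S f \<Longrightarrow> continuous_on S (\<lambda>x. nabs (f x :: 'f::nonarch_local_field))"
  using continuous_on_dist[of S f "\<lambda>_. 0"] by (simp add: dist_nabs)

lemma mem_shell_nonzero: "x \<in> shell m \<Longrightarrow> x \<noteq> 0"
  by (simp add: shell_def)

lemma nabs_shell: "(x::'f::nonarch_local_field) \<in> shell m \<Longrightarrow> nabs x = resq TYPE('f) powi (- m)"
  by (simp add: shell_def)

lemma mem_some_shell:
  fixes x :: "'f::nonarch_local_field"
  assumes "x \<noteq> 0"
  obtains m where "x \<in> shell m"
proof -
  obtain k where "nabs x = resq TYPE('f) powi k" using nabs_eq_powi[OF assms] .
  then have "x \<in> shell (- k)" using assms by (simp add: shell_def)
  then show ?thesis by (rule that)
qed

lemma shell_disjoint: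
  fixes x :: "'f::nonarch_local_field"
  assumes "x \<in> shell m" "x \<in> shell k"
  shows "m = k"
  using assms resq_powi_inject[where 'f='f, of "-m" "-k"] by (simp add: shell_def)

lemma shell_eq_nabs: "shell m = {x::'f::nonarch_local_field. nabs x = resq TYPE('f) powi (- m)}"
  using resq_powi_pos[where 'f='f, of "-m"] by (auto simp: shell_def)

lemma closed_shell: "closed (shell m :: 'f::nonarch_local_field set)"
proof -
  have "continuous_on UNIV (\<lambda>x::'f. nabs x)" by (intro continuous_intros)
  then show ?thesis unfolding shell_eq_nabs
    using closed_Collect_eq[of "\<lambda>x::'f. nabs x" "\<lambda>_. resq TYPE('f) powi (- m)"] by simp
qed

lemma compact_shell: "compact (shell m :: 'f::nonarch_local_field set)"
proof -
  have "shell m = prime_power m \<inter> (shell m :: 'f set)" by (auto simp: shell_def prime_power_def)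
  then show ?thesis using compact_Int_closed[OF compact_prime_power closed_shell] by metis
qed

lemma open_shell: "open (shell m :: 'f::nonarch_local_field set)"
proof (rule open_cosetI)
  fix x :: 'f assume x: "x \<in> shell m"
  have "y \<in> shell m" if "y - x \<in> prime_power (m + 1)" for y
  proof -
    have "nabs (y - x) \<le> resq TYPE('f) powi (- (m + 1))" using that by (simp add: prime_power_def)
    also have "\<dots> < nabs x" using nabs_shell[OF x] resq_powi_less_iff[where 'f='f] by simp
    finally have "nabs y = nabs x" by (rule nabs_eq_if_diff_less)
    then show ?thesis using x by (simp add: shell_eq_nabs)
  qed
  then show "\<exists>k. {y. y - x \<in> prime_power k} \<subseteq> shell m" by blast
qed


section \<open>Matrix lattices and congruence subgroups\<close>

definition matrix_lattice :: "int \<Rightarrow> ('f::nonarch_local_field^'n^'n::finite) set" where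
  "matrix_lattice k = {g. \<forall>i j. g $ i $ j \<in> prime_power k}"

lemma matrix_lattice_0 [simp]: "0 \<in> matrix_lattice k"
  by (simp add: matrix_lattice_def)

lemma matrix_lattice_add: "g \<in> matrix_lattice k \<Longrightarrow> h \<in> matrix_lattice k \<Longrightarrow> g + h \<in> matrix_lattice k"
  by (simp add: matrix_lattice_def prime_power_add)

lemma matrix_lattice_diff: "g \<in> matrix_lattice k \<Longrightarrow> h \<in> matrix_lattice k \<Longrightarrow> g - h \<in> matrix_lattice k"
  by (simp add: matrix_lattice_def prime_power_diff)

lemma matrix_lattice_uminus: "g \<in> matrix_lattice k \<Longrightarrow> - g \<in> matrix_lattice k"
  by (simp add: matrix_lattice_def prime_power_uminus)

lemma matrix_lattice_diff_commute: "g - h \<in> matrix_lattice k \<longleftrightarrow> h - g \<in> matrix_lattice k"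
  by (simp add: matrix_lattice_def prime_power_diff_commute)

lemma matrix_lattice_antimono: "j \<le> k \<Longrightarrow> g \<in> matrix_lattice k \<Longrightarrow> g \<in> matrix_lattice j"
  by (auto simp: matrix_lattice_def intro: prime_power_antimono[THEN subsetD])

lemma matrix_lattice_mult:
  "g \<in> matrix_lattice j \<Longrightarrow> h \<in> matrix_lattice k \<Longrightarrow> g ** h \<in> matrix_lattice (j + k)"
  by (auto simp: matrix_lattice_def matrix_matrix_mult_def intro!: prime_power_sum prime_power_mult)

lemma mat_1_in_matrix_lattice [simp]: "mat 1 \<in> matrix_lattice 0"
  by (simp add: matrix_lattice_def mat_def)

lemma trace_in_prime_power: "g \<in> matrix_lattice k \<Longrightarrow> trace g \<in> prime_power k"
  by (auto simp: matrix_lattice_def trace_def intro!: prime_power_sum)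

lemma K_sub_iff: "g \<in> K_sub l \<longleftrightarrow> g - mat 1 \<in> matrix_lattice (int l)"
  by (simp add: K_sub_def matrix_lattice_def)

lemma K_sub_antimono: "l \<le> m \<Longrightarrow> K_sub m \<subseteq> K_sub l"
  using matrix_lattice_antimono[of "int l" "int m"] by (auto simp: K_sub_iff)

lemma K_sub_integral: "k \<in> K_sub l \<Longrightarrow> k \<in> matrix_lattice 0"
  using matrix_lattice_add[of "k - mat 1" 0 "mat 1"] matrix_lattice_antimono[of 0 "int l" "k - mat 1"]
  by (simp add: K_sub_iff)

lemma mat_1_in_K_sub [simp]: "mat 1 \<in> K_sub l"
  by (simp add: K_sub_iff)

lemma matrix_mult_diff_left: "g ** (a - b) = g ** a - g ** (b :: 'a::ring_1^'n^'m)"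
  by (simp add: vec_eq_iff matrix_matrix_mult_def right_diff_distrib sum_subtractf)

lemma matrix_mult_diff_right: "(a - b) ** g = a ** g - b ** (g :: 'a::ring_1^'n^'m)"
  by (simp add: vec_eq_iff matrix_matrix_mult_def left_diff_distrib sum_subtractf)

lemma matrix_mult_minus_left: "g ** (- a) = - (g ** (a :: 'a::ring_1^'n^'m))"
  by (simp add: vec_eq_iff matrix_matrix_mult_def sum_negf)

lemma matrix_mult_add_right: "(a + b) ** g = a ** g + b ** (g :: 'a::ring_1^'n^'m)"
  by (simp add: vec_eq_iff matrix_matrix_mult_def distrib_right sum.distrib)

text \<open>Telescoping: one factor is exchanged at a time.\<close>
lemma prime_power_prod_cong:
  fixes a b :: "'i \<Rightarrow> 'f::nonarch_local_field"
  assumes "finite I" "\<And>i. i \<in> I \<Longrightarrow> a i \<in> prime_power 0" "\<And>i. i \<in> I \<Longrightarrow> b i \<in> prime_power 0"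
    "\<And>i. i \<in> I \<Longrightarrow> a i - b i \<in> prime_power k"
  shows "prod a I - prod b I \<in> prime_power k"
  using assms
proof (induction I rule: finite_induct)
  case (insert i I)
  have "prod a I \<in> prime_power 0" using prime_power_prod[of I a 0] insert by simp
  then have "(a i - b i) * prod a I \<in> prime_power k"
    using prime_power_mult[of "a i - b i" k "prod a I" 0] insert by simp
  moreover have "b i * (prod a I - prod b I) \<in> prime_power k"
    using prime_power_mult[of "b i" 0 "prod a I - prod b I" k] insert by simp
  ultimately have "(a i - b i) * prod a I + b i * (prod a I - prod b I) \<in> prime_power k"
    by (rule prime_power_add)
  then show ?case using insert(1,2) by (simp add: algebra_simps)
qed simp

lemma prime_power_of_int_sign:
  "x \<in> prime_power k \<Longrightarrow> of_int (sign p) * (x::'f::nonarch_local_field) \<in> prime_power k"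
  by (cases p rule: sign_cases) (auto simp: prime_power_uminus)

lemma det_in_prime_power:
  fixes g :: "'f::nonarch_local_field^'n^'n::finite"
  assumes "g \<in> matrix_lattice k"
  shows "det g \<in> prime_power (int CARD('n) * k)"
  unfolding det_def
proof (intro prime_power_sum prime_power_of_int_sign)
  fix p :: "'n \<Rightarrow> 'n"
  show "(\<Prod>i\<in>UNIV. g $ i $ p i) \<in> prime_power (int CARD('n) * k)"
    using assms by (intro prime_power_prod) (auto simp: matrix_lattice_def)
qed

lemma det_cong_prime_power:
  fixes g h :: "'f::nonarch_local_field^'n^'n::finite"
  assumes "g \<in> matrix_lattice 0" "h \<in> matrix_lattice 0" "g - h \<in> matrix_lattice k"
  shows "det g - det h \<in> prime_power k"
  unfolding det_def sum_subtractf[symmetric] right_diff_distrib[symmetric]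
  using assms
  by (intro prime_power_sum prime_power_of_int_sign prime_power_prod_cong) (auto simp: matrix_lattice_def)

lemma K_sub_det:
  assumes "k \<in> K_sub l"
  shows "det k - 1 \<in> prime_power (int l)"
  using det_cong_prime_power[of k "mat 1" "int l"] assms K_sub_integral by (auto simp: K_sub_iff)

lemma nabs_eq_1_if_cong_1:
  fixes x :: "'f::nonarch_local_field"
  assumes "x - 1 \<in> prime_power k" "1 \<le> k"
  shows "nabs x = 1"
proof -
  have "nabs (x - 1) \<le> resq TYPE('f) powi (- k)" using assms(1) by (simp add: prime_power_def)
  also have "\<dots> < 1" using resq_powi_less_iff[where 'f='f, of "-k" 0] assms(2) by simp
  finally show ?thesis using nabs_eq_if_diff_less[of x 1] by simp
qed

lemma K_sub_nabs_det:
  fixes k :: "'f::nonarch_local_field^'n^'n::finite"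
  shows "k \<in> K_sub l \<Longrightarrow> 1 \<le> l \<Longrightarrow> nabs (det k) = 1"
  using nabs_eq_1_if_cong_1[OF K_sub_det] by force

lemma GL_iff_det: "g \<in> GL \<longleftrightarrow> det g \<noteq> (0::'f::nonarch_local_field)"
  by (simp add: GL_def invertible_det_nz)

lemma K_sub_subset_GL: "1 \<le> l \<Longrightarrow> K_sub l \<subseteq> GL"
  using K_sub_nabs_det by (force simp: GL_iff_det)

lemma GL_mult: "g \<in> GL \<Longrightarrow> h \<in> GL \<Longrightarrow> g ** h \<in> GL"
  by (simp add: GL_iff_det det_mul)

lemma mat_1_in_GL [simp]: "mat 1 \<in> GL"
  by (simp add: GL_iff_det)

lemma GL_inv:
  assumes "g \<in> GL"
  shows "g ** matrix_inv g = mat 1" "matrix_inv g ** g = mat 1"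
proof -
  have "invertible g" using assms by (simp add: GL_def)
  then have "\<exists>h. g ** h = mat 1 \<and> h ** g = mat 1" by (simp add: invertible_def)
  then have "g ** matrix_inv g = mat 1 \<and> matrix_inv g ** g = mat 1"
    unfolding matrix_inv_def by (rule someI_ex)
  then show "g ** matrix_inv g = mat 1" "matrix_inv g ** g = mat 1" by auto
qed

lemma GL_inv_unique:
  assumes "g \<in> GL" "g ** h = mat 1"
  shows "matrix_inv g = h"
proof -
  have "matrix_inv g ** (g ** h) = matrix_inv g" using assms by simp
  then show ?thesis using GL_inv(2)[OF assms(1)] by (simp add: matrix_mul_assoc)
qed

lemma det_matrix_inv: "g \<in> GL \<Longrightarrow> det (matrix_inv g) = inverse (det g)"
  using GL_inv(1)[of g] by (metis det_I det_mul inverse_unique)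

lemma GL_matrix_inv: "g \<in> GL \<Longrightarrow> matrix_inv g \<in> GL"
  by (simp add: GL_iff_det det_matrix_inv)

lemma matrix_inv_matrix_inv: "g \<in> GL \<Longrightarrow> matrix_inv (matrix_inv g) = g"
  by (intro GL_inv_unique GL_matrix_inv GL_inv)

lemma matrix_inv_mult:
  assumes "g \<in> GL" "h \<in> GL"
  shows "matrix_inv (g ** h) = matrix_inv h ** matrix_inv g"
proof (rule GL_inv_unique)
  have "g ** h ** (matrix_inv h ** matrix_inv g) = g ** (h ** matrix_inv h) ** matrix_inv g"
    by (simp only: matrix_mul_assoc)
  then show "g ** h ** (matrix_inv h ** matrix_inv g) = mat 1" using assms by (simp add: GL_inv)
qed (simp add: assms GL_mult)

lemma matrix_inv_mult_cancel: "g \<in> GL \<Longrightarrow> matrix_inv g ** (g ** h) = h"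
  "g \<in> GL \<Longrightarrow> g ** (matrix_inv g ** h) = h"
  by (simp_all add: matrix_mul_assoc GL_inv)


section \<open>Topology of the matrix space\<close>

lemma matrix_coset_basis:
  fixes g :: "'f::nonarch_local_field^'n^'n::finite"
  assumes "open U" "g \<in> U"
  obtains k :: nat where "{h. h - g \<in> matrix_lattice (int k)} \<subseteq> U"
proof -
  have "\<exists>A. (\<forall>i. open (A i) \<and> g $ i \<in> A i) \<and> (\<forall>y. (\<forall>i. y $ i \<in> A i) \<longrightarrow> y \<in> U)"
    using assms unfolding open_vec_def by blast
  then obtain A where A: "\<And>i. open (A i)" "\<And>i. g $ i \<in> A i" "\<And>y. (\<forall>i. y $ i \<in> A i) \<Longrightarrow> y \<in> U"
    by blast
  have "\<exists>B. (\<forall>j. open (B j) \<and> g $ i $ j \<in> B j) \<and> (\<forall>y. (\<forall>j. y $ j \<in> B j) \<longrightarrow> y \<in> A i)" for i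
    using A(1)[of i] A(2)[of i] unfolding open_vec_def by blast
  then obtain B where B: "\<And>i j. open (B i j)" "\<And>i j. g $ i $ j \<in> B i j"
    "\<And>i y. (\<forall>j. y $ j \<in> B i j) \<Longrightarrow> y \<in> A i" by metis
  have "\<exists>k::nat. {y. y - g $ i $ j \<in> prime_power (int k)} \<subseteq> B i j" for i j
    using coset_basis[OF B(1,2)] by metis
  then obtain k :: "'n \<Rightarrow> 'n \<Rightarrow> nat"
    where k: "\<And>i j. {y. y - g $ i $ j \<in> prime_power (int (k i j))} \<subseteq> B i j" by metis
  define m where "m = Max (range (\<lambda>(i, j). k i j))"
  have "k i j \<le> m" for i j unfolding m_def by (intro Max_ge) auto
  then have le: "prime_power (int m) \<subseteq> (prime_power (int (k i j)) :: 'f set)" for i j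
    by (intro prime_power_antimono) simp
  have "h \<in> U" if h: "h - g \<in> matrix_lattice (int m)" for h
  proof (intro A(3) allI B(3))
    fix i j
    have "h $ i $ j - g $ i $ j \<in> prime_power (int m)" using h by (simp add: matrix_lattice_def)
    then show "h $ i $ j \<in> B i j" using le k by blast
  qed
  then show ?thesis using that by blast
qed

lemma open_matrix_coset:
  "open {h. h - g \<in> (matrix_lattice k :: ('f::nonarch_local_field^'n^'n::finite) set)}"
proof -
  have "open {h::'f^'n^'n. \<forall>i. h $ i \<in> {v. \<forall>j. v $ j \<in> {y. y - g $ i $ j \<in> prime_power k}}}"
    using open_coset by (intro open_vector_box allI) blast
  then show ?thesis by (simp add: matrix_lattice_def)
qed

lemma open_matrix_cosetI:
  fixes S :: "('f::nonarch_local_field^'n^'n::finite) set"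
  assumes "\<And>x. x \<in> S \<Longrightarrow> \<exists>k. {y. y - x \<in> matrix_lattice k} \<subseteq> S"
  shows "open S"
proof (subst open_subopen, intro ballI)
  fix x assume "x \<in> S"
  then obtain k where "{y. y - x \<in> matrix_lattice k} \<subseteq> S" using assms by blast
  then show "\<exists>T. open T \<and> x \<in> T \<and> T \<subseteq> S"
    by (intro exI[of _ "{y. y - x \<in> matrix_lattice k}"]) (auto simp: open_matrix_coset)
qed

lemma closed_matrix_coset:
  "closed {h. h - g \<in> (matrix_lattice k :: ('f::nonarch_local_field^'n^'n::finite) set)}"
proof -
  have "h' - g \<notin> matrix_lattice k" if "h - g \<notin> matrix_lattice k" "h' - h \<in> matrix_lattice k"
    for h h' :: "'f^'n^'n"
    using that matrix_lattice_diff[of "h' - g" k "h' - h"] by auto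
  then have "open (- {h. h - g \<in> (matrix_lattice k :: ('f^'n^'n) set)})"
    by (intro open_matrix_cosetI exI[of _ k]) auto
  then show ?thesis by (simp add: closed_def)
qed

lemma compact_matrix_lattice: "compact (matrix_lattice k :: ('f::nonarch_local_field^'n^'n::finite) set)"
proof -
  let ?q = "resq TYPE('f) powi (- k)"
  have "dist 0 g \<le> (\<Sum>i\<in>(UNIV::'n set). \<Sum>j\<in>(UNIV::'n set). ?q)"
    if g: "g \<in> matrix_lattice k" for g :: "'f^'n^'n"
  proof -
    have "dist 0 g \<le> (\<Sum>i\<in>UNIV. dist (0 $ i) (g $ i))"
      unfolding dist_vec_def by (rule L2_set_le_sum) simp
    also have "\<dots> \<le> (\<Sum>i\<in>UNIV. \<Sum>j\<in>UNIV. dist (0 $ i $ j) (g $ i $ j))"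
      unfolding dist_vec_def[where 'a='f] by (intro sum_mono L2_set_le_sum) simp
    also have "\<dots> \<le> (\<Sum>i\<in>(UNIV::'n set). \<Sum>j\<in>(UNIV::'n set). ?q)"
      using g by (intro sum_mono) (auto simp: matrix_lattice_def prime_power_def dist_nabs)
    finally show ?thesis .
  qed
  then have "bounded (matrix_lattice k :: ('f^'n^'n) set)" unfolding bounded_def by blast
  moreover have "closed (matrix_lattice k :: ('f^'n^'n) set)"
    using closed_matrix_coset[of "0::'f^'n^'n" k] by simp
  ultimately show ?thesis by (simp add: compact_eq_bounded_closed)
qed

lemma matrix_coset_eq:
  assumes "h - g \<in> matrix_lattice k"
  shows "{x. x - h \<in> matrix_lattice k} = {x. x - g \<in> matrix_lattice k}"
  using assms matrix_lattice_add[of _ k "h - g"] matrix_lattice_diff[of _ k "h - g"]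
  by (fastforce simp: algebra_simps)

lemma finite_matrix_cosets:
  fixes S :: "('f::nonarch_local_field^'n^'n::finite) set"
  assumes "compact S"
  shows "finite ((\<lambda>g. {h. h - g \<in> matrix_lattice k}) ` S)"
proof -
  let ?c = "\<lambda>g::'f^'n^'n. {h. h - g \<in> matrix_lattice k}"
  have "S \<subseteq> (\<Union>g\<in>S. ?c g)" by auto
  then obtain T where T: "T \<subseteq> S" "finite T" "S \<subseteq> (\<Union>g\<in>T. ?c g)"
    using compactE_image[OF assms, of S ?c] open_matrix_coset by metis
  have "?c ` S \<subseteq> ?c ` T"
  proof (rule image_subsetI)
    fix g assume "g \<in> S"
    then obtain t where "t \<in> T" "g - t \<in> matrix_lattice k" using T(3) by blast
    then show "?c g \<in> ?c ` T" using matrix_coset_eq by blast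
  qed
  then show ?thesis using T(2) finite_surj by blast
qed

lemma mem_some_matrix_lattice:
  fixes g :: "'f::nonarch_local_field^'n^'n::finite"
  obtains l :: nat where "g \<in> matrix_lattice (- int l)"
proof -
  have "\<exists>k::nat. nabs (g $ i $ j) < resq TYPE('f) powi (int k)" for i j
    using resq_powi_large by metis
  then obtain k :: "'n \<Rightarrow> 'n \<Rightarrow> nat" where k: "\<And>i j. nabs (g $ i $ j) < resq TYPE('f) powi (int (k i j))"
    by metis
  define m where "m = Max (range (\<lambda>(i, j). k i j))"
  have "k i j \<le> m" for i j unfolding m_def by (intro Max_ge) auto
  then have "nabs (g $ i $ j) \<le> resq TYPE('f) powi (int m)" for i j
    using k[of i j] resq_powi_le_iff[where 'f='f, of "int (k i j)" "int m"]
    by (meson le_less_trans less_imp_le of_nat_mono order_trans)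
  then have "g \<in> matrix_lattice (- int m)" by (simp add: matrix_lattice_def prime_power_def)
  then show ?thesis by (rule that)
qed

text \<open>Countability of the cosets is what identifies the Borel sets of the matrix space with those of the
  product: every open set is a countable union of cosets, and cosets are boxes.\<close>
lemma countable_matrix_cosets:
  "countable (range (\<lambda>g::'f::nonarch_local_field^'n^'n::finite. {h. h - g \<in> matrix_lattice k}))"
proof -
  let ?c = "\<lambda>g::'f^'n^'n. {h. h - g \<in> matrix_lattice k}"
  have "range ?c \<subseteq> (\<Union>l::nat. ?c ` matrix_lattice (- int l))"
  proof (rule image_subsetI)
    fix g :: "'f^'n^'n"
    obtain l :: nat where "g \<in> matrix_lattice (- int l)" by (rule mem_some_matrix_lattice)
    then show "?c g \<in> (\<Union>l::nat. ?c ` matrix_lattice (- int l))" by blast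
  qed
  moreover have "countable (\<Union>l::nat. ?c ` matrix_lattice (- int l))"
    using finite_matrix_cosets[OF compact_matrix_lattice] by (intro countable_UN) (auto intro: countable_finite)
  ultimately show ?thesis by (rule countable_subset)
qed

lemma continuous_on_det [continuous_intros]:
  fixes f :: "'x::topological_space \<Rightarrow> 'f::nonarch_local_field^'n^'n::finite"
  assumes "continuous_on S f"
  shows "continuous_on S (\<lambda>x. det (f x))"
proof -
  have "((\<lambda>x. det (f x)) \<longlongrightarrow> det (f a)) (at a within S)" if "a \<in> S" for a
    unfolding det_def using assms that
    by (intro tendsto_intros tendsto_prod') (auto simp: continuous_on_def)
  then show ?thesis by (simp add: continuous_on_def)
qed

lemma continuous_on_matrix_mult [continuous_intros]:
  fixes f g :: "'x::topological_space \<Rightarrow> 'f::nonarch_local_field^'n^'n::finite"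
  assumes "continuous_on S f" "continuous_on S g"
  shows "continuous_on S (\<lambda>x. f x ** g x)"
proof -
  have "((\<lambda>x. f x ** g x) \<longlongrightarrow> f a ** g a) (at a within S)" if "a \<in> S" for a
    unfolding matrix_matrix_mult_def using assms that
    by (intro tendsto_intros) (auto simp: continuous_on_def)
  then show ?thesis by (simp add: continuous_on_def)
qed

lemma open_GL: "open (GL :: ('f::nonarch_local_field^'n^'n::finite) set)"
proof -
  have "continuous_on UNIV (\<lambda>g::'f^'n^'n. det g)" by (intro continuous_intros)
  then have "open {g::'f^'n^'n. det g \<noteq> 0}" by (intro open_Collect_neq) auto
  moreover have "GL = {g::'f^'n^'n. det g \<noteq> 0}" by (auto simp: GL_iff_det)
  ultimately show ?thesis by simp
qed

text \<open>On a determinant shell the absolute value of the determinant is constant and nonzero, which makes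
  compact subsets of it compact in \<open>GL\<^sub>n\<close>.\<close>
definition det_shell :: "int \<Rightarrow> ('f::nonarch_local_field^'n^'n::finite) set" where
  "det_shell j = {g. det g \<in> shell j}"

lemma det_shell_subset_GL: "det_shell j \<subseteq> GL"
  by (auto simp: det_shell_def GL_iff_det shell_def)

lemma open_det_shell: "open (det_shell j :: ('f::nonarch_local_field^'n^'n::finite) set)"
proof -
  have "continuous_on UNIV (\<lambda>g::'f^'n^'n. det g)" by (intro continuous_intros)
  then have "open ((\<lambda>g::'f^'n^'n. det g) -` shell j)" by (rule open_vimage[OF open_shell])
  then show ?thesis by (simp add: det_shell_def vimage_def)
qed

lemma closed_det_shell: "closed (det_shell j :: ('f::nonarch_local_field^'n^'n::finite) set)"
proof -
  have "continuous_on UNIV (\<lambda>g::'f^'n^'n. det g)" by (intro continuous_intros)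
  then have "closed ((\<lambda>g::'f^'n^'n. det g) -` shell j)" by (rule closed_vimage[OF closed_shell])
  then show ?thesis by (simp add: det_shell_def vimage_def)
qed

text \<open>The coset \<open>g K\<^sub>l\<close>, written with \<open>g\<^sup>-\<^sup>1\<close> so that it is visibly a preimage under a continuous map.\<close>
definition K_coset :: "nat \<Rightarrow> 'f::nonarch_local_field^'n^'n::finite \<Rightarrow> ('f^'n^'n) set" where
  "K_coset l g = {h. matrix_inv g ** h \<in> K_sub l}"

lemma open_K_coset:
  fixes g :: "'f::nonarch_local_field^'n^'n::finite"
  shows "open (K_coset l g)"
proof -
  have "continuous_on UNIV (\<lambda>h::'f^'n^'n. matrix_inv g ** h)"
    by (rule continuous_on_matrix_mult[OF continuous_on_const continuous_on_id])
  then have "open ((\<lambda>h::'f^'n^'n. matrix_inv g ** h) -` {k. k - mat 1 \<in> matrix_lattice (int l)})"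
    by (rule open_vimage[OF open_matrix_coset])
  then show ?thesis by (simp add: K_coset_def K_sub_iff vimage_def)
qed

lemma K_cosetE:
  assumes "h \<in> K_coset l g" "g \<in> GL"
  obtains k where "k \<in> K_sub l" "h = g ** k"
  using assms that[of "matrix_inv g ** h"] by (simp add: K_coset_def matrix_inv_mult_cancel)

lemma mem_K_coset_self: "g \<in> GL \<Longrightarrow> g \<in> K_coset l g"
  by (simp add: K_coset_def GL_inv)


section \<open>Transvections\<close>

definition elem :: "'n \<Rightarrow> 'n \<Rightarrow> 'f::nonarch_local_field \<Rightarrow> 'f^'n^'n::finite" where
  "elem i j t = (\<chi> a b. if a = i \<and> b = j then t else 0)"

lemma elem_in_matrix_lattice: "t \<in> prime_power k \<Longrightarrow> elem i j t \<in> matrix_lattice k"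
  by (simp add: elem_def matrix_lattice_def)

lemma elem_mult_elem: "elem i j s ** elem k l t = (if j = k then elem i l (s * t) else 0)"
proof -
  have "(\<Sum>c\<in>UNIV. (if a = i \<and> c = j then s else 0) * (if c = k \<and> b = l then t else 0))
      = (\<Sum>c\<in>UNIV. if c = j then (if a = i \<and> j = k \<and> b = l then s * t else 0) else 0)" for a b
    by (intro sum.cong) auto
  then show ?thesis by (auto simp: elem_def matrix_matrix_mult_def vec_eq_iff)
qed

lemma trace_mult_elem: "trace (g ** elem i j t) = g $ j $ i * t"
proof -
  have "trace (g ** elem i j t) = (\<Sum>a\<in>UNIV. \<Sum>b\<in>UNIV. if a = j \<and> b = i then g $ j $ i * t else 0)"
    unfolding trace_def matrix_matrix_mult_def elem_def by (auto intro!: sum.cong)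
  also have "\<dots> = (\<Sum>a\<in>UNIV. if a = j then g $ j $ i * t else 0)"
    by (intro sum.cong) auto
  finally show ?thesis by simp
qed

lemma det_transvection:
  assumes "i \<noteq> j"
  shows "det (mat 1 + elem i j t) = 1"
proof -
  have "mat 1 + elem i j t = (\<chi> k. if k = i then row i (mat 1) + t *s row j (mat 1) else row k (mat 1))"
    by (auto simp: elem_def mat_def row_def vec_eq_iff)
  then show ?thesis using det_row_operation[OF assms, of "mat 1" t] by simp
qed

text \<open>\<open>1 + skew_elem i j t\<close> is a conjugate of a transvection, hence of determinant \<open>1\<close>. Traces against
  transvections see only off-diagonal entries; traces against this conjugate see differences of diagonal
  entries.\<close>
definition skew_elem :: "'n \<Rightarrow> 'n \<Rightarrow> 'f::nonarch_local_field \<Rightarrow> 'f^'n^'n::finite" where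
  "skew_elem i j t = elem i j t + elem j j t - elem i i t - elem j i t"

lemma skew_elem_conj:
  assumes "i \<noteq> j"
  shows "mat 1 + skew_elem i j t = (mat 1 + elem j i 1) ** (mat 1 + elem i j t) ** (mat 1 + elem j i (- 1))"
proof -
  have m: "elem a b (- s) = - elem a b s" for a b and s :: 'b by (simp add: elem_def vec_eq_iff)
  show ?thesis using assms
    by (simp add: skew_elem_def matrix_add_ldistrib matrix_mult_add_right elem_mult_elem m
        matrix_mult_minus_left matrix_mult_diff_left algebra_simps)
qed

lemma det_skew_elem: "i \<noteq> j \<Longrightarrow> det (mat 1 + skew_elem i j t) = 1"
  by (simp only: skew_elem_conj det_mul det_transvection not_sym mult_1 not_False_eq_True)

lemma skew_elem_in_matrix_lattice: "t \<in> prime_power k \<Longrightarrow> skew_elem i j t \<in> matrix_lattice k"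
  unfolding skew_elem_def by (intro matrix_lattice_add matrix_lattice_diff elem_in_matrix_lattice)

lemma trace_mult_skew_elem:
  "trace (g ** skew_elem i j t) = (g $ j $ i + g $ j $ j - g $ i $ i - g $ i $ j) * t"
  by (simp add: skew_elem_def matrix_mult_diff_left matrix_add_ldistrib trace_add trace_sub
      trace_mult_elem algebra_simps)

lemma elem_square: "i \<noteq> j \<Longrightarrow> elem i j t ** elem i j t = 0"
  by (simp add: elem_mult_elem)

lemma skew_elem_square: "i \<noteq> j \<Longrightarrow> skew_elem i j t ** skew_elem i j t = 0"
  by (simp add: skew_elem_def matrix_mult_diff_left matrix_mult_diff_right matrix_add_ldistrib
      matrix_mult_add_right elem_mult_elem)


section \<open>Haar measure on the field\<close>

lemma haar_sets [measurable_cong]: "haar_measure \<mu> \<Longrightarrow> sets \<mu> = sets borel"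
  by (simp add: haar_measure_def)

lemma haar_space: "haar_measure \<mu> \<Longrightarrow> space \<mu> = UNIV"
  using sets_eq_imp_space_eq[of \<mu> borel] by (simp add: haar_measure_def)

lemma haar_add_measurable:
  assumes "haar_measure \<mu>"
  shows "(\<lambda>x. a + x) \<in> measurable \<mu> \<mu>"
proof -
  have "(\<lambda>x. a + x) \<in> borel_measurable borel"
    by (intro borel_measurable_continuous_onI continuous_intros)
  then show ?thesis by (simp add: measurable_cong_sets[OF haar_sets[OF assms] haar_sets[OF assms]])
qed

lemma prime_power_borel [measurable, simp]: "(prime_power k :: 'f::nonarch_local_field set) \<in> sets borel"
  by (rule borel_closed[OF closed_prime_power])

lemma haar_measure_translate:
  assumes "haar_measure \<mu>" "A \<in> sets borel"
  shows "emeasure \<mu> {x. a + x \<in> A} = emeasure \<mu> A"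
proof -
  have m: "(\<lambda>x. a + x) \<in> measurable \<mu> \<mu>"
    by (rule haar_add_measurable[OF assms(1)])
  have "emeasure \<mu> A = emeasure (distr \<mu> \<mu> (\<lambda>x. a + x)) A"
    using assms(1) by (simp add: haar_measure_def)
  also have "\<dots> = emeasure \<mu> {x. a + x \<in> A}"
    using m assms by (subst emeasure_distr) (auto simp: haar_sets haar_space vimage_def)
  finally show ?thesis ..
qed

lemma haar_measure_coset:
  assumes "haar_measure \<mu>"
  shows "emeasure \<mu> {y. y - a \<in> prime_power k} = emeasure \<mu> (prime_power k)"
  using haar_measure_translate[OF assms prime_power_borel, of "- a" k] by (simp add: algebra_simps)

lemma haar_prime_power_finite: "haar_measure \<mu> \<Longrightarrow> emeasure \<mu> (prime_power k) < \<infinity>"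
  by (simp add: haar_measure_def compact_prime_power)

lemma haar_prime_power_pos: "haar_measure \<mu> \<Longrightarrow> 0 < emeasure \<mu> (prime_power k)"
proof -
  assume "haar_measure \<mu>"
  moreover have "open (prime_power k :: 'a set)" using open_coset[of "0::'a" k] by simp
  moreover have "(0::'a) \<in> prime_power k" by simp
  ultimately show ?thesis unfolding haar_measure_def by blast
qed

text \<open>\<open>\<pp>\<^sup>k\<close> is the disjoint union of \<open>q\<close> translates of \<open>\<pp>\<^sup>k\<^sup>+\<^sup>1\<close>. This is the scaling behaviour of Haar
  measure on balls, from which the Jacobian \<open>|det g|\<^sup>n\<close> of left multiplication is derived below.\<close>
lemma haar_prime_power_Suc:
  fixes \<mu> :: "'f::nonarch_local_field measure"
  assumes "haar_measure \<mu>"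
  shows "emeasure \<mu> (prime_power k) = ennreal (resq TYPE('f)) * emeasure \<mu> (prime_power (k + 1))"
proof -
  let ?R = "(\<lambda>x::'f. {y. nabs (y - x) < 1}) ` {x. nabs x \<le> 1}"
  obtain c :: 'f where c: "nabs c = resq TYPE('f) powi (- k)" using ex_nabs_powi by metis
  have A: "(*) c ` A \<in> sets \<mu> \<and> emeasure \<mu> ((*) c ` A) = emeasure \<mu> (prime_power (k + 1))"
    if A: "A \<in> ?R" for A
  proof -
    obtain a where "(*) c ` A = {y. y - a \<in> prime_power (k + 1)}"
      using prime_power_layer(3)[OF c A] by blast
    then show ?thesis using haar_measure_coset[OF assms] open_coset[of a "k + 1"] assms by (simp add: haar_sets)
  qed
  have "emeasure \<mu> (prime_power k) = (\<Sum>A\<in>?R. emeasure \<mu> ((*) c ` A))"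
    unfolding prime_power_layer(1)[OF c]
    using A by (intro sum_emeasure[symmetric] prime_power_layer(2)[OF c] finite_residue_field) auto
  also have "\<dots> = (\<Sum>A\<in>?R. emeasure \<mu> (prime_power (k + 1)))" using A by (intro sum.cong) auto
  also have "\<dots> = ennreal (resq TYPE('f)) * emeasure \<mu> (prime_power (k + 1))"
    by (simp add: residue_card_def ennreal_of_nat_eq_real_of_nat)
  finally show ?thesis .
qed

lemma haar_prime_power_shift:
  fixes \<mu> :: "'f::nonarch_local_field measure"
  assumes "haar_measure \<mu>"
  shows "emeasure \<mu> (prime_power (k + v)) = ennreal (resq TYPE('f) powi (- v)) * emeasure \<mu> (prime_power k)"
proof -
  have q: "resq TYPE('f) \<noteq> 0" using resq_pos[where 'f='f] by simp
  have nat: "emeasure \<mu> (prime_power k) = ennreal (resq TYPE('f) powi (int m)) * emeasure \<mu> (prime_power (k + int m))"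
    for k m
  proof (induction m)
    case (Suc m)
    have "ennreal (resq TYPE('f) powi (int (Suc m))) = ennreal (resq TYPE('f) powi (int m)) * ennreal (resq TYPE('f))"
      using resq_powi_add[where 'f='f, of "int m" 1]
      by (subst ennreal_mult[symmetric]) (auto simp: add.commute)
    then show ?case using Suc haar_prime_power_Suc[OF assms, of "k + int m"]
      by (simp add: mult.assoc add.assoc add.commute[of 1])
  qed simp
  show ?thesis
  proof (cases "0 \<le> v")
    case True
    then obtain m where v: "v = int m" using nonneg_int_cases by blast
    have "ennreal (resq TYPE('f) powi (- v)) * ennreal (resq TYPE('f) powi v) = 1"
      using q by (subst ennreal_mult[symmetric])
        (auto simp: less_imp_le[OF resq_powi_pos] power_int_minus ennreal_1)
    then show ?thesis using nat[of k m] v by (metis mult.assoc mult_1)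
  next
    case False
    then obtain m where v: "v = - int m" by (metis int_cases2 linorder_not_le neg_0_le_iff_le of_nat_0_le_iff)
    show ?thesis using nat[of "k + v" m] v by simp
  qed
qed

lemma haar_sigma_finite:
  fixes \<mu> :: "'f::nonarch_local_field measure"
  assumes "haar_measure \<mu>"
  shows "sigma_finite_measure \<mu>"
proof
  have "x \<in> (\<Union>k::nat. prime_power (- int k))" for x :: 'f
  proof -
    obtain k :: nat where "nabs x < resq TYPE('f) powi (int k)" by (rule resq_powi_large)
    then show ?thesis by (auto simp: prime_power_def intro!: exI[of _ k])
  qed
  then show "\<exists>A::'f set set. countable A \<and> A \<subseteq> sets \<mu> \<and> \<Union>A = space \<mu> \<and> (\<forall>a\<in>A. emeasure \<mu> a \<noteq> \<infinity>)"
    using less_imp_neq[OF haar_prime_power_finite[OF assms]] assms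
    by (intro exI[of _ "range (\<lambda>k::nat. prime_power (- int k))"]) (auto simp: haar_sets haar_space)
qed


section \<open>Additive Haar measure on matrices\<close>

text \<open>The measure on matrices is transported along this map, so without its measurability the transported
  measure would be degenerate.\<close>
lemma matrix_of_pairs_measurable:
  fixes \<mu> :: "'f::nonarch_local_field measure"
  assumes "haar_measure \<mu>"
  shows "(\<lambda>a. (\<chi> i j. a (i, j)) :: 'f^'n^'n::finite) \<in> borel_measurable (Pi\<^sub>M UNIV (\<lambda>_::'n \<times> 'n. \<mu>))"
proof (rule borel_measurableI)
  let ?P = "Pi\<^sub>M UNIV (\<lambda>_::'n \<times> 'n. \<mu>)" and ?m = "\<lambda>a. (\<chi> i j. a (i, j)) :: 'f^'n^'n"
  fix U :: "('f^'n^'n) set" assume U: "open U"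
  define \<C> where "\<C> = {C. \<exists>k::nat. C \<in> range (\<lambda>g::'f^'n^'n. {h. h - g \<in> matrix_lattice (int k)}) \<and> C \<subseteq> U}"
  have "\<C> \<subseteq> (\<Union>k::nat. range (\<lambda>g::'f^'n^'n. {h. h - g \<in> matrix_lattice (int k)}))" by (auto simp: \<C>_def)
  moreover have "countable (\<Union>k::nat. range (\<lambda>g::'f^'n^'n. {h. h - g \<in> matrix_lattice (int k)}))"
    using countable_matrix_cosets by (intro countable_UN) auto
  ultimately have c: "countable \<C>" by (rule countable_subset)
  have "U = \<Union>\<C>"
  proof (intro equalityI subsetI)
    fix g assume "g \<in> U"
    then obtain k :: nat where "{h. h - g \<in> matrix_lattice (int k)} \<subseteq> U" using matrix_coset_basis U by metis
    then have "{h. h - g \<in> matrix_lattice (int k)} \<in> \<C>" by (auto simp: \<C>_def)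
    moreover have "g \<in> {h. h - g \<in> matrix_lattice (int k)}" by simp
    ultimately show "g \<in> \<Union>\<C>" by blast
  qed (auto simp: \<C>_def)
  then have U_eq: "?m -` U \<inter> space ?P = (\<Union>C\<in>\<C>. ?m -` C \<inter> space ?P)" by blast
  have "?m -` C \<inter> space ?P \<in> sets ?P" if C\<C>: "C \<in> \<C>" for C
  proof -
    obtain k :: nat and g :: "'f^'n^'n" where C: "C = {h. h - g \<in> matrix_lattice (int k)}"
      using C\<C> unfolding \<C>_def by blast
    have "?m -` C \<inter> space ?P = Pi\<^sub>E UNIV (\<lambda>p. {y. y - g $ fst p $ snd p \<in> prime_power (int k)})"
      using assms by (auto simp: C matrix_lattice_def space_PiM haar_space PiE_iff)
    also have "\<dots> \<in> sets ?P" using assms by (intro sets_PiM_I_finite) (auto simp: haar_sets open_coset)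
    finally show ?thesis .
  qed
  then have "(\<Union>C\<in>\<C>. ?m -` C \<inter> space ?P) \<in> sets ?P"
    by (intro sets.countable_UN' c image_subsetI) blast
  then show "?m -` U \<inter> space ?P \<in> sets ?P" by (simp only: U_eq)
qed

lemma sets_matrix_measure [simp, measurable_cong]: "sets (matrix_measure \<mu>) = sets borel"
  by (simp add: matrix_measure_def)

lemma space_matrix_measure [simp]: "space (matrix_measure \<mu>) = UNIV"
  by (simp add: matrix_measure_def)

lemma emeasure_matrix_box:
  fixes \<mu> :: "'f::nonarch_local_field measure" and A :: "'n::finite \<Rightarrow> 'n \<Rightarrow> 'f set"
  assumes "haar_measure \<mu>" "\<And>i j. open (A i j)"
  shows "emeasure (matrix_measure \<mu>) {h. \<forall>i j. h $ i $ j \<in> A i j} = (\<Prod>i\<in>UNIV. \<Prod>j\<in>UNIV. emeasure \<mu> (A i j))"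
proof -
  interpret product_sigma_finite "\<lambda>_::'n \<times> 'n. \<mu>"
    by (simp add: product_sigma_finite_def haar_sigma_finite[OF assms(1)])
  have "open {h::'f^'n^'n. \<forall>i. h $ i \<in> {v. \<forall>j. v $ j \<in> A i j}}"
    using assms(2) by (intro open_vector_box allI) auto
  then have "emeasure (matrix_measure \<mu>) {h. \<forall>i j. h $ i $ j \<in> A i j}
    = emeasure (Pi\<^sub>M UNIV (\<lambda>_::'n \<times> 'n. \<mu>)) (Pi\<^sub>E UNIV (\<lambda>p. A (fst p) (snd p)))"
    unfolding matrix_measure_def using matrix_of_pairs_measurable[OF assms(1)] assms(1)
    by (subst emeasure_distr) (auto simp: space_PiM haar_space PiE_iff intro!: arg_cong2[where f=emeasure])
  also have "\<dots> = (\<Prod>p\<in>UNIV. emeasure \<mu> (A (fst p) (snd p)))"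
    using assms by (intro emeasure_PiM) (auto simp: haar_sets)
  also have "\<dots> = (\<Prod>i\<in>UNIV. \<Prod>j\<in>UNIV. emeasure \<mu> (A i j))"
    by (simp add: prod.cartesian_product case_prod_beta)
  finally show ?thesis .
qed

lemma matrix_add_measurable:
  "(\<lambda>h. h + X) \<in> borel_measurable (borel :: ('f::nonarch_local_field^'n^'n::finite) measure)"
proof (rule borel_measurable_continuous_onI)
  show "continuous_on UNIV (\<lambda>h::'f^'n^'n. h + X)"
    unfolding continuous_on_def
    by (intro ballI vec_tendstoI) (simp, intro tendsto_intros tendsto_ident_at)
qed

lemma matrix_mult_measurable:
  fixes h :: "'f::nonarch_local_field^'n^'n::finite"
  shows "(\<lambda>g::'f^'n^'n. h ** g) \<in> borel_measurable borel" "(\<lambda>g::'f^'n^'n. g ** h) \<in> borel_measurable borel"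
  by (intro borel_measurable_continuous_onI continuous_on_matrix_mult continuous_on_const continuous_on_id)+

lemma matrix_measure_translate:
  fixes \<mu> :: "'f::nonarch_local_field measure" and X :: "'f^'n^'n::finite"
  assumes "haar_measure \<mu>"
  shows "distr (matrix_measure \<mu>) borel (\<lambda>h. h + X) = matrix_measure \<mu>"
proof -
  interpret product_sigma_finite "\<lambda>_::'n \<times> 'n. \<mu>"
    by (simp add: product_sigma_finite_def haar_sigma_finite[OF assms])
  let ?P = "Pi\<^sub>M UNIV (\<lambda>_::'n \<times> 'n. \<mu>)" and ?m = "\<lambda>a. (\<chi> i j. a (i, j)) :: 'f^'n^'n"
  let ?t = "\<lambda>a::'n \<times> 'n \<Rightarrow> 'f. \<lambda>p\<in>UNIV. X $ fst p $ snd p + a p"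
  note cont = haar_add_measurable[OF assms]
  have t: "?t \<in> measurable ?P ?P"
    by (intro measurable_restrict measurable_compose[OF _ cont] measurable_component_singleton) simp
  have "distr ?P ?P ?t = ?P"
  proof (rule PiM_eqI)
    fix A :: "'n \<times> 'n \<Rightarrow> 'f set" assume A: "\<And>p. p \<in> UNIV \<Longrightarrow> A p \<in> sets \<mu>"
    have "emeasure (distr ?P ?P ?t) (Pi\<^sub>E UNIV A) = emeasure ?P (Pi\<^sub>E UNIV (\<lambda>p. {x. X $ fst p $ snd p + x \<in> A p}))"
      using t A assms by (subst emeasure_distr)
        (auto simp: space_PiM haar_space PiE_iff intro!: sets_PiM_I_finite arg_cong2[where f=emeasure])
    also have "\<dots> = (\<Prod>p\<in>UNIV. emeasure \<mu> {x. X $ fst p $ snd p + x \<in> A p})"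
    proof (rule emeasure_PiM)
      show "{x. X $ fst p $ snd p + x \<in> A p} \<in> sets \<mu>" for p
        using measurable_sets[OF cont A, of p "X $ fst p $ snd p"] assms by (simp add: vimage_def haar_space)
    qed simp
    also have "\<dots> = (\<Prod>p\<in>UNIV. emeasure \<mu> (A p))"
      using A assms by (intro prod.cong haar_measure_translate) (auto simp: haar_sets)
    finally show "emeasure (distr ?P ?P ?t) (Pi\<^sub>E UNIV A) = (\<Prod>p\<in>UNIV. emeasure \<mu> (A p))" .
  qed auto
  then have "matrix_measure \<mu> = distr (distr ?P ?P ?t) borel ?m" by (simp add: matrix_measure_def)
  also have "\<dots> = distr ?P borel (?m \<circ> ?t)"
    using t matrix_of_pairs_measurable[OF assms] by (intro distr_distr)
  also have "?m \<circ> ?t = (\<lambda>h. h + X) \<circ> ?m" by (auto simp: vec_eq_iff fun_eq_iff add.commute)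
  also have "distr ?P borel ((\<lambda>h. h + X) \<circ> ?m) = distr (distr ?P borel ?m) borel (\<lambda>h. h + X)"
    by (rule distr_distr[symmetric, OF matrix_add_measurable matrix_of_pairs_measurable[OF assms]])
  finally show ?thesis by (simp add: matrix_measure_def)
qed

text \<open>Translation invariance turns the integral into \<open>c\<close> times itself. This is the orthogonality of
  characters, in the form used for all cancellations below.\<close>
lemma matrix_integral_eigen_zero:
  fixes u :: "'f::nonarch_local_field^'n^'n::finite \<Rightarrow> complex"
  assumes "haar_measure \<mu>" "u \<in> borel_measurable borel" "\<And>h. u (h + X) = c * u h" "c \<noteq> 1"
  shows "(LINT h|matrix_measure \<mu>. u h) = 0"
proof -
  have m: "(\<lambda>h. h + X) \<in> borel_measurable (matrix_measure \<mu>)"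
    using matrix_add_measurable by (simp add: measurable_cong_sets[OF sets_matrix_measure refl])
  have "(LINT h|matrix_measure \<mu>. u h) = (LINT h|distr (matrix_measure \<mu>) borel (\<lambda>h. h + X). u h)"
    by (simp add: matrix_measure_translate[OF assms(1)])
  also have "\<dots> = (LINT h|matrix_measure \<mu>. u (h + X))"
    by (rule integral_distr[OF m assms(2)])
  also have "\<dots> = c * (LINT h|matrix_measure \<mu>. u h)" by (simp add: assms(3))
  finally show ?thesis using assms(4) by (metis mult_cancel_right1)
qed


section \<open>Haar measure on the general linear group\<close>

lemma GL_borel [measurable]: "(GL :: ('f::nonarch_local_field^'n^'n::finite) set) \<in> sets borel"
  by (rule borel_open[OF open_GL])

lemma space_gl_measure [simp]: "space (gl_measure \<mu>) = GL"
  by (simp add: gl_measure_def space_restrict_space)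

lemma sets_gl_measure: "sets (gl_measure \<mu>) = sets (restrict_space borel GL)"
  unfolding gl_measure_def by (intro sets_restrict_space_cong) simp

lemma det_power_measurable [measurable]:
  "(\<lambda>g::'f::nonarch_local_field^'n^'n::finite. nabs (det g) powi (- int m)) \<in> borel_measurable borel"
proof -
  have "continuous_on UNIV (\<lambda>g::'f^'n^'n. nabs (det g))" by (intro continuous_intros)
  then have [measurable]: "(\<lambda>g::'f^'n^'n. nabs (det g)) \<in> borel_measurable borel"
    by (rule borel_measurable_continuous_onI)
  show ?thesis unfolding power_int_minus power_int_of_nat by measurable
qed

lemma emeasure_gl_const_det:
  fixes \<mu> :: "'f::nonarch_local_field measure" and A :: "('f^'n^'n::finite) set"
  assumes "A \<in> sets borel" "A \<subseteq> GL" "\<And>g. g \<in> A \<Longrightarrow> nabs (det g) = c"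
  shows "emeasure (gl_measure \<mu>) A = ennreal (c powi (- int CARD('n))) * emeasure (matrix_measure \<mu>) A"
proof -
  have "emeasure (gl_measure \<mu>) A = (\<integral>\<^sup>+ g. ennreal (nabs (det g) powi (- int CARD('n))) * indicator A g \<partial>matrix_measure \<mu>)"
    unfolding gl_measure_def using assms
    by (subst emeasure_restrict_space) (auto simp: emeasure_density)
  also have "\<dots> = (\<integral>\<^sup>+ g. ennreal (c powi (- int CARD('n))) * indicator A g \<partial>matrix_measure \<mu>)"
    using assms(3) by (intro nn_integral_cong) (auto simp: indicator_def)
  also have "\<dots> = ennreal (c powi (- int CARD('n))) * emeasure (matrix_measure \<mu>) A"
    using assms(1) by (subst nn_integral_cmult) auto
  finally show ?thesis .
qed

lemma integral_gl_const_det: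
  fixes \<mu> :: "'f::nonarch_local_field measure" and f :: "'f^'n^'n::finite \<Rightarrow> complex"
  assumes "f \<in> borel_measurable borel" "\<And>g. f g \<noteq> 0 \<Longrightarrow> g \<in> GL \<and> nabs (det g) = c"
  shows "(LINT g|gl_measure \<mu>. f g) = of_real (c powi (- int CARD('n))) * (LINT g|matrix_measure \<mu>. f g)"
proof -
  have "(LINT g|gl_measure \<mu>. f g) = (LINT g|density (matrix_measure \<mu>) (\<lambda>g. ennreal (nabs (det g) powi (- int CARD('n)))).
     indicator GL g *\<^sub>R f g)"
    unfolding gl_measure_def by (subst integral_restrict_space) simp_all
  also have "\<dots> = (LINT g|matrix_measure \<mu>. nabs (det g) powi (- int CARD('n)) *\<^sub>R (indicator GL g *\<^sub>R f g))"
    using assms(1) by (intro integral_density) auto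
  also have "\<dots> = (LINT g|matrix_measure \<mu>. of_real (c powi (- int CARD('n))) * f g)"
  proof (rule Bochner_Integration.integral_cong)
    fix g :: "'f^'n^'n"
    show "nabs (det g) powi (- int CARD('n)) *\<^sub>R (indicator GL g *\<^sub>R f g) = of_real (c powi (- int CARD('n))) * f g"
      using assms(2)[of g] by (cases "f g = 0") (auto simp: scaleR_conv_of_real)
  qed simp
  finally show ?thesis by simp
qed

lemma K_sub_box:
  "(K_sub l :: ('f::nonarch_local_field^'n^'n::finite) set)
    = {h. \<forall>i j. h $ i $ j \<in> {y. y - mat 1 $ i $ j \<in> prime_power (int l)}}"
  by (simp add: K_sub_def)

lemma K_sub_borel [measurable]: "(K_sub l :: ('f::nonarch_local_field^'n^'n::finite) set) \<in> sets borel"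
proof -
  have "K_sub l = {h::'f^'n^'n. h - mat 1 \<in> matrix_lattice (int l)}" by (auto simp: K_sub_iff)
  then show ?thesis using borel_open[OF open_matrix_coset[of "mat 1 :: 'f^'n^'n" "int l"]] by simp
qed

lemma emeasure_matrix_K_sub:
  fixes \<mu> :: "'f::nonarch_local_field measure"
  assumes "haar_measure \<mu>"
  shows "emeasure (matrix_measure \<mu>) (K_sub l :: ('f^'n^'n::finite) set)
    = (\<Prod>i\<in>(UNIV::'n set). \<Prod>j\<in>(UNIV::'n set). emeasure \<mu> (prime_power (int l)))"
  unfolding K_sub_box using assms open_coset
  by (subst emeasure_matrix_box) (auto simp: haar_measure_coset)

lemma emeasure_gl_K_sub:
  fixes \<mu> :: "'f::nonarch_local_field measure"
  assumes "1 \<le> l"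
  shows "emeasure (gl_measure \<mu>) (K_sub l :: ('f^'n^'n::finite) set) = emeasure (matrix_measure \<mu>) (K_sub l :: ('f^'n^'n) set)"
  using emeasure_gl_const_det[of "K_sub l :: ('f^'n^'n) set" 1 \<mu>] K_sub_nabs_det assms K_sub_subset_GL by force

lemma K_sub_volume:
  fixes \<mu> :: "'f::nonarch_local_field measure"
  assumes "haar_measure \<mu>" "1 \<le> l"
  shows "0 < emeasure (gl_measure \<mu>) (K_sub l :: ('f^'n^'n::finite) set)"
    and "emeasure (gl_measure \<mu>) (K_sub l :: ('f^'n^'n::finite) set) < \<infinity>"
    and "0 < measure (gl_measure \<mu>) (K_sub l :: ('f^'n^'n::finite) set)"
proof -
  show 1: "0 < emeasure (gl_measure \<mu>) (K_sub l :: ('f^'n^'n::finite) set)"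
    and 2: "emeasure (gl_measure \<mu>) (K_sub l :: ('f^'n^'n::finite) set) < \<infinity>"
    unfolding emeasure_gl_K_sub[OF assms(2)] emeasure_matrix_K_sub[OF assms(1)]
    using haar_prime_power_pos[OF assms(1), of "int l"] haar_prime_power_finite[OF assms(1), of "int l"]
    by (auto simp: zero_less_iff_neq_zero power_less_top_ennreal)
  show "0 < measure (gl_measure \<mu>) (K_sub l :: ('f^'n^'n::finite) set)"
    using 1 2 by (simp add: measure_def enn2real_positive_iff)
qed

lemma det_fibre_sets:
  "det_fibre_measures \<mu> D \<Longrightarrow> x \<noteq> 0 \<Longrightarrow> sets (D x) = sets (restrict_space borel {g. det g = x})"
  by (simp add: det_fibre_measures_def)

lemma det_fibre_space: "det_fibre_measures \<mu> D \<Longrightarrow> x \<noteq> 0 \<Longrightarrow> space (D x) = {g. det g = x}"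
  using sets_eq_imp_space_eq[OF det_fibre_sets] by (simp add: space_restrict_space)

lemma det_fibre_inv:
  "det_fibre_measures \<mu> D \<Longrightarrow> x \<noteq> 0 \<Longrightarrow> det h = 1 \<Longrightarrow> distr (D x) (D x) (\<lambda>g. h ** g) = D x"
  "det_fibre_measures \<mu> D \<Longrightarrow> x \<noteq> 0 \<Longrightarrow> det h = 1 \<Longrightarrow> distr (D x) (D x) (\<lambda>g. g ** h) = D x"
  by (simp_all add: det_fibre_measures_def)

lemma det_fibre_mult_measurable:
  fixes D :: "'f \<Rightarrow> ('f::nonarch_local_field^'n^'n::finite) measure"
  assumes "det_fibre_measures \<mu> D" "x \<noteq> 0" "det h = 1"
  shows "(\<lambda>g. h ** g) \<in> measurable (D x) (D x)" "(\<lambda>g. g ** h) \<in> measurable (D x) (D x)"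
  unfolding measurable_cong_sets[OF det_fibre_sets[OF assms(1,2)] det_fibre_sets[OF assms(1,2)]]
  using assms(3)
  by (intro measurable_restrict_space2 measurable_restrict_space1 matrix_mult_measurable;
      auto simp: space_restrict_space det_mul)+

lemma space_mult_measure [simp]: "space (mult_measure \<mu>) = space \<mu> - {0}"
  by (auto simp: mult_measure_def space_restrict_space)

text \<open>The integration formula on indicators, from which the formula for test functions follows by linearity.\<close>
lemma det_fibre_emeasure:
  fixes D :: "'f \<Rightarrow> ('f::nonarch_local_field^'n^'n::finite) measure"
  assumes "det_fibre_measures \<mu> D" "A \<in> sets borel" "A \<subseteq> GL"
  shows "emeasure (gl_measure \<mu>) A = (\<integral>\<^sup>+ x. emeasure (D x) (A \<inter> space (D x)) \<partial>mult_measure \<mu>)"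
proof -
  have A: "A \<in> sets (gl_measure \<mu> :: ('f^'n^'n) measure)"
    using assms by (auto simp: sets_gl_measure sets_restrict_space)
  then have "emeasure (gl_measure \<mu>) A = (\<integral>\<^sup>+ g. indicator A g \<partial>gl_measure \<mu>)" by simp
  also have "\<dots> = (\<integral>\<^sup>+ x. (\<integral>\<^sup>+ g. indicator A g \<partial>D x) \<partial>mult_measure \<mu>)"
    using assms(1) borel_measurable_indicator[OF A] unfolding det_fibre_measures_def by blast
  also have "\<dots> = (\<integral>\<^sup>+ x. emeasure (D x) (A \<inter> space (D x)) \<partial>mult_measure \<mu>)"
  proof (rule nn_integral_cong)
    fix x assume "x \<in> space (mult_measure \<mu>)"
    then have x: "x \<noteq> 0" by simp
    have "A \<inter> space (D x) \<in> sets (D x)"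
      using det_fibre_sets[OF assms(1) x] det_fibre_space[OF assms(1) x] assms(2)
      by (auto simp: sets_restrict_space)
    then show "(\<integral>\<^sup>+ g. indicator A g \<partial>D x) = emeasure (D x) (A \<inter> space (D x))"
      by (rule nn_integral_indicator')
  qed
  finally show ?thesis .
qed

text \<open>Invariance of the fibre measures under the special linear group passes to \<open>gl_measure\<close>
  through the integration formula.\<close>
lemma gl_measure_SL_invariant:
  fixes D :: "'f \<Rightarrow> ('f::nonarch_local_field^'n^'n::finite) measure" and h :: "'f^'n^'n"
  assumes "det_fibre_measures \<mu> D" "A \<in> sets borel" "A \<subseteq> GL" "det h = 1"
  shows "emeasure (gl_measure \<mu>) {g. h ** g \<in> A} = emeasure (gl_measure \<mu>) A"
proof -
  from measurable_sets[OF matrix_mult_measurable(1) assms(2)] have m: "{g. h ** g \<in> A} \<in> sets borel" by (simp add: vimage_def)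
  have s: "{g. h ** g \<in> A} \<subseteq> GL" using assms(3,4) by (auto simp: GL_iff_det det_mul)
  have "emeasure (D x) (A \<inter> space (D x)) = emeasure (D x) ({g. h ** g \<in> A} \<inter> space (D x))"
    if "x \<in> space (mult_measure \<mu>)" for x
  proof -
    have x: "x \<noteq> 0" using that by simp
    have A: "A \<inter> space (D x) \<in> sets (D x)"
      using det_fibre_sets[OF assms(1) x] det_fibre_space[OF assms(1) x] assms(2)
      by (auto simp: sets_restrict_space)
    have "emeasure (D x) (A \<inter> space (D x)) = emeasure (distr (D x) (D x) (\<lambda>g. h ** g)) (A \<inter> space (D x))"
      by (simp add: det_fibre_inv(1)[OF assms(1) x assms(4)])
    also have "\<dots> = emeasure (D x) ((\<lambda>g. h ** g) -` (A \<inter> space (D x)) \<inter> space (D x))"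
      by (rule emeasure_distr[OF det_fibre_mult_measurable(1)[OF assms(1) x assms(4)] A])
    also have "(\<lambda>g. h ** g) -` (A \<inter> space (D x)) \<inter> space (D x) = {g. h ** g \<in> A} \<inter> space (D x)"
      using assms(4) by (auto simp: det_fibre_space[OF assms(1) x] det_mul)
    finally show ?thesis .
  qed
  then show ?thesis
    unfolding det_fibre_emeasure[OF assms(1) m s] det_fibre_emeasure[OF assms(1-3)]
    by (intro nn_integral_cong) simp
qed

definition diag_one :: "'f::nonarch_local_field \<Rightarrow> 'n \<Rightarrow> 'f^'n^'n::finite" where
  "diag_one a i0 = (\<chi> i j. if i = j then if i = i0 then a else 1 else 0)"

lemma det_diag_one: "det (diag_one a i0) = a"
  by (subst det_diagonal) (auto simp: diag_one_def)

lemma diag_one_mult: "(diag_one a i0 ** h) $ i $ j = (if i = i0 then a else 1) * h $ i $ j"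
proof -
  have "(diag_one a i0 ** h) $ i $ j = (\<Sum>k\<in>UNIV. if k = i then (if i = i0 then a else 1) * h $ i $ j else 0)"
    unfolding matrix_matrix_mult_def diag_one_def vec_lambda_beta by (intro sum.cong) auto
  then show ?thesis by simp
qed

lemma matrix_inv_diag_one:
  assumes "a \<noteq> 0"
  shows "matrix_inv (diag_one a i0) = diag_one (inverse a) i0"
proof (rule GL_inv_unique)
  show "diag_one a i0 ** diag_one (inverse a) i0 = mat 1"
    using assms by (simp add: vec_eq_iff diag_one_mult) (simp add: diag_one_def mat_def)
qed (simp add: GL_iff_det det_diag_one assms)

lemma K_coset_nabs_det:
  assumes "g \<in> GL" "h \<in> K_coset l g" "1 \<le> l"
  shows "nabs (det h) = nabs (det g)" "h \<in> GL"
proof -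
  obtain k where k: "k \<in> K_sub l" "h = g ** k" using assms by (blast elim: K_cosetE)
  then have "nabs (det k) = 1" using K_sub_nabs_det assms(3) by blast
  then show "nabs (det h) = nabs (det g)" "h \<in> GL"
    using k assms(1) by (auto simp: GL_iff_det det_mul nabs_mult)
qed

text \<open>For \<open>d = diag(a, 1, \<dots>, 1)\<close>, with \<open>a\<close> in row \<open>i0\<close>, the coset \<open>d K\<^sub>l\<close> is a box in which the balls of
  one row are scaled by \<open>a\<close>; the additive volume gains \<open>|a|\<^sup>n\<close>, which the density \<open>|det g|\<^sup>-\<^sup>n\<close> removes.\<close>
lemma gl_measure_K_coset_diag:
  fixes \<mu> :: "'f::nonarch_local_field measure" and i0 :: "'n::finite"
  assumes "haar_measure \<mu>" "1 \<le> l" "a \<noteq> 0"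
  shows "emeasure (gl_measure \<mu>) (K_coset l (diag_one a i0)) = emeasure (gl_measure \<mu>) (K_sub l :: ('f^'n^'n) set)"
proof -
  obtain v where "nabs a = resq TYPE('f) powi v" using nabs_eq_powi[OF assms(3)] .
  then have v: "nabs a = resq TYPE('f) powi (- (- v))" by simp
  let ?d = "diag_one a i0" and ?w = "\<lambda>i. if i = i0 then int l + (- v) else int l"
  have dGL: "?d \<in> GL" using assms(3) by (simp add: GL_iff_det det_diag_one)
  have iff: "inverse a * y - x \<in> prime_power (int l) \<longleftrightarrow> y - a * x \<in> prime_power (int l + (- v))" for x y
  proof -
    have "a * (inverse a * y - x) = y - a * x" using assms(3) by (simp add: right_diff_distrib)
    then show ?thesis using prime_power_unit_scale[OF v, of "inverse a * y - x" "int l"]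
      by (simp only: add.commute)
  qed
  have "K_coset l ?d = {h. \<forall>i j. h $ i $ j \<in> {y. y - ?d $ i $ j \<in> prime_power (?w i)}}"
    using iff[of _ 0] iff[of _ 1]
    by (simp add: K_coset_def K_sub_def matrix_inv_diag_one[OF assms(3)] diag_one_mult)
       (auto simp: diag_one_def mat_def; metis)
  then have "emeasure (matrix_measure \<mu>) (K_coset l ?d)
      = (\<Prod>i\<in>(UNIV::'n set). \<Prod>j\<in>(UNIV::'n set). emeasure \<mu> (prime_power (?w i)))"
    using emeasure_matrix_box[OF assms(1) open_coset, of "\<lambda>i j. ?d $ i $ j" "\<lambda>i j. ?w i"]
    by (simp add: haar_measure_coset[OF assms(1)])
  also have "\<dots> = (\<Prod>i\<in>(UNIV::'n set). (if i = i0 then ennreal (nabs a) ^ CARD('n) else 1) * (\<Prod>j\<in>(UNIV::'n set). emeasure \<mu> (prime_power (int l))))"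
    using haar_prime_power_shift[OF assms(1), of "int l" "- v"] v
    by (intro prod.cong) (auto simp: power_mult_distrib)
  also have "\<dots> = ennreal (nabs a) ^ CARD('n) * emeasure (matrix_measure \<mu>) (K_sub l :: ('f^'n^'n) set)"
    by (simp add: prod.distrib emeasure_matrix_K_sub[OF assms(1)])
  finally have m: "emeasure (matrix_measure \<mu>) (K_coset l ?d)
     = ennreal (nabs a) ^ CARD('n) * emeasure (matrix_measure \<mu>) (K_sub l :: ('f^'n^'n) set)" .
  have "emeasure (gl_measure \<mu>) (K_coset l ?d)
    = ennreal (nabs a powi (- int CARD('n))) * emeasure (matrix_measure \<mu>) (K_coset l ?d)"
    using K_coset_nabs_det[OF dGL _ assms(2)] borel_open[OF open_K_coset[of l ?d]]
    by (intro emeasure_gl_const_det) (auto simp: det_diag_one)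
  also have "\<dots> = (ennreal (nabs a powi (- int CARD('n))) * ennreal (nabs a) ^ CARD('n))
     * emeasure (matrix_measure \<mu>) (K_sub l :: ('f^'n^'n) set)"
    by (simp add: m mult.assoc)
  also have "ennreal (nabs a powi (- int CARD('n))) * ennreal (nabs a) ^ CARD('n) = 1"
    using assms(3) nabs_pos[OF assms(3)]
    by (simp add: ennreal_power ennreal_mult[symmetric] power_int_minus)
  finally show ?thesis by (simp add: emeasure_gl_K_sub[OF assms(2)])
qed

text \<open>Left invariance on cosets: every \<open>g\<close> is an element of the special linear group times
  \<open>diag(det g, 1, \<dots>, 1)\<close>.\<close>
lemma gl_measure_K_coset:
  fixes D :: "'f \<Rightarrow> ('f::nonarch_local_field^'n^'n::finite) measure" and g :: "'f^'n^'n"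
  assumes "haar_measure \<mu>" "det_fibre_measures \<mu> D" "1 \<le> l" "g \<in> GL"
  shows "emeasure (gl_measure \<mu>) (K_coset l g) = emeasure (gl_measure \<mu>) (K_sub l :: ('f^'n^'n) set)"
proof -
  \<comment> \<open>any row will do\<close>
  let ?d = "diag_one (det g) (undefined::'n)"
  define h where "h = ?d ** matrix_inv g"
  have g0: "det g \<noteq> 0" using assms(4) by (simp add: GL_iff_det)
  then have dGL: "?d \<in> GL" by (simp add: GL_iff_det det_diag_one)
  have h: "det h = 1" using g0 by (simp add: h_def det_mul det_diag_one det_matrix_inv[OF assms(4)])
  have "matrix_inv ?d ** (h ** x) = matrix_inv g ** x" for x :: "'f^'n^'n"
    by (simp add: h_def matrix_mul_assoc GL_inv[OF dGL])
  then have "K_coset l g = {x. h ** x \<in> K_coset l ?d}" by (simp add: K_coset_def)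
  then have "emeasure (gl_measure \<mu>) (K_coset l g) = emeasure (gl_measure \<mu>) (K_coset l ?d)"
    using gl_measure_SL_invariant[OF assms(2) _ _ h, of "K_coset l ?d"] open_K_coset[of l ?d]
      K_coset_nabs_det(2)[OF dGL _ assms(3)] by (simp add: subset_iff)
  then show ?thesis using gl_measure_K_coset_diag[OF assms(1,3) g0] by simp
qed


section \<open>Orthogonality of additive characters\<close>

lemma additive_character_add: "additive_character \<psi> \<Longrightarrow> \<psi> (x + y) = \<psi> x * \<psi> y"
  by (simp add: additive_character_def)

lemma conductor_integers_trivial: "conductor_integers \<psi> \<Longrightarrow> x \<in> prime_power 0 \<Longrightarrow> \<psi> x = 1"
  by (simp add: conductor_integers_def)

text \<open>The annihilator of \<open>\<pp>\<^sup>m\<close> under the pairing \<open>\<psi>(a t)\<close> is no larger than \<open>\<pp>\<^sup>-\<^sup>m\<close>: if \<open>a\<close> lies outside,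
  then \<open>a \<pp>\<^sup>m\<close> contains \<open>\<pp>\<^sup>-\<^sup>1\<close>, where \<open>\<psi>\<close> is nontrivial.\<close>
lemma conductor_integers_detect:
  fixes a :: "'f::nonarch_local_field"
  assumes "conductor_integers \<psi>" "a \<notin> prime_power (- m)"
  obtains t where "t \<in> prime_power m" "\<psi> (a * t) \<noteq> 1"
proof -
  obtain y where y: "y \<in> prime_power (- 1)" "\<psi> y \<noteq> 1" using assms(1) by (auto simp: conductor_integers_def)
  have a: "resq TYPE('f) powi (1 + m) \<le> nabs a" using not_mem_prime_power[OF assms(2)] by simp
  have a0: "a \<noteq> 0" using assms(2) by auto
  have "nabs y \<le> resq TYPE('f) powi 1" using y(1) by (simp add: prime_power_def)
  also have "\<dots> = resq TYPE('f) powi (1 + m) * resq TYPE('f) powi (- m)"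
    using resq_powi_add[where 'f='f, of "1 + m" "- m"] by simp
  also have "\<dots> \<le> nabs a * resq TYPE('f) powi (- m)"
    using a resq_powi_pos[where 'f='f, of "-m"] by (intro mult_right_mono) auto
  finally have "nabs (y / a) \<le> resq TYPE('f) powi (- m)"
    using nabs_pos[OF a0] by (simp add: nabs_divide divide_le_eq mult.commute)
  then have "y / a \<in> prime_power m" by (simp add: prime_power_def)
  moreover have "a * (y / a) = y" using a0 by simp
  ultimately show ?thesis using that[of "y / a"] y(2) by metis
qed

lemma continuous_on_trace [continuous_intros]:
  fixes f :: "'x::topological_space \<Rightarrow> 'f::nonarch_local_field^'n^'n::finite"
  assumes "continuous_on S f"
  shows "continuous_on S (\<lambda>x. trace (f x))"
proof -
  have "((\<lambda>x. trace (f x)) \<longlongrightarrow> trace (f a)) (at a within S)" if "a \<in> S" for a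
    unfolding trace_def using assms that
    by (intro tendsto_intros) (auto simp: continuous_on_def)
  then show ?thesis by (simp add: continuous_on_def)
qed

lemma psi_trace_measurable:
  fixes f :: "'f::nonarch_local_field^'n^'n::finite \<Rightarrow> 'f^'n^'n"
  assumes "additive_character \<psi>" "continuous_on UNIV f"
  shows "(\<lambda>g. \<psi> (trace (f g))) \<in> borel_measurable borel"
proof (rule borel_measurable_continuous_onI)
  have "continuous_on UNIV \<psi>" using assms(1) by (simp add: additive_character_def)
  then show "continuous_on UNIV (\<lambda>g. \<psi> (trace (f g)))"
    by (rule continuous_on_compose2) (auto intro!: continuous_intros assms(2))
qed

lemma psi_trace_perturb:
  assumes "additive_character \<psi>" "conductor_integers \<psi>" "g \<in> matrix_lattice (- k)" "X \<in> matrix_lattice k"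
  shows "\<psi> (trace (g + g ** X)) = \<psi> (trace g)"
proof -
  have "trace (g ** X) \<in> prime_power 0" using matrix_lattice_mult[OF assms(3,4)] by (simp add: trace_in_prime_power)
  then show ?thesis using assms(1,2) by (simp add: trace_add additive_character_add conductor_integers_trivial)
qed

lemma not_mem_matrix_lattice:
  fixes g :: "'f::nonarch_local_field^'n^'n::finite"
  assumes "g \<notin> matrix_lattice k"
  obtains i j where "g $ i $ j \<notin> prime_power k"
  using assms by (auto simp: matrix_lattice_def)

lemma integral_complex_indicator:
  "(LINT x|M. indicator A x :: complex) = of_real (measure M (A \<inter> space M))"
proof -
  have "(LINT x|M. indicator A x :: complex) = (LINT x|M. complex_of_real (indicator A x))"
    by (intro Bochner_Integration.integral_cong) (auto simp: indicator_def)
  also have "\<dots> = of_real (LINT x|M. indicator A x)" by (rule integral_complex_of_real)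
  finally show ?thesis by simp
qed

text \<open>\<open>K\<^sub>l\<close> is a translate of the lattice \<open>M\<^sub>n(\<pp>\<^sup>l)\<close>, whose dual under \<open>\<psi>(tr x y)\<close> is \<open>M\<^sub>n(\<pp>\<^sup>-\<^sup>l)\<close>: for \<open>x\<close> in
  the dual lattice the phase is constant on \<open>K\<^sub>l\<close>, otherwise a translation by an elementary matrix in
  \<open>M\<^sub>n(\<pp>\<^sup>l)\<close> changes it by a nontrivial constant.\<close>
lemma matrix_fourier_c_fun:
  fixes \<mu> :: "'f::nonarch_local_field measure" and x :: "'f^'n^'n::finite"
  assumes \<psi>: "additive_character \<psi>" "conductor_integers \<psi>" and \<mu>: "haar_measure \<mu>" and l: "1 \<le> l"
  shows "matrix_fourier \<mu> \<psi> (c_fun \<mu> l) x = \<psi> (trace x) * indicator (matrix_lattice (- int l)) x"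
proof -
  let ?K = "K_sub l :: ('f^'n^'n) set"
  define v where "v = measure (gl_measure \<mu>) ?K"
  have v: "0 < v" unfolding v_def by (rule K_sub_volume(3)[OF \<mu> l])
  have vm: "v = measure (matrix_measure \<mu>) ?K" by (simp add: v_def measure_def emeasure_gl_K_sub[OF l])
  have c: "c_fun \<mu> l y = of_real (inverse v) * indicator ?K y" for y by (simp add: c_fun_def v_def)
  show ?thesis
  proof (cases "x \<in> matrix_lattice (- int l)")
    case True
    have "c_fun \<mu> l y * \<psi> (trace (x ** y)) = (of_real (inverse v) * \<psi> (trace x)) * indicator ?K y" for y
    proof (cases "y \<in> ?K")
      case K: True
      have "x ** y = x + x ** (y - mat 1)" by (simp add: matrix_mult_diff_left)
      then have "\<psi> (trace (x ** y)) = \<psi> (trace x)"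
        using psi_trace_perturb[OF \<psi> True, of "y - mat 1"] K by (simp add: K_sub_iff)
      then show ?thesis by (simp add: c)
    qed (simp add: c)
    then have "matrix_fourier \<mu> \<psi> (c_fun \<mu> l) x
        = of_real (inverse v) * \<psi> (trace x) * (LINT y|matrix_measure \<mu>. indicator ?K y)"
      unfolding matrix_fourier_def by simp
    also have "(LINT y|matrix_measure \<mu>. indicator ?K y :: complex) = of_real v"
      by (simp add: vm integral_complex_indicator)
    finally show ?thesis using True v by simp
  next
    case False
    then obtain i j where "x $ i $ j \<notin> prime_power (- int l)" by (rule not_mem_matrix_lattice)
    then obtain t where t: "t \<in> prime_power (int l)" "\<psi> (x $ i $ j * t) \<noteq> 1"
      using conductor_integers_detect[OF \<psi>(2)] by metis
    let ?X = "elem j i t"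
    have X: "?X \<in> matrix_lattice (int l)" by (rule elem_in_matrix_lattice[OF t(1)])
    have K: "y + ?X \<in> ?K \<longleftrightarrow> y \<in> ?K" for y
      using matrix_lattice_add[OF _ X, of "y - mat 1"] matrix_lattice_diff[OF _ X, of "y + ?X - mat 1"]
      by (auto simp: K_sub_iff algebra_simps)
    have "(LINT y|matrix_measure \<mu>. c_fun \<mu> l y * \<psi> (trace (x ** y))) = 0"
    proof (rule matrix_integral_eigen_zero[OF \<mu> _ _ t(2)])
      have "continuous_on UNIV (\<lambda>y::'f^'n^'n. x ** y)"
        by (rule continuous_on_matrix_mult[OF continuous_on_const continuous_on_id])
      then have [measurable]: "(\<lambda>y. \<psi> (trace (x ** y))) \<in> borel_measurable borel"
        by (rule psi_trace_measurable[OF \<psi>(1)])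
      show "(\<lambda>y. c_fun \<mu> l y * \<psi> (trace (x ** y))) \<in> borel_measurable borel"
        unfolding c by measurable
      show "c_fun \<mu> l (y + ?X) * \<psi> (trace (x ** (y + ?X)))
        = \<psi> (x $ i $ j * t) * (c_fun \<mu> l y * \<psi> (trace (x ** y)))" for y
        by (simp add: c K indicator_def matrix_add_ldistrib trace_add trace_mult_elem additive_character_add[OF \<psi>(1)])
    qed
    then show ?thesis using False by (simp add: matrix_fourier_def)
  qed
qed

text \<open>The convolution averages \<open>\<Phi>\<^sub>G\<^sub>J\<close> over \<open>g K\<^sub>l\<close>, a translate of the lattice \<open>g M\<^sub>n(\<pp>\<^sup>l)\<close> on which \<open>|det|\<close> is
  constant, so the same duality argument applies. With the previous lemma, the truncated kernel integrand
  and the Fourier-transformed zeta integrand agree up to a power of \<open>|det g|\<close>.\<close>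
lemma gl_convolution_Phi_GJ:
  fixes \<mu> :: "'f::nonarch_local_field measure" and g :: "'f^'n^'n::finite"
  assumes \<psi>: "additive_character \<psi>" "conductor_integers \<psi>" and \<mu>: "haar_measure \<mu>"
    and D: "det_fibre_measures \<mu> (D :: 'f \<Rightarrow> ('f^'n^'n) measure)" and l: "1 \<le> l" and g: "g \<in> GL"
  shows "gl_convolution \<mu> (Phi_GJ \<psi>) (vee (c_fun \<mu> l)) g
    = Phi_GJ \<psi> g * indicator (matrix_lattice (- int l)) g"
proof -
  let ?K = "K_sub l :: ('f^'n^'n) set" and ?B = "K_coset l g"
  define v where "v = measure (gl_measure \<mu>) ?K"
  define d where "d = complex_of_real (nabs (det g) powr (real CARD('n) / 2))"
  have v: "0 < v" unfolding v_def by (rule K_sub_volume(3)[OF \<mu> l])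
  have B: "?B \<in> sets borel" by (rule borel_open[OF open_K_coset])
  have Bgl: "?B \<in> sets (gl_measure \<mu>)"
    using B K_coset_nabs_det(2)[OF g _ l] by (auto simp: sets_gl_measure sets_restrict_space)
  have Bv: "measure (gl_measure \<mu>) ?B = v"
    using gl_measure_K_coset[OF \<mu> D l g] by (simp add: v_def measure_def)
  have "gl_convolution \<mu> (Phi_GJ \<psi>) (vee (c_fun \<mu> l)) g
    = (LINT h|gl_measure \<mu>. (of_real (inverse v) * d) * (indicator ?B h * \<psi> (trace h)))"
    unfolding gl_convolution_def
  proof (rule Bochner_Integration.integral_cong)
    fix h :: "'f^'n^'n" assume "h \<in> space (gl_measure \<mu>)"
    then have h: "h \<in> GL" by simp
    have "matrix_inv (matrix_inv h ** g) = matrix_inv g ** h"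
      using matrix_inv_mult[OF GL_matrix_inv[OF h] g] matrix_inv_matrix_inv[OF h] by simp
    then have "vee (c_fun \<mu> l) (matrix_inv h ** g) = of_real (inverse v) * indicator ?B h"
      by (simp add: vee_def c_fun_def v_def K_coset_def indicator_def)
    then show "Phi_GJ \<psi> h * vee (c_fun \<mu> l) (matrix_inv h ** g)
      = (of_real (inverse v) * d) * (indicator ?B h * \<psi> (trace h))"
      using K_coset_nabs_det(1)[OF g _ l, of h] by (cases "h \<in> ?B") (auto simp: Phi_GJ_def d_def)
  qed simp
  also have "\<dots> = (of_real (inverse v) * d) * (LINT h|gl_measure \<mu>. indicator ?B h * \<psi> (trace h))" by simp
  also have "\<dots> = Phi_GJ \<psi> g * indicator (matrix_lattice (- int l)) g"
  proof (cases "g \<in> matrix_lattice (- int l)")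
    case True
    have "indicator ?B h * \<psi> (trace h) = \<psi> (trace g) * indicator ?B h" for h
    proof (cases "h \<in> ?B")
      case True': True
      then obtain k where k: "k \<in> ?K" "h = g ** k" using K_cosetE[OF _ g] by metis
      have "h = g + g ** (k - mat 1)" by (simp add: k matrix_mult_diff_left)
      then have "\<psi> (trace h) = \<psi> (trace g)"
        using psi_trace_perturb[OF \<psi> True, of "k - mat 1"] k by (simp add: K_sub_iff)
      then show ?thesis by simp
    qed simp
    then have "(LINT h|gl_measure \<mu>. indicator ?B h * \<psi> (trace h))
      = \<psi> (trace g) * (LINT h|gl_measure \<mu>. indicator ?B h)" by (simp only: integral_mult_right_zero)
    also have "\<dots> = \<psi> (trace g) * of_real v" using Bv sets.sets_into_space[OF Bgl]
      by (simp add: integral_complex_indicator Int_absorb2)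
    finally have "(LINT h|gl_measure \<mu>. indicator ?B h * \<psi> (trace h)) = \<psi> (trace g) * of_real v" .
    then show ?thesis using v True by (simp add: Phi_GJ_def d_def)
  next
    case False
    then obtain i j where "g $ i $ j \<notin> prime_power (- int l)" by (rule not_mem_matrix_lattice)
    then obtain t where t: "t \<in> prime_power (int l)" "\<psi> (g $ i $ j * t) \<noteq> 1"
      using conductor_integers_detect[OF \<psi>(2)] by metis
    let ?X = "elem j i t"
    have X: "?X \<in> matrix_lattice (int l)" by (rule elem_in_matrix_lattice[OF t(1)])
    have K: "h + g ** ?X \<in> ?B \<longleftrightarrow> h \<in> ?B" for h
      using matrix_lattice_add[OF _ X, of "matrix_inv g ** h - mat 1"]
        matrix_lattice_diff[OF _ X, of "matrix_inv g ** h + ?X - mat 1"]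
      by (auto simp: K_coset_def K_sub_iff matrix_add_ldistrib matrix_inv_mult_cancel[OF g] algebra_simps)
    have [measurable]: "(\<lambda>h::'f^'n^'n. \<psi> (trace h)) \<in> borel_measurable borel"
      by (rule psi_trace_measurable[OF \<psi>(1) continuous_on_id])
    note B[measurable]
    have "(LINT h|matrix_measure \<mu>. indicator ?B h * \<psi> (trace h)) = 0"
    proof (rule matrix_integral_eigen_zero[OF \<mu> _ _ t(2)])
      show "(\<lambda>h. indicator ?B h * \<psi> (trace h)) \<in> borel_measurable borel" by measurable
      show "indicator ?B (h + g ** ?X) * \<psi> (trace (h + g ** ?X))
        = \<psi> (g $ i $ j * t) * (indicator ?B h * \<psi> (trace h))" for h
        by (simp add: K indicator_def trace_add trace_mult_elem additive_character_add[OF \<psi>(1)])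
    qed
    moreover have "(LINT h|gl_measure \<mu>. indicator ?B h * \<psi> (trace h))
      = of_real (nabs (det g) powi (- int CARD('n))) * (LINT h|matrix_measure \<mu>. indicator ?B h * \<psi> (trace h))"
      using K_coset_nabs_det[OF g _ l]
      by (intro integral_gl_const_det) (measurable, auto simp: indicator_def split: if_splits)
    ultimately show ?thesis using False by simp
  qed
  finally show ?thesis .
qed


section \<open>Locally constant functions and integration along the determinant\<close>

definition locally_const_on :: "'a::topological_space set \<Rightarrow> ('a \<Rightarrow> 'b) \<Rightarrow> bool" where
  "locally_const_on S f \<longleftrightarrow> (\<forall>x\<in>S. \<exists>U. open U \<and> x \<in> U \<and> (\<forall>y\<in>U. f y = f x))"

lemma locally_const_onI:
  "(\<And>x. x \<in> S \<Longrightarrow> \<exists>U. open U \<and> x \<in> U \<and> (\<forall>y\<in>U. f y = f x)) \<Longrightarrow> locally_const_on S f"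
  by (simp add: locally_const_on_def)

lemma locally_const_on_binop:
  assumes "locally_const_on S f" "locally_const_on S g"
  shows "locally_const_on S (\<lambda>x. h (f x) (g x))"
proof (rule locally_const_onI)
  fix x assume "x \<in> S"
  then obtain U V where UV: "open U" "x \<in> U" "open V" "x \<in> V"
    and fg: "\<forall>y\<in>U. f y = f x" "\<forall>y\<in>V. g y = g x"
    using assms unfolding locally_const_on_def by meson
  have "\<forall>y\<in>U \<inter> V. h (f y) (g y) = h (f x) (g x)" using fg by (metis IntE)
  moreover have "open (U \<inter> V)" "x \<in> U \<inter> V" using UV by (simp_all add: open_Int)
  ultimately show "\<exists>U. open U \<and> x \<in> U \<and> (\<forall>y\<in>U. h (f y) (g y) = h (f x) (g x))" by blast
qed

lemma locally_const_on_compose: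
  assumes "locally_const_on T g" "continuous_on UNIV f" "\<And>x. x \<in> S \<Longrightarrow> f x \<in> T"
  shows "locally_const_on S (\<lambda>x. g (f x))"
proof (rule locally_const_onI)
  fix x assume "x \<in> S"
  then obtain U where U: "open U" "f x \<in> U" "\<forall>y\<in>U. g y = g (f x)"
    using assms(1,3) unfolding locally_const_on_def by meson
  have "open (f -` U)" by (rule open_vimage[OF U(1) assms(2)])
  then show "\<exists>U. open U \<and> x \<in> U \<and> (\<forall>y\<in>U. g (f y) = g (f x))"
    using U(2,3) by blast
qed

lemma schwartz_bruhat_restrict:
  fixes f :: "'a::t2_space \<Rightarrow> complex"
  assumes "compact A" "open A" "A \<subseteq> S" "locally_const_on S f"
  shows "schwartz_bruhat (\<lambda>x. if x \<in> A then f x else 0)"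
  unfolding schwartz_bruhat_def
proof (intro conjI allI)
  fix x
  show "\<exists>U. open U \<and> x \<in> U \<and> (\<forall>y\<in>U. (if y \<in> A then f y else 0) = (if x \<in> A then f x else 0))"
  proof (cases "x \<in> A")
    case True
    then obtain U where U: "open U" "x \<in> U" and f: "\<forall>y\<in>U. f y = f x"
      using assms(3,4) unfolding locally_const_on_def by blast
    have "\<forall>y\<in>U \<inter> A. (if y \<in> A then f y else 0) = (if x \<in> A then f x else 0)"
      using f True by (metis IntE)
    moreover have "open (U \<inter> A)" "x \<in> U \<inter> A" using U True assms(2) by (simp_all add: open_Int)
    ultimately show ?thesis by blast
  next
    case False
    then show ?thesis using compact_imp_closed[OF assms(1)] by (intro exI[of _ "- A"]) auto
  qed
  have "closure {x. (if x \<in> A then f x else 0) \<noteq> 0} \<subseteq> A"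
    by (rule closure_minimal[OF _ compact_imp_closed[OF assms(1)]]) auto
  then have "closure {x. (if x \<in> A then f x else 0) \<noteq> 0} = A \<inter> closure {x. (if x \<in> A then f x else 0) \<noteq> 0}"
    by blast
  then show "compact (closure {x. (if x \<in> A then f x else 0) \<noteq> 0})"
    using compact_Int_closed[OF assms(1) closed_closure] by metis
qed

lemma schwartz_bruhat_indicator:
  fixes A :: "'a::t2_space set"
  assumes "compact A" "open A"
  shows "schwartz_bruhat (indicator A)"
proof -
  have "locally_const_on UNIV (\<lambda>_::'a. 1 :: complex)" by (auto simp: locally_const_on_def)
  from schwartz_bruhat_restrict[OF assms subset_UNIV this] show ?thesis
    by (simp add: indicator_def[abs_def] of_bool_def)
qed

lemma schwartz_bruhat_open_vimage:
  assumes "schwartz_bruhat f"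
  shows "open (f -` B)"
proof (subst open_subopen, intro ballI)
  fix x assume x: "x \<in> f -` B"
  obtain U where "open U" "x \<in> U" "\<forall>y\<in>U. f y = f x" using assms unfolding schwartz_bruhat_def by blast
  moreover from this x have "U \<subseteq> f -` B" by (metis subsetI vimageE vimageI)
  ultimately show "\<exists>T. open T \<and> x \<in> T \<and> T \<subseteq> f -` B" by blast
qed

lemma schwartz_bruhat_measurable: "schwartz_bruhat f \<Longrightarrow> f \<in> borel_measurable borel"
  by (intro borel_measurable_continuous_onI) (simp add: continuous_on_open_vimage schwartz_bruhat_open_vimage)

text \<open>The level sets form an open cover of the compact support.\<close>
lemma schwartz_bruhat_finite_range:
  assumes "schwartz_bruhat f"
  shows "finite (range f)"
proof -
  let ?K = "closure {x. f x \<noteq> 0}"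
  have "compact ?K" using assms by (simp add: schwartz_bruhat_def)
  moreover have "?K \<subseteq> (\<Union>c\<in>range f. f -` {c})" by auto
  ultimately obtain T where T: "T \<subseteq> range f" "finite T" "?K \<subseteq> (\<Union>c\<in>T. f -` {c})"
    using compactE_image[of ?K "range f" "\<lambda>c. f -` {c}"] schwartz_bruhat_open_vimage[OF assms] by metis
  have "range f \<subseteq> insert 0 T"
  proof (rule image_subsetI)
    fix x show "f x \<in> insert 0 T"
    proof (cases "f x = 0")
      case False
      then have "x \<in> ?K" using closure_subset[of "{x. f x \<noteq> 0}"] by auto
      then show ?thesis using T(3) by auto
    qed simp
  qed
  then show ?thesis using T(2) finite_subset by blast
qed

lemma schwartz_bruhat_compact_level:
  assumes "schwartz_bruhat f" "c \<noteq> 0"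
  shows "compact {x. f x = c}"
proof -
  have "open (f -` (- {c}))" by (rule schwartz_bruhat_open_vimage[OF assms(1)])
  then have "closed {x. f x = c}" by (simp add: closed_def vimage_def Compl_eq)
  moreover have "compact (closure {x. f x \<noteq> 0})" using assms(1) by (simp add: schwartz_bruhat_def)
  moreover have "{x. f x = c} = closure {x. f x \<noteq> 0} \<inter> {x. f x = c}"
    using assms(2) closure_subset[of "{x. f x \<noteq> 0}"] by auto
  ultimately show ?thesis using compact_Int_closed by metis
qed

lemma haar_compact_finite: "haar_measure \<mu> \<Longrightarrow> compact K \<Longrightarrow> emeasure \<mu> K < \<infinity>"
  by (simp add: haar_measure_def)

lemma sets_mult_measure:
  "haar_measure \<mu> \<Longrightarrow> sets (mult_measure \<mu>) = sets (restrict_space borel (UNIV - {0}))"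
  unfolding mult_measure_def by (intro sets_restrict_space_cong) (simp add: haar_sets)

lemma shell_sets_mult_measure:
  "haar_measure \<mu> \<Longrightarrow> shell m \<in> sets (mult_measure \<mu>)"
  using borel_open[OF open_shell, of m] mem_shell_nonzero
  by (auto simp: sets_mult_measure sets_restrict_space intro!: image_eqI[of _ _ "shell m"])

lemma shell_mult_measure_finite:
  fixes \<mu> :: "'f::nonarch_local_field measure"
  assumes "haar_measure \<mu>"
  shows "emeasure (mult_measure \<mu>) (shell m) < \<infinity>"
proof -
  have [measurable]: "(\<lambda>x::'f. nabs x) \<in> borel_measurable borel"
    by (intro borel_measurable_continuous_onI continuous_intros)
  have s [measurable]: "shell m \<in> sets \<mu>" using borel_open[OF open_shell] assms by (simp add: haar_sets)
  have "emeasure (mult_measure \<mu>) (shell m) = emeasure (density \<mu> (\<lambda>x. ennreal (inverse (nabs x)))) (shell m)"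
    unfolding mult_measure_def using mem_shell_nonzero
    by (intro emeasure_restrict_space) (auto simp: haar_sets[OF assms])
  also have "\<dots> = (\<integral>\<^sup>+ x. ennreal (inverse (nabs x)) * indicator (shell m) x \<partial>\<mu>)"
  proof (rule emeasure_density[OF _ s])
    have "(\<lambda>x::'f. ennreal (inverse (nabs x))) \<in> borel_measurable borel" by measurable
    then show "(\<lambda>x. ennreal (inverse (nabs x))) \<in> borel_measurable \<mu>"
      by (simp add: measurable_cong_sets[OF haar_sets[OF assms] refl])
  qed
  also have "\<dots> = (\<integral>\<^sup>+ x. ennreal (inverse (resq TYPE('f) powi (- m))) * indicator (shell m) x \<partial>\<mu>)"
    by (intro nn_integral_cong) (auto simp: indicator_def nabs_shell)
  also have "\<dots> = ennreal (inverse (resq TYPE('f) powi (- m))) * emeasure \<mu> (shell m)"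
    using s by (subst nn_integral_cmult) auto
  also have "\<dots> < \<infinity>" using haar_compact_finite[OF assms compact_shell, of m] by (simp add: ennreal_mult_less_top)
  finally show ?thesis .
qed

lemma shell_integrable:
  fixes \<mu> :: "'f::nonarch_local_field measure" and h :: "'f \<Rightarrow> complex"
  assumes "haar_measure \<mu>" "continuous_on (UNIV - {0}) h"
  shows "set_integrable (mult_measure \<mu>) (shell m) h"
proof -
  have h: "h \<in> borel_measurable (mult_measure \<mu>)"
    using borel_measurable_continuous_on_restrict[OF assms(2)]
    by (simp add: measurable_cong_sets[OF sets_mult_measure[OF assms(1)] refl])
  note [measurable] = h shell_sets_mult_measure[OF assms(1)]
  have m: "(\<lambda>x. indicator (shell m) x *\<^sub>R h x) \<in> borel_measurable (mult_measure \<mu>)" by measurable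
  have "continuous_on (shell m) h"
    using assms(2) by (rule continuous_on_subset) (auto dest: mem_shell_nonzero)
  then have "bounded (h ` shell m)" by (intro compact_imp_bounded compact_continuous_image compact_shell)
  then obtain B where B: "\<And>x. x \<in> shell m \<Longrightarrow> norm (h x) \<le> B" by (auto simp: bounded_iff)
  show ?thesis
    unfolding set_integrable_def
    by (rule integrableI_bounded_set[where A="shell m" and B=B])
      (use B m shell_sets_mult_measure[OF assms(1)] shell_mult_measure_finite[OF assms(1), of m] in auto)
qed

lemma det_fibre_continuous:
  assumes "det_fibre_measures \<mu> D" "schwartz_bruhat f" "\<And>g. g \<notin> GL \<Longrightarrow> f g = 0"
  shows "continuous_on (UNIV - {0}) (\<lambda>x. LINT g|D x. f g)"
  using assms unfolding det_fibre_measures_def by blast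

lemma det_fibre_borel:
  assumes "det_fibre_measures \<mu> D" "x \<noteq> 0" "f \<in> borel_measurable borel"
  shows "f \<in> borel_measurable (D x)"
  using measurable_restrict_space1[OF assms(3), of "{g. det g = x}"]
  by (simp add: measurable_cong_sets[OF det_fibre_sets[OF assms(1,2)] refl])

lemma det_fibre_compact:
  fixes D :: "'f \<Rightarrow> ('f::nonarch_local_field^'n^'n::finite) measure"
  assumes "det_fibre_measures \<mu> D" "x \<noteq> 0" "compact A"
  shows "A \<inter> space (D x) \<in> sets (D x)" "emeasure (D x) (A \<inter> space (D x)) < \<infinity>"
proof -
  have "A \<in> sets borel" using assms(3) by (intro borel_compact)
  then show "A \<inter> space (D x) \<in> sets (D x)"
    by (auto simp: det_fibre_sets[OF assms(1,2)] det_fibre_space[OF assms(1,2)] sets_restrict_space)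
  have "closed {g::'f^'n^'n. det g = x}"
    by (intro closed_Collect_eq continuous_intros)
  then have "compact (A \<inter> space (D x))"
    using compact_Int_closed[OF assms(3)] by (simp add: det_fibre_space[OF assms(1,2)])
  then show "emeasure (D x) (A \<inter> space (D x)) < \<infinity>"
    using assms(1,2) unfolding det_fibre_measures_def by (simp add: det_fibre_space[OF assms(1,2)])
qed

text \<open>Measurability of the inner integral in \<open>x\<close>, without which the integration formula says nothing about
  Bochner integrals, comes from its continuity on test functions. Confining \<open>A\<close> to one shell makes the outer
  integral one over a compact set.\<close>
lemma det_fibre_integral_indicator:
  fixes D :: "'f \<Rightarrow> ('f::nonarch_local_field^'n^'n::finite) measure"
  assumes \<mu>: "haar_measure \<mu>" and D: "det_fibre_measures \<mu> D"
    and A: "compact A" "open A" "A \<subseteq> det_shell j"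
  shows "integrable (gl_measure \<mu>) (indicator A :: _ \<Rightarrow> complex)"
    and "integrable (mult_measure \<mu>) (\<lambda>x. LINT g|D x. indicator A g :: complex)"
    and "(LINT g|gl_measure \<mu>. indicator A g :: complex) = (LINT x|mult_measure \<mu>. (LINT g|D x. indicator A g))"
proof -
  let ?F = "\<lambda>x. (LINT g|D x. indicator A g :: complex)"
  define a where "a x = measure (D x) (A \<inter> space (D x))" for x
  have AGL: "A \<subseteq> GL" using A(3) det_shell_subset_GL by blast
  have F: "?F x = of_real (a x)" for x
    by (simp add: a_def integral_complex_indicator)
  have a0: "a x = 0" if "x \<noteq> 0" "x \<notin> shell j" for x
  proof -
    have "A \<inter> space (D x) = {}" using A(3) that(2) by (auto simp: det_fibre_space[OF D that(1)] det_shell_def)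
    then show ?thesis by (simp add: a_def)
  qed
  have cont: "continuous_on (UNIV - {0}) ?F"
    using AGL by (intro det_fibre_continuous[OF D schwartz_bruhat_indicator[OF A(1,2)]]) (auto simp: indicator_def)
  have "integrable (mult_measure \<mu>) ?F \<longleftrightarrow> set_integrable (mult_measure \<mu>) (shell j) ?F"
    unfolding set_integrable_def
    by (rule Bochner_Integration.integrable_cong) (use a0 in \<open>auto simp: F split: split_indicator\<close>)
  then show int: "integrable (mult_measure \<mu>) ?F" using shell_integrable[OF \<mu> cont] by simp
  have "integrable (mult_measure \<mu>) (\<lambda>x. Re (?F x))" using int by (rule integrable_Re)
  then have inta: "integrable (mult_measure \<mu>) a" by (simp add: F)
  have "emeasure (gl_measure \<mu>) A = (\<integral>\<^sup>+ x. emeasure (D x) (A \<inter> space (D x)) \<partial>mult_measure \<mu>)"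
    by (rule det_fibre_emeasure[OF D borel_open[OF A(2)] AGL])
  also have "\<dots> = (\<integral>\<^sup>+ x. ennreal (a x) \<partial>mult_measure \<mu>)"
    using det_fibre_compact(2)[OF D _ A(1)]
    by (intro nn_integral_cong) (simp add: a_def emeasure_eq_ennreal_measure less_top)
  also have "\<dots> = ennreal (LINT x|mult_measure \<mu>. a x)"
    by (rule nn_integral_eq_integral[OF inta]) (simp add: a_def)
  finally have e: "emeasure (gl_measure \<mu>) A = ennreal (LINT x|mult_measure \<mu>. a x)" .
  have "0 \<le> (LINT x|mult_measure \<mu>. a x)" by (intro integral_nonneg_AE) (simp add: a_def)
  then have m: "measure (gl_measure \<mu>) A = (LINT x|mult_measure \<mu>. a x)" by (simp add: measure_def e)
  have Agl: "A \<in> sets (gl_measure \<mu>)"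
    using borel_open[OF A(2)] AGL by (auto simp: sets_gl_measure sets_restrict_space)
  then show "integrable (gl_measure \<mu>) (indicator A :: _ \<Rightarrow> complex)"
    using e by (intro integrable_real_indicator[THEN integrable_of_real, where 'a=complex, unfolded of_real_indicator]) auto
  have "(LINT x|mult_measure \<mu>. ?F x) = of_real (LINT x|mult_measure \<mu>. a x)" by (simp add: F)
  moreover have "(LINT g|gl_measure \<mu>. indicator A g :: complex) = of_real (measure (gl_measure \<mu>) A)"
    using AGL by (simp add: integral_complex_indicator Int_absorb2)
  ultimately show "(LINT g|gl_measure \<mu>. indicator A g :: complex) = (LINT x|mult_measure \<mu>. ?F x)" by (simp add: m)
qed

text \<open>A test function is a finite linear combination of indicators of its level sets, so Fubini's
  theorem along the determinant extends from indicators.\<close>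
lemma det_fibre_integral:
  fixes D :: "'f \<Rightarrow> ('f::nonarch_local_field^'n^'n::finite) measure"
  assumes \<mu>: "haar_measure \<mu>" and D: "det_fibre_measures \<mu> D"
    and f: "schwartz_bruhat f" "\<And>g. f g \<noteq> 0 \<Longrightarrow> g \<in> det_shell j"
  shows "integrable (gl_measure \<mu>) f"
    and "x \<noteq> 0 \<Longrightarrow> integrable (D x) f"
    and "(LINT g|gl_measure \<mu>. f g) = (LINT x|mult_measure \<mu>. (LINT g|D x. f g))"
proof -
  let ?R = "range f - {0}" and ?A = "\<lambda>c. {g. f g = c}"
  have fin: "finite ?R" using schwartz_bruhat_finite_range[OF f(1)] by simp
  have A: "compact (?A c)" "open (?A c)" "?A c \<subseteq> det_shell j" if "c \<in> ?R" for c
    using that schwartz_bruhat_compact_level[OF f(1)] schwartz_bruhat_open_vimage[OF f(1), of "{c}"] f(2)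
    by (auto simp: vimage_def)
  note ind = det_fibre_integral_indicator[OF \<mu> D A]
  have fe: "f = (\<lambda>g. \<Sum>c\<in>?R. c * indicator (?A c) g)"
  proof
    fix g
    have "(\<Sum>c\<in>?R. c * indicator (?A c) g) = (\<Sum>c\<in>?R. if c = f g then c else 0)"
      by (intro sum.cong) (auto simp: indicator_def)
    also have "\<dots> = f g" using fin by simp
    finally show "f g = (\<Sum>c\<in>?R. c * indicator (?A c) g)" ..
  qed
  have iD: "integrable (D x) (indicator (?A c) :: _ \<Rightarrow> complex)" if x: "x \<noteq> 0" and c: "c \<in> ?R" for x c
  proof (rule integrableI_bounded_set[where A="?A c \<inter> space (D x)" and B=1])
    show "indicator (?A c) \<in> borel_measurable (D x)"
      using borel_open[OF A(2)[OF c]] by (intro det_fibre_borel[OF D x] borel_measurable_indicator)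
  qed (use det_fibre_compact[OF D x A(1)[OF c]] in \<open>auto simp: indicator_def\<close>)
  show "integrable (gl_measure \<mu>) f"
    by (subst fe) (intro Bochner_Integration.integrable_sum integrable_mult_right ind(1))
  show "integrable (D x) f" if "x \<noteq> 0"
    by (subst fe) (intro Bochner_Integration.integrable_sum integrable_mult_right iD that)
  have "(LINT g|gl_measure \<mu>. f g) = (\<Sum>c\<in>?R. c * (LINT g|gl_measure \<mu>. indicator (?A c) g))"
    by (subst fe, subst Bochner_Integration.integral_sum) (auto intro!: integrable_mult_right ind(1))
  also have "\<dots> = (\<Sum>c\<in>?R. c * (LINT x|mult_measure \<mu>. (LINT g|D x. indicator (?A c) g)))"
    by (intro sum.cong refl) (subst ind(3), auto)
  also have "\<dots> = (LINT x|mult_measure \<mu>. (\<Sum>c\<in>?R. c * (LINT g|D x. indicator (?A c) g)))"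
    by (subst Bochner_Integration.integral_sum) (auto intro!: integrable_mult_right ind(2))
  also have "\<dots> = (LINT x|mult_measure \<mu>. (LINT g|D x. f g))"
  proof (rule Bochner_Integration.integral_cong)
    fix x assume "x \<in> space (mult_measure \<mu>)"
    then have x: "x \<noteq> 0" by simp
    show "(\<Sum>c\<in>?R. c * (LINT g|D x. indicator (?A c) g)) = (LINT g|D x. f g)"
      by (subst (2) fe, subst Bochner_Integration.integral_sum) (auto intro!: integrable_mult_right iD[OF x])
  qed simp
  finally show "(LINT g|gl_measure \<mu>. f g) = (LINT x|mult_measure \<mu>. (LINT g|D x. f g))" .
qed


section \<open>Stationary phase\<close>

definition right_invariant :: "nat \<Rightarrow> ('f::nonarch_local_field^'n^'n::finite \<Rightarrow> complex) \<Rightarrow> bool" where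
  "right_invariant l \<eta> \<longleftrightarrow> (\<forall>g\<in>GL. \<forall>k\<in>K_sub l. \<eta> (g ** k) = \<eta> g)"

lemma right_invariant_antimono: "right_invariant l \<eta> \<Longrightarrow> l \<le> m \<Longrightarrow> right_invariant m \<eta>"
  using K_sub_antimono by (fastforce simp: right_invariant_def)

lemma right_invariant_locally_const:
  fixes \<eta> :: "'f::nonarch_local_field^'n^'n::finite \<Rightarrow> complex"
  assumes "right_invariant l \<eta>"
  shows "locally_const_on GL \<eta>"
proof (rule locally_const_onI)
  fix g :: "'f^'n^'n" assume g: "g \<in> GL"
  have "\<forall>h\<in>K_coset l g. \<eta> h = \<eta> g"
  proof
    fix h assume "h \<in> K_coset l g"
    then obtain k where "k \<in> K_sub l" "h = g ** k" using K_cosetE[OF _ g] by metis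
    then show "\<eta> h = \<eta> g" using assms g by (simp add: right_invariant_def)
  qed
  then show "\<exists>U. open U \<and> g \<in> U \<and> (\<forall>h\<in>U. \<eta> h = \<eta> g)"
    using open_K_coset mem_K_coset_self[OF g] by blast
qed

lemma psi_locally_const:
  assumes "additive_character \<psi>" "conductor_integers \<psi>"
  shows "locally_const_on UNIV \<psi>"
proof (rule locally_const_onI)
  fix x :: 'a
  have "\<psi> y = \<psi> x" if "y - x \<in> prime_power 0" for y
    using additive_character_add[OF assms(1), of "y - x" x] conductor_integers_trivial[OF assms(2) that] by simp
  then show "\<exists>U. open U \<and> x \<in> U \<and> (\<forall>y\<in>U. \<psi> y = \<psi> x)"
    using open_coset[of x 0] by (intro exI[of _ "{y. y - x \<in> prime_power 0}"] conjI) (blast | simp)+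
qed

text \<open>Confining the determinant to one shell makes this a test function on \<open>GL\<^sub>n\<close> even when the compact open
  set \<open>A\<close> contains singular matrices, so that fibre integrals and integrals over \<open>GL\<^sub>n\<close> can be compared
  through it.\<close>
definition phase_cut :: "('f::nonarch_local_field \<Rightarrow> complex) \<Rightarrow> ('f^'n^'n::finite \<Rightarrow> complex) \<Rightarrow> int
    \<Rightarrow> ('f^'n^'n) set \<Rightarrow> 'f^'n^'n \<Rightarrow> complex" where
  "phase_cut \<psi> \<eta> j A g = (if g \<in> A \<inter> det_shell j then \<psi> (trace g) * \<eta> g else 0)"

lemma phase_cut_schwartz_bruhat:
  fixes A :: "('f::nonarch_local_field^'n^'n::finite) set"
  assumes \<psi>: "additive_character \<psi>" "conductor_integers \<psi>" and \<eta>: "right_invariant l \<eta>"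
    and A: "compact A" "open A"
  shows "schwartz_bruhat (phase_cut \<psi> \<eta> j A)"
proof -
  have "continuous_on UNIV (\<lambda>g::'f^'n^'n. trace g)" by (intro continuous_intros)
  then have "locally_const_on GL (\<lambda>g::'f^'n^'n. \<psi> (trace g))"
    by (rule locally_const_on_compose[OF psi_locally_const[OF \<psi>]]) simp
  then have lc: "locally_const_on GL (\<lambda>g. \<psi> (trace g) * \<eta> g)"
    by (rule locally_const_on_binop[OF _ right_invariant_locally_const[OF \<eta>]])
  have "A \<inter> det_shell j \<subseteq> GL" using det_shell_subset_GL by blast
  from schwartz_bruhat_restrict[OF compact_Int_closed[OF A(1) closed_det_shell] open_Int[OF A(2) open_det_shell] this lc]
  show ?thesis unfolding phase_cut_def .
qed

lemma phase_cut_support: "phase_cut \<psi> \<eta> j A g \<noteq> 0 \<Longrightarrow> g \<in> det_shell j"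
  by (simp add: phase_cut_def split: if_splits)

lemma phase_cut_fibre:
  assumes "det_fibre_measures \<mu> D" "x \<in> shell j" "g \<in> space (D x)"
  shows "phase_cut \<psi> \<eta> j A g = indicator A g * (\<psi> (trace g) * \<eta> g)"
  using assms mem_shell_nonzero[OF assms(2)]
  by (simp add: det_fibre_space phase_cut_def det_shell_def indicator_def)

lemma phase_fibre_integrable:
  fixes D :: "'f \<Rightarrow> ('f::nonarch_local_field^'n^'n::finite) measure"
  assumes \<psi>: "additive_character \<psi>" "conductor_integers \<psi>" and \<mu>: "haar_measure \<mu>"
    and D: "det_fibre_measures \<mu> D" and \<eta>: "right_invariant l \<eta>"
    and A: "compact A" "open A" and x: "x \<noteq> 0"
  shows "integrable (D x) (\<lambda>g. indicator A g * (\<psi> (trace g) * \<eta> g))"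
proof -
  obtain j where j: "x \<in> shell j" using mem_some_shell[OF x] .
  have "integrable (D x) (phase_cut \<psi> \<eta> j A)"
    using det_fibre_integral(2)[OF \<mu> D phase_cut_schwartz_bruhat[OF \<psi> \<eta> A] phase_cut_support x] .
  then show ?thesis
    by (subst Bochner_Integration.integrable_cong[OF refl phase_cut_fibre[OF D j, symmetric]])
qed

text \<open>The analogue on a fibre of the vanishing under translations, for right multiplication by the special
  linear group.\<close>
lemma det_fibre_eigen_zero:
  fixes u :: "'f::nonarch_local_field^'n^'n::finite \<Rightarrow> complex"
  assumes D: "det_fibre_measures \<mu> D" and x: "x \<noteq> 0" and k: "det k = 1"
    and u: "u \<in> borel_measurable (D x)" "\<And>g. det g = x \<Longrightarrow> u (g ** k) = c * u g" and c: "c \<noteq> 1"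
  shows "(LINT g|D x. u g) = 0"
proof -
  have "(LINT g|D x. u g) = (LINT g|distr (D x) (D x) (\<lambda>g. g ** k). u g)"
    by (simp add: det_fibre_inv(2)[OF D x k])
  also have "\<dots> = (LINT g|D x. u (g ** k))"
    by (rule integral_distr[OF det_fibre_mult_measurable(2)[OF D x k] u(1)])
  also have "\<dots> = (LINT g|D x. c * u g)"
    by (rule Bochner_Integration.integral_cong) (simp_all add: det_fibre_space[OF D x] u(2))
  finally show ?thesis using c by simp
qed

abbreviation lattice_coset :: "nat \<Rightarrow> 'f::nonarch_local_field^'n^'n::finite \<Rightarrow> ('f^'n^'n) set" where
  "lattice_coset m g \<equiv> {h. h - g \<in> matrix_lattice (- int m)}"

lemma compact_lattice_coset: "compact (lattice_coset m (g :: 'f::nonarch_local_field^'n^'n::finite))"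
proof -
  obtain l :: nat where l: "g \<in> matrix_lattice (- int l)" by (rule mem_some_matrix_lattice)
  have "lattice_coset m g \<subseteq> matrix_lattice (- int (max l m))"
  proof
    fix h assume "h \<in> lattice_coset m g"
    then have "h - g \<in> matrix_lattice (- int (max l m))" by (auto elim!: matrix_lattice_antimono[rotated])
    moreover have "g \<in> matrix_lattice (- int (max l m))" using l by (auto elim!: matrix_lattice_antimono[rotated])
    ultimately show "h \<in> matrix_lattice (- int (max l m))" using matrix_lattice_add by fastforce
  qed
  then have "lattice_coset m g = matrix_lattice (- int (max l m)) \<inter> lattice_coset m g" by blast
  then show ?thesis using compact_Int_closed[OF compact_matrix_lattice closed_matrix_coset] by metis
qed

text \<open>On a coset of \<open>M\<^sub>n(\<pp>\<^sup>-\<^sup>m)\<close> inside \<open>M\<^sub>n(\<pp>\<^sup>-\<^sup>2\<^sup>m)\<close>, right multiplication by \<open>1 + X\<close> with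
  \<open>X \<in> M\<^sub>n(\<pp>\<^sup>m)\<close> acts on \<open>\<psi>(tr g)\<close> by a constant, since the variation of \<open>tr(g X)\<close> over the coset is
  integral.\<close>
lemma phase_fibre_coset_zero:
  fixes D :: "'f \<Rightarrow> ('f::nonarch_local_field^'n^'n::finite) measure"
  assumes \<psi>: "additive_character \<psi>" "conductor_integers \<psi>" and \<mu>: "haar_measure \<mu>"
    and D: "det_fibre_measures \<mu> D" and \<eta>: "right_invariant m \<eta>"
    and r: "r \<le> 2 * m" and g0: "g0 \<in> matrix_lattice (- int r)"
    and X: "X \<in> matrix_lattice (int m)" "X ** X = 0" "det (mat 1 + X) = 1" "\<psi> (trace (g0 ** X)) \<noteq> 1"
    and x: "x \<noteq> 0"
  shows "(LINT g|D x. indicator (lattice_coset m g0) g * (\<psi> (trace g) * \<eta> g)) = 0"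
proof (rule det_fibre_eigen_zero[OF D x X(3) _ _ X(4)])
  let ?C = "lattice_coset m g0"
  show "(\<lambda>g. indicator ?C g * (\<psi> (trace g) * \<eta> g)) \<in> borel_measurable (D x)"
    by (rule borel_measurable_integrable[OF phase_fibre_integrable[OF \<psi> \<mu> D \<eta> compact_lattice_coset open_matrix_coset x]])
  fix g :: "'f^'n^'n" assume "det g = x"
  then have gGL: "g \<in> GL" using x by (simp add: GL_iff_det)
  have gk: "g ** (mat 1 + X) = g + g ** X" by (simp add: matrix_add_ldistrib)
  have C: "g + g ** X \<in> ?C" if "g \<in> ?C" "X \<in> matrix_lattice (int m)" for g X
  proof -
    have "g - g0 \<in> matrix_lattice (- int (2 * m))" using that by (auto elim!: matrix_lattice_antimono[rotated])
    moreover have "g0 \<in> matrix_lattice (- int (2 * m))" using g0 r by (auto elim!: matrix_lattice_antimono[rotated])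
    ultimately have "g \<in> matrix_lattice (- int (2 * m))" using matrix_lattice_add by fastforce
    from matrix_lattice_mult[OF this that(2)] have "g ** X \<in> matrix_lattice (- int m)" by simp
    then have "g - g0 + g ** X \<in> matrix_lattice (- int m)" using that(1) by (intro matrix_lattice_add) auto
    then show ?thesis by (simp add: algebra_simps)
  qed
  \<comment> \<open>since \<open>X\<^sup>2 = 0\<close>, the inverse of \<open>1 + X\<close> is \<open>1 - X\<close>, which has the same form\<close>
  have "g \<in> ?C" if "g + g ** X \<in> ?C"
  proof -
    have "(g + g ** X) + (g + g ** X) ** (- X) = g + g ** X - (g ** X + g ** (X ** X))"
      by (simp add: matrix_mult_minus_left matrix_mult_add_right matrix_mul_assoc)
    then have e: "(g + g ** X) + (g + g ** X) ** (- X) = g" by (simp add: X(2))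
    show ?thesis using C[OF that matrix_lattice_uminus[OF X(1)]] unfolding e .
  qed
  then have iff: "g ** (mat 1 + X) \<in> ?C \<longleftrightarrow> g \<in> ?C" using C[OF _ X(1)] gk by metis
  have "\<psi> (trace (g ** (mat 1 + X))) = \<psi> (trace (g0 ** X)) * \<psi> (trace g)" if "g \<in> ?C"
  proof -
    have "(g - g0) ** X \<in> matrix_lattice 0" using matrix_lattice_mult[of "g - g0" "- int m" X "int m"] that X(1) by simp
    then have "\<psi> (trace ((g - g0) ** X)) = 1"
      by (intro conductor_integers_trivial[OF \<psi>(2)] trace_in_prime_power)
    moreover have "trace (g ** (mat 1 + X)) = trace g + (trace (g0 ** X) + trace ((g - g0) ** X))"
      by (simp add: gk trace_add matrix_mult_diff_right trace_sub)
    ultimately show ?thesis by (simp add: additive_character_add[OF \<psi>(1)])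
  qed
  moreover have "\<eta> (g ** (mat 1 + X)) = \<eta> g"
    using \<eta> gGL X(1) by (simp add: right_invariant_def K_sub_iff)
  ultimately show "indicator ?C (g ** (mat 1 + X)) * (\<psi> (trace (g ** (mat 1 + X))) * \<eta> (g ** (mat 1 + X)))
    = \<psi> (trace (g0 ** X)) * (indicator ?C g * (\<psi> (trace g) * \<eta> g))"
    using iff by (simp add: indicator_def)
qed

text \<open>The stationary cosets are those of scalar matrices: transvections force the off-diagonal entries
  of \<open>g\<^sub>0\<close> into \<open>\<pp>\<^sup>-\<^sup>m\<close>, and their conjugates force the diagonal entries to agree modulo \<open>\<pp>\<^sup>-\<^sup>m\<close>.\<close>
lemma stationary_coset_scalar:
  fixes g0 :: "'f::nonarch_local_field^'n^'n::finite"
  assumes "conductor_integers \<psi>"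
    and stat: "\<And>X. X \<in> matrix_lattice (int m) \<Longrightarrow> X ** X = 0 \<Longrightarrow> det (mat 1 + X) = 1 \<Longrightarrow> \<psi> (trace (g0 ** X)) = 1"
  obtains a where "g0 - mat a \<in> matrix_lattice (- int m)"
proof -
  have off: "g0 $ j $ i \<in> prime_power (- int m)" if "i \<noteq> j" for i j
  proof (rule ccontr)
    assume "g0 $ j $ i \<notin> prime_power (- int m)"
    then obtain t where "t \<in> prime_power (int m)" "\<psi> (g0 $ j $ i * t) \<noteq> 1"
      using conductor_integers_detect[OF assms(1)] by metis
    then show False
      using stat[OF elem_in_matrix_lattice elem_square[OF that] det_transvection[OF that]] by (simp add: trace_mult_elem)
  qed
  have diag: "g0 $ j $ j - g0 $ i $ i \<in> prime_power (- int m)" if "i \<noteq> j" for i j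
  proof -
    let ?y = "g0 $ j $ i + g0 $ j $ j - g0 $ i $ i - g0 $ i $ j"
    have "?y \<in> prime_power (- int m)"
    proof (rule ccontr)
      assume "?y \<notin> prime_power (- int m)"
      then obtain t where "t \<in> prime_power (int m)" "\<psi> (?y * t) \<noteq> 1"
        using conductor_integers_detect[OF assms(1)] by metis
      then show False
        using stat[OF skew_elem_in_matrix_lattice skew_elem_square[OF that] det_skew_elem[OF that]]
        by (simp add: trace_mult_skew_elem)
    qed
    from prime_power_diff[OF prime_power_add[OF this off[OF that[symmetric]]] off[OF that]]
    show ?thesis by (simp add: algebra_simps)
  qed
  let ?i = "undefined :: 'n"
  have "g0 - mat (g0 $ ?i $ ?i) \<in> matrix_lattice (- int m)"
    unfolding matrix_lattice_def
  proof (intro CollectI allI)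
    fix i j
    show "(g0 - mat (g0 $ ?i $ ?i)) $ i $ j \<in> prime_power (- int m)"
      using off[of j i] diag[of ?i i] by (cases "i = j"; cases "i = ?i") (auto simp: mat_def)
  qed
  then show ?thesis by (rule that)
qed

lemma det_mat: "det (mat a :: 'f::nonarch_local_field^'n^'n::finite) = a ^ CARD('n)"
  by (subst det_diagonal) (auto simp: mat_def)

lemma mat_mult_component: "(mat a ** h) $ i $ j = a * (h :: 'f::nonarch_local_field^'n^'n::finite) $ i $ j"
proof -
  have "(mat a ** h) $ i $ j = (\<Sum>k\<in>UNIV. if k = i then a * h $ i $ j else 0)"
    unfolding matrix_matrix_mult_def mat_def vec_lambda_beta by (intro sum.cong) auto
  then show ?thesis by simp
qed

text \<open>\<open>a + M\<^sub>n(\<pp>\<^sup>-\<^sup>m) = a (1 + M\<^sub>n(\<pp>\<^sup>r\<^sup>-\<^sup>m))\<close> when \<open>|a| = q\<^sup>r\<close>.\<close>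
lemma scalar_coset_eq_K_coset:
  fixes a :: "'f::nonarch_local_field"
  assumes a: "nabs a = resq TYPE('f) powi (int r)" and m: "m \<le> r"
  shows "lattice_coset m (mat a :: 'f^'n^'n::finite) = K_coset (r - m) (mat a)"
proof -
  have a0: "a \<noteq> 0" using a resq_powi_pos[where 'f='f, of "int r"] by auto
  have "matrix_inv (mat a :: 'f^'n^'n) = mat (inverse a)"
    using a0 by (intro GL_inv_unique) (auto simp: GL_iff_det det_mat vec_eq_iff mat_mult_component, auto simp: mat_def)
  moreover have "h $ i $ j - mat a $ i $ j \<in> prime_power (- int m)
      \<longleftrightarrow> inverse a * h $ i $ j - mat 1 $ i $ j \<in> prime_power (int (r - m))" for h :: "'f^'n^'n" and i j
  proof -
    have "a * (inverse a * h $ i $ j - mat 1 $ i $ j) = h $ i $ j - mat a $ i $ j"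
      using a0 by (simp add: mat_def right_diff_distrib)
    moreover have "- int r + int (r - m) = - int m" using m by simp
    ultimately show ?thesis
      using prime_power_unit_scale[of a "- int r" "inverse a * h $ i $ j - mat 1 $ i $ j" "int (r - m)"] a by simp
  qed
  ultimately show ?thesis by (simp add: K_coset_def K_sub_def matrix_lattice_def mat_mult_component)
qed

text \<open>The matrices whose largest entry has absolute value exactly \<open>q\<^sup>r\<close>.\<close>
definition annulus :: "nat \<Rightarrow> ('f::nonarch_local_field^'n^'n::finite) set" where
  "annulus r = matrix_lattice (- int r) - matrix_lattice (1 - int r)"

lemma annulus_coset_subset:
  assumes "g \<in> annulus r" "m < r"
  shows "lattice_coset m g \<subseteq> annulus r"
proof
  fix h assume h: "h \<in> lattice_coset m g"
  then have d: "h - g \<in> matrix_lattice (- int r)" "h - g \<in> matrix_lattice (1 - int r)"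
    using assms(2) by (auto elim!: matrix_lattice_antimono[rotated])
  have "h = g + (h - g)" "g = h - (h - g)" by simp_all
  then show "h \<in> annulus r"
    using assms(1) matrix_lattice_add[OF _ d(1), of g] matrix_lattice_diff[OF _ d(2), of h]
    by (auto simp: annulus_def)
qed

lemma scalar_in_annulus:
  fixes a :: "'f::nonarch_local_field"
  assumes "g \<in> (annulus r :: ('f^'n^'n::finite) set)" "m < r" "g - mat a \<in> matrix_lattice (- int m)"
  shows "nabs a = resq TYPE('f) powi (int r)"
proof -
  have "mat a \<in> lattice_coset m g" using assms(3) by (simp add: matrix_lattice_diff_commute)
  then have a: "(mat a :: 'f^'n^'n) \<in> annulus r" using annulus_coset_subset[OF assms(1,2)] by blast
  have "(mat a :: 'f^'n^'n) \<in> matrix_lattice k \<longleftrightarrow> a \<in> prime_power k" for k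
    by (auto simp: matrix_lattice_def mat_def)
  then have "a \<in> prime_power (- int r)" "a \<notin> prime_power (1 - int r)" using a by (auto simp: annulus_def)
  then show ?thesis using not_mem_prime_power[of a "1 - int r"] by (simp add: prime_power_def)
qed

text \<open>Since \<open>m < r\<close>, a coset that meets the annulus lies inside it; compactness makes their number finite.\<close>
lemma annulus_cosets:
  fixes r :: nat
  assumes "m < r"
  defines "\<C> \<equiv> lattice_coset m ` (annulus r :: ('f::nonarch_local_field^'n^'n::finite) set)"
  shows "finite \<C>" "disjoint_family_on (\<lambda>C. C) \<C>" "\<Union>\<C> = annulus r"
proof -
  have "finite (lattice_coset m ` (matrix_lattice (- int r) :: ('f^'n^'n) set))"
    by (rule finite_matrix_cosets[OF compact_matrix_lattice])
  then show "finite \<C>" unfolding \<C>_def by (rule finite_subset[rotated]) (auto simp: annulus_def)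
  have "lattice_coset m g = lattice_coset m h" if "x \<in> lattice_coset m g" "x \<in> lattice_coset m h"
    for g h x :: "'f^'n^'n"
    using matrix_coset_eq[of x g "- int m"] matrix_coset_eq[of x h "- int m"] that by simp
  then show "disjoint_family_on (\<lambda>C. C) \<C>" unfolding disjoint_family_on_def \<C>_def by blast
  have "g \<in> lattice_coset m g" for g :: "'f^'n^'n" by simp
  then show "\<Union>\<C> = annulus r" unfolding \<C>_def using annulus_coset_subset[OF _ assms(1)] by blast
qed

lemma annulus_indicator:
  fixes r :: nat and g :: "'f::nonarch_local_field^'n^'n::finite"
  assumes "m < r"
  shows "(indicator (annulus r) g :: complex) = (\<Sum>C\<in>lattice_coset m ` annulus r. indicator C g)"
proof -
  let ?S = "lattice_coset m ` (annulus r :: ('f^'n^'n) set)"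
  have "(indicator (\<Union>C\<in>?S. C) g :: complex) = (\<Sum>C\<in>?S. indicator C g)"
    by (rule indicator_UN_disjoint[OF annulus_cosets(1,2)[OF assms]])
  then show ?thesis using annulus_cosets(3)[OF assms, where 'f='f and 'n='n] by simp
qed

text \<open>Either some \<open>1 + X\<close> multiplies the phase on the coset by a constant other than \<open>1\<close>, which kills all
  fibre integrals at once, or the coset is stationary.\<close>
lemma annulus_coset_zero_or_scalar:
  fixes D :: "'f \<Rightarrow> ('f::nonarch_local_field^'n^'n::finite) measure"
  assumes \<psi>: "additive_character \<psi>" "conductor_integers \<psi>" and \<mu>: "haar_measure \<mu>"
    and D: "det_fibre_measures \<mu> D" and \<eta>: "right_invariant m \<eta>"
    and m: "r \<le> 2 * m" "m < r" and g0: "g0 \<in> annulus r"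
  obtains "\<And>x. x \<noteq> 0 \<Longrightarrow> (LINT g|D x. indicator (lattice_coset m g0) g * (\<psi> (trace g) * \<eta> g)) = 0"
  | a where "nabs a = resq TYPE('f) powi (int r)" "lattice_coset m g0 = lattice_coset m (mat a)"
proof (cases "\<exists>X. X \<in> matrix_lattice (int m) \<and> X ** X = 0 \<and> det (mat 1 + X) = 1 \<and> \<psi> (trace (g0 ** X)) \<noteq> 1")
  case True
  then obtain X where X: "X \<in> matrix_lattice (int m)" "X ** X = 0" "det (mat 1 + X) = 1" "\<psi> (trace (g0 ** X)) \<noteq> 1"
    by blast
  have "g0 \<in> matrix_lattice (- int r)" using g0 by (simp add: annulus_def)
  then show ?thesis using phase_fibre_coset_zero[OF \<psi> \<mu> D \<eta> m(1) _ X] that(1) by blast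
next
  case False
  then obtain a where a: "g0 - mat a \<in> matrix_lattice (- int m)"
    using stationary_coset_scalar[OF \<psi>(2), of m g0] by metis
  show ?thesis by (rule that(2)[OF scalar_in_annulus[OF g0 m(2) a] matrix_coset_eq[OF a]])
qed

text \<open>The excluded value \<open>q\<^sup>n\<^sup>r\<close> is the absolute value of the determinant on scalar cosets, which therefore
  miss the fibre.\<close>
lemma phase_fibre_annulus_zero:
  fixes D :: "'f \<Rightarrow> ('f::nonarch_local_field^'n^'n::finite) measure"
  assumes \<psi>: "additive_character \<psi>" "conductor_integers \<psi>" and \<mu>: "haar_measure \<mu>"
    and D: "det_fibre_measures \<mu> D" and \<eta>: "right_invariant l \<eta>" and l: "1 \<le> l" "2 * l \<le> r"
    and x: "x \<noteq> 0" "nabs x \<noteq> (resq TYPE('f) powi (int r)) ^ CARD('n)"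
  shows "(LINT g|D x. indicator (annulus r) g * (\<psi> (trace g) * \<eta> g)) = 0"
proof -
  \<comment> \<open>\<open>\<lceil>r/2\<rceil>\<close> is the least scale at which the cosets in the annulus are stable under \<open>1 + M\<^sub>n(\<pp>\<^sup>m)\<close>\<close>
  define m where "m = (r + 1) div 2"
  have m: "l \<le> m" "r \<le> 2 * m" "m < r" using l by (auto simp: m_def)
  have \<eta>m: "right_invariant m \<eta>" using right_invariant_antimono[OF \<eta> m(1)] .
  let ?S = "lattice_coset m ` (annulus r :: ('f^'n^'n) set)" and ?F = "\<lambda>g. \<psi> (trace g) * \<eta> g"
  have "(LINT g|D x. indicator (annulus r) g * ?F g) = (LINT g|D x. (\<Sum>C\<in>?S. indicator C g * ?F g))"
    by (simp only: annulus_indicator[OF m(3)] sum_distrib_right)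
  also have "\<dots> = (\<Sum>C\<in>?S. (LINT g|D x. indicator C g * ?F g))"
    by (rule Bochner_Integration.integral_sum)
      (auto intro!: phase_fibre_integrable[OF \<psi> \<mu> D \<eta> _ _ x(1)] compact_lattice_coset open_matrix_coset)
  also have "\<dots> = 0"
  proof (rule sum.neutral, rule ballI)
    fix C assume "C \<in> ?S"
    then obtain g0 where g0: "g0 \<in> annulus r" "C = lattice_coset m g0" by blast
    show "(LINT g|D x. indicator C g * ?F g) = 0"
    proof (rule annulus_coset_zero_or_scalar[OF \<psi> \<mu> D \<eta>m m(2,3) g0(1)])
      assume "\<And>x. x \<noteq> 0 \<Longrightarrow> (LINT g|D x. indicator (lattice_coset m g0) g * ?F g) = 0"
      then show ?thesis using x(1) by (simp add: g0(2))
    next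
      fix a assume na: "nabs a = resq TYPE('f) powi (int r)" and "lattice_coset m g0 = lattice_coset m (mat a)"
      then have C: "C = K_coset (r - m) (mat a)"
        using scalar_coset_eq_K_coset[OF na less_imp_le[OF m(3)]] by (simp add: g0(2))
      have aGL: "(mat a :: 'f^'n^'n) \<in> GL"
        using na resq_powi_pos[where 'f='f, of "int r"] by (auto simp: GL_iff_det det_mat)
      have "nabs (det g) = (resq TYPE('f) powi (int r)) ^ CARD('n)" if "g \<in> C" for g
        using K_coset_nabs_det(1)[OF aGL that[unfolded C]] m by (simp add: det_mat nabs_power na)
      then have "indicator C g * ?F g = 0" if "g \<in> space (D x)" for g
        using that x by (auto simp: det_fibre_space[OF D x(1)] indicator_def)
      then show ?thesis by (subst Bochner_Integration.integral_cong[OF refl, of _ _ "\<lambda>_. 0"]) auto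
    qed
  qed
  finally show ?thesis .
qed

text \<open>The coset is \<open>a K\<^sub>r\<^sub>-\<^sub>m\<close>, on which only the phase \<open>\<psi>(tr g)\<close> varies. Its fibres over individual
  determinants are not stable under additive translation, so the cancellation is only in the total.\<close>
lemma phase_scalar_coset_zero:
  fixes a :: "'f::nonarch_local_field" and \<eta> :: "'f^'n^'n::finite \<Rightarrow> complex"
  assumes \<psi>: "additive_character \<psi>" "conductor_integers \<psi>" and \<mu>: "haar_measure \<mu>"
    and \<eta>: "right_invariant l \<eta>" and l: "1 \<le> l" "1 \<le> m" "l + m \<le> r"
    and a: "nabs a = resq TYPE('f) powi (int r)"
  shows "(LINT g|gl_measure \<mu>. phase_cut \<psi> \<eta> j (lattice_coset m (mat a)) g) = 0"
proof -
  let ?C = "lattice_coset m (mat a :: 'f^'n^'n)" and ?u = "phase_cut \<psi> \<eta> j (lattice_coset m (mat a :: 'f^'n^'n))"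
  have aGL: "(mat a :: 'f^'n^'n) \<in> GL"
    using a resq_powi_pos[where 'f='f, of "int r"] by (auto simp: GL_iff_det det_mat)
  have C: "?C = K_coset (r - m) (mat a)" by (rule scalar_coset_eq_K_coset[OF a]) (use l in simp)
  have lrm: "1 \<le> r - m" "l \<le> r - m" using l by auto
  have dC: "nabs (det g) = nabs (det (mat a :: 'f^'n^'n))" "g \<in> GL" if "g \<in> ?C" for g
    using K_coset_nabs_det[OF aGL _ lrm(1)] that unfolding C by blast+
  have eC: "\<eta> g = \<eta> (mat a)" if g: "g \<in> ?C" for g
  proof -
    obtain k where "k \<in> K_sub (r - m)" "g = mat a ** k" using K_cosetE[OF _ aGL] g unfolding C by metis
    then show ?thesis using right_invariant_antimono[OF \<eta> lrm(2)] aGL by (simp add: right_invariant_def)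
  qed
  have meas: "?u \<in> borel_measurable borel"
    by (intro schwartz_bruhat_measurable phase_cut_schwartz_bruhat[OF \<psi> \<eta>] compact_lattice_coset open_matrix_coset)
  have supp: "g \<in> ?C" if "?u g \<noteq> 0" for g using that by (simp add: phase_cut_def split: if_splits)
  \<comment> \<open>\<open>1 \<le> m\<close> leaves room for a translation with trace in \<open>\<pp>\<^sup>-\<^sup>1\<close>, where \<open>\<psi>\<close> is nontrivial\<close>
  obtain y where y: "y \<in> prime_power (- 1)" "\<psi> y \<noteq> 1" using \<psi>(2) by (auto simp: conductor_integers_def)
  let ?X = "elem undefined undefined y :: 'f^'n^'n"
  have X: "?X \<in> matrix_lattice (- int m)"
    by (rule matrix_lattice_antimono[OF _ elem_in_matrix_lattice[OF y(1)]]) (use l in simp)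
  have iff: "g + ?X \<in> ?C \<longleftrightarrow> g \<in> ?C" for g
    using matrix_lattice_add[OF _ X, of "g - mat a"] matrix_lattice_diff[OF _ X, of "g + ?X - mat a"]
    by (auto simp: algebra_simps)
  have tX: "trace ?X = y"
    using trace_mult_elem[of "mat 1 :: 'f^'n^'n" undefined undefined y] unfolding matrix_mul_lid by (simp add: mat_def)
  have "?u (g + ?X) = \<psi> y * ?u g" for g
  proof (cases "g \<in> ?C")
    case True
    have "nabs (det (g + ?X)) = nabs (det g)" using dC True iff by metis
    then have "g + ?X \<in> det_shell j \<longleftrightarrow> g \<in> det_shell j" by (simp add: det_shell_def shell_eq_nabs)
    moreover have "\<eta> (g + ?X) = \<eta> g" using eC True iff by metis
    ultimately show ?thesis using True iff[of g]
      by (simp add: phase_cut_def trace_add tX additive_character_add[OF \<psi>(1)])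
  next
    case False
    then have "?u g = 0" "?u (g + ?X) = 0" using supp iff by blast+
    then show ?thesis by simp
  qed
  then have "(LINT g|matrix_measure \<mu>. ?u g) = 0"
    by (intro matrix_integral_eigen_zero[OF \<mu> meas _ y(2)])
  moreover have "(LINT g|gl_measure \<mu>. ?u g)
    = of_real (nabs (det (mat a :: 'f^'n^'n)) powi (- int CARD('n))) * (LINT g|matrix_measure \<mu>. ?u g)"
    using dC supp by (intro integral_gl_const_det[OF meas]) blast
  ultimately show ?thesis by simp
qed

text \<open>Nonscalar cosets vanish fibre by fibre, scalar cosets as a whole.\<close>
lemma phase_annulus_zero:
  fixes D :: "'f \<Rightarrow> ('f::nonarch_local_field^'n^'n::finite) measure" and \<eta> :: "'f^'n^'n \<Rightarrow> complex"
  assumes \<psi>: "additive_character \<psi>" "conductor_integers \<psi>" and \<mu>: "haar_measure \<mu>"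
    and D: "det_fibre_measures \<mu> D" and \<eta>: "right_invariant l \<eta>" and l: "1 \<le> l" "2 * l \<le> r"
  shows "(LINT g|gl_measure \<mu>. phase_cut \<psi> \<eta> j (annulus r) g) = 0"
proof -
  \<comment> \<open>besides stability of the cosets, scalar cosets need \<open>r - m = \<lfloor>r/2\<rfloor> \<ge> l\<close>, that is \<open>2 l \<le> r\<close>\<close>
  define m where "m = (r + 1) div 2"
  have m: "l \<le> m" "r \<le> 2 * m" "m < r" "1 \<le> m" "l + m \<le> r" using l by (auto simp: m_def)
  have \<eta>m: "right_invariant m \<eta>" using right_invariant_antimono[OF \<eta> m(1)] .
  let ?S = "lattice_coset m ` (annulus r :: ('f^'n^'n) set)" and ?u = "phase_cut \<psi> \<eta> j"
  have u: "?u A g = indicator A g * (if g \<in> det_shell j then \<psi> (trace g) * \<eta> g else 0)" for A g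
    by (simp add: phase_cut_def indicator_def)
  have sb: "schwartz_bruhat (?u C)" if "C \<in> ?S" for C
    using that by (auto intro!: phase_cut_schwartz_bruhat[OF \<psi> \<eta>] compact_lattice_coset open_matrix_coset)
  have "(LINT g|gl_measure \<mu>. ?u (annulus r) g) = (LINT g|gl_measure \<mu>. (\<Sum>C\<in>?S. ?u C g))"
    by (simp only: u annulus_indicator[OF m(3)] sum_distrib_right)
  also have "\<dots> = (\<Sum>C\<in>?S. (LINT g|gl_measure \<mu>. ?u C g))"
    using det_fibre_integral(1)[OF \<mu> D sb phase_cut_support] by (intro Bochner_Integration.integral_sum)
  also have "\<dots> = 0"
  proof (rule sum.neutral, rule ballI)
    fix C assume CS: "C \<in> ?S"
    then obtain g0 where g0: "g0 \<in> annulus r" "C = lattice_coset m g0" by blast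
    show "(LINT g|gl_measure \<mu>. ?u C g) = 0"
    proof (rule annulus_coset_zero_or_scalar[OF \<psi> \<mu> D \<eta>m m(2,3) g0(1)])
      assume zero: "\<And>x. x \<noteq> 0 \<Longrightarrow> (LINT g|D x. indicator (lattice_coset m g0) g * (\<psi> (trace g) * \<eta> g)) = 0"
      have "(LINT g|D x. ?u C g) = 0" if x: "x \<noteq> 0" for x
      proof (cases "x \<in> shell j")
        case True
        have "(LINT g|D x. ?u C g) = (LINT g|D x. indicator C g * (\<psi> (trace g) * \<eta> g))"
          by (rule Bochner_Integration.integral_cong[OF refl phase_cut_fibre[OF D True]])
        then show ?thesis using zero[OF x] by (simp add: g0(2))
      next
        case False
        then have "?u C g = 0" if "g \<in> space (D x)" for g
          using that by (simp add: phase_cut_def det_shell_def det_fibre_space[OF D x])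
        then show ?thesis by (subst Bochner_Integration.integral_cong[OF refl, of _ _ "\<lambda>_. 0"]) auto
      qed
      then have "(LINT x|mult_measure \<mu>. (LINT g|D x. ?u C g)) = 0"
        by (subst Bochner_Integration.integral_cong[OF refl, of _ _ "\<lambda>_. 0"]) auto
      then show ?thesis using det_fibre_integral(3)[OF \<mu> D sb[OF CS] phase_cut_support] by simp
    next
      fix a assume na: "nabs a = resq TYPE('f) powi (int r)" and "lattice_coset m g0 = lattice_coset m (mat a)"
      then show ?thesis using phase_scalar_coset_zero[OF \<psi> \<mu> \<eta> l(1) m(4,5) na] by (simp add: g0(2))
    qed
  qed
  finally show ?thesis .
qed

lemma lattice_split_annulus:
  "matrix_lattice (- int (Suc r)) = matrix_lattice (- int r) \<union> annulus (Suc r)"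
  "matrix_lattice (- int r) \<inter> annulus (Suc r) = {}"
  by (auto simp: annulus_def elim!: matrix_lattice_antimono[rotated])

lemma open_matrix_lattice: "open (matrix_lattice k :: ('f::nonarch_local_field^'n^'n::finite) set)"
  using open_matrix_coset[of "0 :: 'f^'n^'n" k] by simp

lemma open_annulus: "open (annulus r :: ('f::nonarch_local_field^'n^'n::finite) set)"
  using open_matrix_coset[of "0 :: 'f^'n^'n" "- int r"] closed_matrix_coset[of "0 :: 'f^'n^'n" "1 - int r"]
  by (simp add: annulus_def open_Diff)

lemma compact_annulus: "compact (annulus r :: ('f::nonarch_local_field^'n^'n::finite) set)"
  unfolding annulus_def by (intro compact_diff compact_matrix_lattice open_matrix_lattice)

text \<open>Raising the truncation from \<open>r\<close> to \<open>r + 1\<close> adds an annulus, which contributes to the fibre over \<open>x\<close>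
  only if \<open>|x| = q\<^sup>n\<^sup>(\<^sup>r\<^sup>+\<^sup>1\<^sup>)\<close>; this is why the level at which the fibre integral becomes constant depends on
  the shell of \<open>x\<close>. Over an entire determinant shell annuli never contribute, so there the level \<open>2 l\<close> serves
  all shells, and this uniformity is what replaces an interchange of limit and integral.\<close>
lemma phase_fibre_stable:
  fixes D :: "'f \<Rightarrow> ('f::nonarch_local_field^'n^'n::finite) measure"
  assumes \<psi>: "additive_character \<psi>" "conductor_integers \<psi>" and \<mu>: "haar_measure \<mu>"
    and D: "det_fibre_measures \<mu> D" and \<eta>: "right_invariant l \<eta>" and l: "1 \<le> l"
    and x: "x \<in> shell j" and L: "2 * l \<le> L" "- j \<le> int L" and r: "L \<le> r"
  shows "(LINT g|D x. indicator (matrix_lattice (- int r)) g * (\<psi> (trace g) * \<eta> g))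
    = (LINT g|D x. indicator (matrix_lattice (- int L)) g * (\<psi> (trace g) * \<eta> g))"
  using r
proof (induction r rule: dec_induct)
  case (step r)
  let ?F = "\<lambda>g. \<psi> (trace g) * \<eta> g"
  have x0: "x \<noteq> 0" using x by (rule mem_shell_nonzero)
  have "int (Suc r) \<le> int (Suc r) * int CARD('n)" by simp
  then have "- j < int (Suc r) * int CARD('n)" using L step by linarith
  then have ne: "nabs x \<noteq> (resq TYPE('f) powi (int (Suc r))) ^ CARD('n)"
    using nabs_shell[OF x] resq_powi_inject[where 'f='f, of "-j" "int (Suc r) * int CARD('n)"]
    by (simp only: power_int_mult power_int_of_nat)
  have z: "(LINT g|D x. indicator (annulus (Suc r)) g * ?F g) = 0"
    using L step by (intro phase_fibre_annulus_zero[OF \<psi> \<mu> D \<eta> l _ x0 ne]) simp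
  have "(LINT g|D x. indicator (matrix_lattice (- int (Suc r))) g * ?F g)
    = (LINT g|D x. indicator (matrix_lattice (- int r)) g * ?F g + indicator (annulus (Suc r)) g * ?F g)"
    unfolding lattice_split_annulus(1)
    by (rule Bochner_Integration.integral_cong[OF refl]) (use lattice_split_annulus(2)[of r] in \<open>auto simp: indicator_def\<close>)
  also have "\<dots> = (LINT g|D x. indicator (matrix_lattice (- int r)) g * ?F g)"
    by (subst Bochner_Integration.integral_add)
      (simp_all add: z phase_fibre_integrable[OF \<psi> \<mu> D \<eta> _ _ x0] compact_matrix_lattice
        open_matrix_lattice compact_annulus open_annulus)
  finally show ?case using step by simp
qed simp

lemma phase_shell_stable:
  fixes D :: "'f \<Rightarrow> ('f::nonarch_local_field^'n^'n::finite) measure" and \<eta> :: "'f^'n^'n \<Rightarrow> complex"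
  assumes \<psi>: "additive_character \<psi>" "conductor_integers \<psi>" and \<mu>: "haar_measure \<mu>"
    and D: "det_fibre_measures \<mu> D" and \<eta>: "right_invariant l \<eta>" and l: "1 \<le> l"
    and L: "2 * l \<le> L" and r: "L \<le> r"
  shows "(LINT g|gl_measure \<mu>. phase_cut \<psi> \<eta> j (matrix_lattice (- int r)) g)
    = (LINT g|gl_measure \<mu>. phase_cut \<psi> \<eta> j (matrix_lattice (- int L)) g)"
  using r
proof (induction r rule: dec_induct)
  case (step r)
  let ?u = "phase_cut \<psi> \<eta> j"
  have z: "(LINT g|gl_measure \<mu>. ?u (annulus (Suc r)) g) = 0"
    using L step by (intro phase_annulus_zero[OF \<psi> \<mu> D \<eta> l]) simp
  have i: "integrable (gl_measure \<mu>) (?u A)" if "compact A" "open A" for A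
    by (rule det_fibre_integral(1)[OF \<mu> D phase_cut_schwartz_bruhat[OF \<psi> \<eta> that] phase_cut_support])
  have "?u (matrix_lattice (- int (Suc r))) g = ?u (matrix_lattice (- int r)) g + ?u (annulus (Suc r)) g" for g
    using lattice_split_annulus(2)[of r] unfolding lattice_split_annulus(1) phase_cut_def by auto
  then have "(LINT g|gl_measure \<mu>. ?u (matrix_lattice (- int (Suc r))) g)
    = (LINT g|gl_measure \<mu>. ?u (matrix_lattice (- int r)) g + ?u (annulus (Suc r)) g)" by simp
  also have "\<dots> = (LINT g|gl_measure \<mu>. ?u (matrix_lattice (- int r)) g)"
    by (subst Bochner_Integration.integral_add)
      (simp_all add: z i compact_matrix_lattice open_matrix_lattice compact_annulus open_annulus)
  finally show ?case using step by simp
qed simp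


section \<open>Smoothness of quasi-characters and coefficients\<close>

lemma quasi_character_mult: "quasi_character chi \<Longrightarrow> x \<noteq> 0 \<Longrightarrow> y \<noteq> 0 \<Longrightarrow> chi (x * y) = chi x * chi y"
  by (simp add: quasi_character_def)

lemma quasi_character_1:
  assumes "quasi_character (chi :: 'f::nonarch_local_field \<Rightarrow> complex)"
  shows "chi 1 = 1"
proof -
  have "chi 1 * chi 1 = chi 1" using quasi_character_mult[OF assms, of 1 1] by simp
  moreover have "chi 1 \<noteq> 0" using assms by (simp add: quasi_character_def)
  ultimately show ?thesis by simp
qed

text \<open>The group of nonzero complex numbers has no small subgroups: if all iterated squares of \<open>z\<close> stay
  within distance \<open>1/2\<close> of \<open>1\<close>, then each squaring multiplies the distance by at least \<open>3/2\<close>. Hence a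
  quasi-character is trivial on some \<open>1 + \<pp>\<^sup>l\<close>.\<close>
lemma quasi_character_trivial_near_1:
  fixes chi :: "'f::nonarch_local_field \<Rightarrow> complex"
  assumes chi: "quasi_character chi"
  obtains l where "1 \<le> l" "\<And>x. x - 1 \<in> prime_power (int l) \<Longrightarrow> chi x = 1"
proof -
  have c: "continuous_on (UNIV - {0}) chi" using chi by (simp add: quasi_character_def)
  have "open (UNIV - {0::'f})" by auto
  then have "isCont chi 1" using c continuous_on_eq_continuous_at[of "UNIV - {0}" chi] by simp
  then have "eventually (\<lambda>x. dist (chi x) (chi 1) < 1/2) (nhds 1)"
    unfolding isCont_def tendsto_at_iff_tendsto_nhds by (rule tendstoD) simp
  then obtain U where U: "open U" "1 \<in> U" "\<And>x. x \<in> U \<Longrightarrow> norm (chi x - 1) < 1/2"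
    unfolding eventually_nhds by (auto simp: quasi_character_1[OF chi] dist_norm)
  obtain k :: nat where k: "{y. y - 1 \<in> prime_power (int k)} \<subseteq> U" using coset_basis[OF U(1,2)] .
  \<comment> \<open>\<open>l \<ge> 1\<close> keeps \<open>1 + \<pp>\<^sup>l\<close> inside the units\<close>
  define l where "l = max 1 k"
  let ?V = "{x::'f. x - 1 \<in> prime_power (int l)}"
  have VU: "?V \<subseteq> U" using k prime_power_antimono[of "int k" "int l"] by (auto simp: l_def)
  have V0: "x \<noteq> 0" if "x \<in> ?V" for x
    using nabs_eq_1_if_cong_1[of x "int l"] that by (auto simp: l_def)
  have sq: "x * x \<in> ?V" if x: "x \<in> ?V" for x
  proof -
    have "x - 1 \<in> prime_power 0" using x prime_power_antimono[of 0 "int l"] by auto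
    then have "(x - 1) + (1 + 1) \<in> prime_power 0" by (intro prime_power_add one_mem_prime_power)
    then have "x + 1 \<in> prime_power 0" by (simp add: add.commute)
    then have "(x - 1) * (x + 1) \<in> prime_power (int l)" using prime_power_mult[of "x - 1" "int l" "x + 1" 0] x by simp
    then show ?thesis by (simp add: algebra_simps)
  qed
  have grow: "(3/2) ^ i * norm (chi x - 1) \<le> 1/2" if "x \<in> ?V" for x i
    using that
  proof (induction i arbitrary: x)
    case 0
    then show ?case using U(3)[of x] VU by auto
  next
    case (Suc i)
    have n: "norm (chi x - 1) < 1/2" using U(3)[of x] VU Suc.prems by auto
    have "2 = norm ((chi x + 1) - (chi x - 1))" by simp
    also have "\<dots> \<le> norm (chi x + 1) + norm (chi x - 1)" by (rule norm_triangle_ineq4)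
    finally have "3/2 \<le> norm (chi x + 1)" using n by linarith
    then have "3/2 * norm (chi x - 1) \<le> norm (chi x + 1) * norm (chi x - 1)" by (intro mult_right_mono) auto
    also have "\<dots> = norm (chi (x * x) - 1)"
      using quasi_character_mult[OF chi V0[OF Suc.prems] V0[OF Suc.prems]]
      by (simp add: norm_mult[symmetric] algebra_simps)
    finally have "(3/2) ^ i * (3/2 * norm (chi x - 1)) \<le> (3/2) ^ i * norm (chi (x * x) - 1)"
      by (intro mult_left_mono) auto
    also have "\<dots> \<le> 1/2" by (rule Suc.IH[OF sq[OF Suc.prems]])
    finally show ?case by (simp add: mult_ac)
  qed
  have "chi x = 1" if x: "x \<in> ?V" for x
  proof (rule ccontr)
    assume "chi x \<noteq> 1"
    then have p: "0 < norm (chi x - 1)" by simp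
    obtain i where "1 / norm (chi x - 1) < (3/2) ^ i" using real_arch_pow[of "3/2"] by auto
    then have "1 < (3/2) ^ i * norm (chi x - 1)" using p by (simp add: divide_less_eq)
    then show False using grow[OF x, of i] by linarith
  qed
  then show ?thesis using that[of l] by (simp add: l_def)
qed

lemma matrix_inv_mat_1: "matrix_inv (mat 1) = (mat 1 :: 'f::nonarch_local_field^'n^'n::finite)"
  by (rule GL_inv_unique) simp_all

lemma dual_action_one:
  assumes "smooth_representation smul \<pi>"
  shows "dual_action \<pi> (mat 1) \<xi> = \<xi>"
  using assms by (auto simp: dual_action_def matrix_inv_mat_1 smooth_representation_def)

lemma dual_action_mult:
  assumes "smooth_representation smul \<pi>" "g \<in> GL" "h \<in> GL"
  shows "dual_action \<pi> (g ** h) \<xi> v = dual_action \<pi> h \<xi> (\<pi> (matrix_inv g) v)"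
proof -
  have "\<pi> (matrix_inv h ** matrix_inv g) = \<pi> (matrix_inv h) \<circ> \<pi> (matrix_inv g)"
    using assms(1) GL_matrix_inv[OF assms(2)] GL_matrix_inv[OF assms(3)] by (simp add: smooth_representation_def)
  then show ?thesis using assms by (simp add: dual_action_def matrix_inv_mult)
qed

lemma dual_action_mult_fixed:
  assumes "smooth_representation smul \<pi>" "g \<in> GL" "h \<in> GL" "dual_action \<pi> h \<xi> = \<xi>"
  shows "dual_action \<pi> (g ** h) \<xi> v = dual_action \<pi> g \<xi> v"
proof -
  have "dual_action \<pi> (g ** h) \<xi> v = \<xi> (\<pi> (matrix_inv g) v)"
    by (simp only: dual_action_mult[OF assms(1-3)] assms(4))
  then show ?thesis by (simp only: dual_action_def)
qed

lemma smooth_dual_fixed_level: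
  fixes \<pi> :: "'f::nonarch_local_field^'n^'n::finite \<Rightarrow> 'v::ab_group_add \<Rightarrow> 'v"
  assumes "smooth_representation smul \<pi>" "\<And>i. i < (N::nat) \<Longrightarrow> \<xi> i \<in> smooth_dual smul \<pi>"
  shows "\<exists>l. \<forall>i<N. \<forall>k\<in>K_sub l. dual_action \<pi> k (\<xi> i) = \<xi> i"
proof -
  have "\<exists>l. K_sub l \<subseteq> {g\<in>GL. dual_action \<pi> g (\<xi> i) = \<xi> i}" if "i < N" for i
  proof -
    have "open {g\<in>GL. dual_action \<pi> g (\<xi> i) = \<xi> i}" using assms(2)[OF that] by (simp add: smooth_dual_def)
    moreover have "mat 1 \<in> {g\<in>GL. dual_action \<pi> g (\<xi> i) = \<xi> i}" using dual_action_one[OF assms(1)] by simp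
    ultimately obtain k :: nat
      where "{h. h - mat 1 \<in> matrix_lattice (int k)} \<subseteq> {g\<in>GL. dual_action \<pi> g (\<xi> i) = \<xi> i}"
      by (rule matrix_coset_basis)
    then show ?thesis by (auto simp: K_sub_iff intro!: exI[of _ k])
  qed
  then have "\<forall>i. \<exists>l. i < N \<longrightarrow> K_sub l \<subseteq> {g\<in>GL. dual_action \<pi> g (\<xi> i) = \<xi> i}" by blast
  from choice[OF this] obtain l
    where l: "\<And>i. i < N \<Longrightarrow> K_sub (l i) \<subseteq> {g\<in>GL. dual_action \<pi> g (\<xi> i) = \<xi> i}" by blast
  define m where "m = Max (insert 0 (l ` {..<N}))"
  have "l i \<le> m" if "i < N" for i unfolding m_def using that by (intro Max_ge) auto
  then have "K_sub m \<subseteq> {g\<in>GL. dual_action \<pi> g (\<xi> i) = \<xi> i}" if "i < N" for i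
    using order_trans[OF K_sub_antimono l[OF that]] that by blast
  then show ?thesis by blast
qed

text \<open>Right translation by \<open>k\<close> moves the functionals, \<open>\<langle>v, \<pi>\<^sup>\<or>(g k) \<xi>\<rangle>\<close>, and these are smooth.\<close>
lemma contragredient_coefficient_right_invariant:
  fixes \<pi> :: "'f::nonarch_local_field^'n^'n::finite \<Rightarrow> 'v::ab_group_add \<Rightarrow> 'v"
  assumes \<pi>: "smooth_representation smul \<pi>" and \<phi>: "\<phi> \<in> contragredient_coefficients smul \<pi>"
  obtains l where "right_invariant l \<phi>"
proof -
  obtain N :: nat and v \<xi> where \<xi>: "\<And>i. i < N \<Longrightarrow> \<xi> i \<in> smooth_dual smul \<pi>"
    and e: "\<And>g. g \<in> GL \<Longrightarrow> \<phi> g = (\<Sum>i<N. dual_action \<pi> g (\<xi> i) (v i))"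
    using \<phi> unfolding contragredient_coefficients_def by blast
  obtain l where "\<forall>i<N. \<forall>k\<in>K_sub l. dual_action \<pi> k (\<xi> i) = \<xi> i"
    using smooth_dual_fixed_level[OF \<pi> \<xi>] by (rule exE)
  then have l: "\<And>i k. i < N \<Longrightarrow> k \<in> K_sub l \<Longrightarrow> dual_action \<pi> k (\<xi> i) = \<xi> i" by simp
  have "right_invariant (max 1 l) \<phi>"
    unfolding right_invariant_def
  proof (intro ballI)
    fix g k :: "'f^'n^'n" assume g: "g \<in> GL" and "k \<in> K_sub (max 1 l)"
    then have k: "k \<in> K_sub l" "k \<in> GL" using K_sub_antimono[of l "max 1 l"] K_sub_subset_GL[of "max 1 l"] by auto
    have "dual_action \<pi> (g ** k) (\<xi> i) (v i) = dual_action \<pi> g (\<xi> i) (v i)" if "i < N" for i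
      by (rule dual_action_mult_fixed[OF \<pi> g k(2) l[OF that k(1)]])
    then show "\<phi> (g ** k) = \<phi> g" using g k(2) by (simp add: e GL_mult)
  qed
  then show ?thesis by (rule that)
qed

text \<open>The coefficient on which the functional equation is tested: it is \<open>1\<close> on small congruence subgroups, and
  its value at \<open>g\<^sup>-\<^sup>1\<close> is \<open>\<chi>(det g)\<^sup>-\<^sup>1 \<phi>(g)\<close>, the factor that occurs in the kernel integral.\<close>
definition twisted_coefficient :: "('f::nonarch_local_field \<Rightarrow> complex) \<Rightarrow> ('f^'n^'n::finite \<Rightarrow> complex)
    \<Rightarrow> 'f^'n^'n \<Rightarrow> complex" where
  "twisted_coefficient chi \<phi> g = chi (det g) * \<phi> (matrix_inv g)"

text \<open>The point is that smooth functionals of \<open>\<pi>\<close> stay smooth for \<open>\<pi> \<otimes> \<chi>(det)\<close>, because \<open>\<chi>(det)\<close> is trivial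
  on a congruence subgroup.\<close>
lemma twisted_coefficient_mem:
  fixes \<pi> :: "'f::nonarch_local_field^'n^'n::finite \<Rightarrow> 'v::ab_group_add \<Rightarrow> 'v"
  assumes \<pi>: "smooth_representation smul \<pi>" and chi: "quasi_character chi"
    and \<phi>: "\<phi> \<in> contragredient_coefficients smul \<pi>"
  shows "twisted_coefficient chi \<phi> \<in> matrix_coefficients smul (twist smul chi \<pi>)"
proof -
  let ?\<tau> = "twist smul chi \<pi>"
  obtain N :: nat and v \<xi> where \<xi>: "\<And>i. i < N \<Longrightarrow> \<xi> i \<in> smooth_dual smul \<pi>"
    and e: "\<And>g. g \<in> GL \<Longrightarrow> \<phi> g = (\<Sum>i<N. dual_action \<pi> g (\<xi> i) (v i))"
    using \<phi> unfolding contragredient_coefficients_def by blast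
  have lin: "Vector_Spaces.linear smul (*) (\<xi> i)" if "i < N" for i using \<xi>[OF that] by (simp add: smooth_dual_def)
  have scale: "\<xi> i (smul c w) = c * \<xi> i w" if "i < N" for i c w
  proof -
    interpret Vector_Spaces.linear smul "(*)" "\<xi> i" by (rule lin[OF that])
    show ?thesis by (rule scale)
  qed
  obtain l0 where "\<forall>i<N. \<forall>k\<in>K_sub l0. dual_action \<pi> k (\<xi> i) = \<xi> i"
    using smooth_dual_fixed_level[OF \<pi> \<xi>] by (rule exE)
  then have l0: "\<And>i k. i < N \<Longrightarrow> k \<in> K_sub l0 \<Longrightarrow> dual_action \<pi> k (\<xi> i) = \<xi> i" by simp
  obtain l1 where l1: "1 \<le> l1" "\<And>x. x - 1 \<in> prime_power (int l1) \<Longrightarrow> chi x = 1"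
    using quasi_character_trivial_near_1[OF chi] by metis
  define l where "l = max l0 l1"
  have l: "1 \<le> l" using l1 by (simp add: l_def)
  have Kl: "k \<in> K_sub l0" "chi (det k) = 1" if k: "k \<in> K_sub l" for k :: "'f^'n^'n"
  proof -
    show "k \<in> K_sub l0" using k K_sub_antimono[of l0 l] by (auto simp: l_def)
    have "k \<in> K_sub l1" using k K_sub_antimono[of l1 l] by (auto simp: l_def)
    then show "chi (det k) = 1" by (intro l1(2) K_sub_det)
  qed
  have act: "dual_action ?\<tau> g (\<xi> i) w = chi (det (matrix_inv g)) * dual_action \<pi> g (\<xi> i) w" if "i < N" for g i w
    by (simp add: dual_action_def twist_def scale[OF that])
  have inv: "dual_action ?\<tau> (g ** k) (\<xi> i) = dual_action ?\<tau> g (\<xi> i)"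
    if i: "i < N" and g: "g \<in> GL" and k: "k \<in> K_sub l" for i g k
  proof
    fix w
    have kGL: "k \<in> GL" using k K_sub_subset_GL[OF l] by blast
    have g0: "det g \<noteq> 0" "det k \<noteq> 0" using g kGL by (simp_all add: GL_iff_det)
    have "chi (det k * inverse (det k)) = chi (det k) * chi (inverse (det k))"
      by (rule quasi_character_mult[OF chi]) (use g0 in auto)
    then have "chi (inverse (det k)) = 1" using g0 Kl(2)[OF k] quasi_character_1[OF chi] by simp
    then have "chi (det (matrix_inv (g ** k))) = chi (det (matrix_inv g))"
      using quasi_character_mult[OF chi, of "inverse (det g)" "inverse (det k)"] g0
      by (simp add: det_matrix_inv GL_mult g kGL det_mul)
    moreover have "dual_action \<pi> (g ** k) (\<xi> i) w = dual_action \<pi> g (\<xi> i) w"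
      by (rule dual_action_mult_fixed[OF \<pi> g kGL l0[OF i Kl(1)[OF k]]])
    ultimately show "dual_action ?\<tau> (g ** k) (\<xi> i) w = dual_action ?\<tau> g (\<xi> i) w" by (simp add: act[OF i])
  qed
  have sd: "\<xi> i \<in> smooth_dual smul ?\<tau>" if i: "i < N" for i
  proof -
    have "open {g\<in>GL. dual_action ?\<tau> g (\<xi> i) = \<xi> i}"
    proof (subst open_subopen, intro ballI)
      fix g assume g: "g \<in> {g\<in>GL. dual_action ?\<tau> g (\<xi> i) = \<xi> i}"
      have "K_coset l g \<subseteq> {g\<in>GL. dual_action ?\<tau> g (\<xi> i) = \<xi> i}"
      proof
        fix h assume h: "h \<in> K_coset l g"
        then obtain k where "k \<in> K_sub l" "h = g ** k" using K_cosetE[OF h] g by blast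
        moreover have "h \<in> GL" using K_coset_nabs_det(2)[OF _ h l] g by blast
        ultimately show "h \<in> {g\<in>GL. dual_action ?\<tau> g (\<xi> i) = \<xi> i}" using inv[OF i, of g k] g by simp
      qed
      then show "\<exists>T. open T \<and> g \<in> T \<and> T \<subseteq> {g\<in>GL. dual_action ?\<tau> g (\<xi> i) = \<xi> i}"
        using open_K_coset[of l g] mem_K_coset_self[of g l] g by (intro exI[of _ "K_coset l g"]) simp
    qed
    then show ?thesis using lin[OF i] by (simp add: smooth_dual_def)
  qed
  have "twisted_coefficient chi \<phi> g = (\<Sum>i<N. \<xi> i (?\<tau> g (v i)))" if g: "g \<in> GL" for g
    by (simp add: twisted_coefficient_def e[OF GL_matrix_inv[OF g]] dual_action_def matrix_inv_matrix_inv[OF g]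
        twist_def scale sum_distrib_left)
  then show ?thesis unfolding matrix_coefficients_def using sd by blast
qed


section \<open>The kernel function on determinant shells\<close>

text \<open>The coefficient that the kernel integral and the zeta integral share at the parameter \<open>s\<close>.\<close>
definition shifted_coefficient :: "('f::nonarch_local_field \<Rightarrow> complex) \<Rightarrow> ('f^'n^'n::finite \<Rightarrow> complex)
    \<Rightarrow> complex \<Rightarrow> 'f^'n^'n \<Rightarrow> complex" where
  "shifted_coefficient chi \<phi> s g =
     \<phi> g * of_real (nabs (det g) powr (real CARD('n) / 2)) * char_shift chi s (inverse (det g))"

lemma shifted_coefficient_right_invariant:
  fixes \<phi> :: "'f::nonarch_local_field^'n^'n::finite \<Rightarrow> complex"
  assumes chi: "quasi_character chi" and \<phi>: "right_invariant l \<phi>" and l: "1 \<le> l"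
    and triv: "\<And>x. x - 1 \<in> prime_power (int l) \<Longrightarrow> chi x = 1"
  shows "right_invariant l (shifted_coefficient chi \<phi> s)"
  unfolding right_invariant_def
proof (intro ballI)
  fix g k :: "'f^'n^'n" assume g: "g \<in> GL" and k: "k \<in> K_sub l"
  have g0: "det g \<noteq> 0" "det k \<noteq> 0" using g k K_sub_subset_GL[OF l] by (auto simp: GL_iff_det)
  have n: "nabs (det k) = 1" by (rule K_sub_nabs_det[OF k l])
  have "chi (det k * inverse (det k)) = chi (det k) * chi (inverse (det k))"
    by (rule quasi_character_mult[OF chi]) (use g0 in auto)
  then have "chi (inverse (det k)) = 1" using g0 triv[OF K_sub_det[OF k]] quasi_character_1[OF chi] by simp
  then have "char_shift chi s (inverse (det (g ** k))) = char_shift chi s (inverse (det g))"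
    using quasi_character_mult[OF chi, of "inverse (det g)" "inverse (det k)"] g0
    by (simp add: char_shift_def det_mul nabs_mult nabs_inverse n)
  moreover have "\<phi> (g ** k) = \<phi> g" using \<phi> g k by (simp add: right_invariant_def)
  ultimately show "shifted_coefficient chi \<phi> s (g ** k) = shifted_coefficient chi \<phi> s g"
    by (simp add: shifted_coefficient_def det_mul nabs_mult n)
qed

lemma of_real_powr_exp: "0 < d \<Longrightarrow> complex_of_real d powr z = exp (z * of_real (ln d))"
  by (simp add: powr_def Ln_of_real)

lemma shifted_coefficient_shell:
  fixes g :: "'f::nonarch_local_field^'n^'n::finite"
  assumes "g \<in> det_shell j"
  shows "shifted_coefficient chi \<phi> s g
    = exp (s * of_real (of_int j * ln (resq TYPE('f)))) * shifted_coefficient chi \<phi> 0 g"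
proof -
  have "det g \<in> shell j" using assms by (simp add: det_shell_def)
  then have n: "nabs (inverse (det g)) = resq TYPE('f) powi j"
    using nabs_shell[of "det g" j] by (simp add: nabs_inverse power_int_minus)
  have "ln (resq TYPE('f) powi j) = of_int j * ln (resq TYPE('f))"
    using resq_pos[where 'f='f] powr_real_of_int'[of "resq TYPE('f)" j] ln_powr[of "resq TYPE('f)" "of_int j"] by simp
  then have "of_real (nabs (inverse (det g))) powr s = exp (s * of_real (of_int j * ln (resq TYPE('f))))"
    using resq_powi_pos[where 'f='f, of j] by (simp only: n of_real_powr_exp)
  moreover have "of_real (nabs (inverse (det g))) powr (0::complex) = 1"
    using resq_powi_pos[where 'f='f, of j] by (simp only: n of_real_powr_exp) simp
  ultimately show ?thesis by (simp add: shifted_coefficient_def char_shift_def)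
qed

lemma phase_cut_shifted:
  fixes g :: "'f::nonarch_local_field^'n^'n::finite"
  shows "phase_cut \<psi> (shifted_coefficient chi \<phi> s) j A g
    = exp (s * of_real (of_int j * ln (resq TYPE('f)))) * phase_cut \<psi> (shifted_coefficient chi \<phi> 0) j A g"
  using shifted_coefficient_shell[of g j chi \<phi> s] by (simp add: phase_cut_def)

text \<open>The limit defining the kernel is that of an eventually constant sequence.\<close>
lemma pi_kernel_on_shell:
  fixes D :: "'f \<Rightarrow> ('f::nonarch_local_field^'n^'n::finite) measure"
  assumes \<psi>: "additive_character \<psi>" "conductor_integers \<psi>" and \<mu>: "haar_measure \<mu>"
    and D: "det_fibre_measures \<mu> D" and \<phi>: "right_invariant l \<phi>" and l: "1 \<le> l"
    and x: "x \<in> shell j" and L: "2 * l \<le> L" "- j \<le> int L"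
  shows "pi_kernel \<mu> D \<psi> \<phi> x = of_real (nabs x powr (real CARD('n) / 2)) *
    (LINT g|D x. indicator (matrix_lattice (- int L)) g * (\<psi> (trace g) * \<phi> g))"
proof -
  let ?W = "\<lambda>r. matrix_lattice (- int r) :: ('f^'n^'n) set"
  let ?I = "\<lambda>r. (LINT g|D x. indicator (?W r) g * (\<psi> (trace g) * \<phi> g))"
  let ?d = "complex_of_real (nabs x powr (real CARD('n) / 2))"
  have x0: "x \<noteq> 0" using x by (rule mem_shell_nonzero)
  have "(LINT g|D x. gl_convolution \<mu> (Phi_GJ \<psi>) (vee (c_fun \<mu> r)) g * \<phi> g) = ?d * ?I L" if r: "L \<le> r" for r
  proof -
    have r1: "1 \<le> r" using r L l by simp
    have "(LINT g|D x. gl_convolution \<mu> (Phi_GJ \<psi>) (vee (c_fun \<mu> r)) g * \<phi> g)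
      = (LINT g|D x. ?d * (indicator (?W r) g * (\<psi> (trace g) * \<phi> g)))"
    proof (rule Bochner_Integration.integral_cong[OF refl])
      fix g assume "g \<in> space (D x)"
      then have g: "det g = x" by (simp add: det_fibre_space[OF D x0])
      then have "g \<in> GL" using x0 by (simp add: GL_iff_det)
      from gl_convolution_Phi_GJ[OF \<psi> \<mu> D r1 this]
      show "gl_convolution \<mu> (Phi_GJ \<psi>) (vee (c_fun \<mu> r)) g * \<phi> g
        = ?d * (indicator (?W r) g * (\<psi> (trace g) * \<phi> g))"
        by (simp add: Phi_GJ_def g)
    qed
    also have "\<dots> = ?d * ?I r" by (rule integral_mult_right_zero)
    also have "?I r = ?I L" by (rule phase_fibre_stable[OF \<psi> \<mu> D \<phi> l x L r])
    finally show ?thesis .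
  qed
  then have "(\<lambda>r. LINT g|D x. gl_convolution \<mu> (Phi_GJ \<psi>) (vee (c_fun \<mu> r)) g * \<phi> g) \<longlonglongrightarrow> ?d * ?I L"
    by (intro tendsto_eventually eventually_sequentiallyI[of L])
  then show ?thesis unfolding pi_kernel_def by (rule limI)
qed

text \<open>The kernel is evaluated at a level \<open>L\<close> adapted to the shell, the integral along the determinant is
  undone, and the level is then lowered to \<open>2 l\<close>, which no longer depends on the shell.\<close>
lemma kernel_shell_integral:
  fixes D :: "'f \<Rightarrow> ('f::nonarch_local_field^'n^'n::finite) measure"
  assumes \<psi>: "additive_character \<psi>" "conductor_integers \<psi>" and \<mu>: "haar_measure \<mu>"
    and D: "det_fibre_measures \<mu> D" and \<phi>: "right_invariant l \<phi>" and l: "1 \<le> l"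
    and chi: "quasi_character chi" and triv: "\<And>x. x - 1 \<in> prime_power (int l) \<Longrightarrow> chi x = 1"
  shows "set_integrable (mult_measure \<mu>) (shell j) (\<lambda>x. pi_kernel \<mu> D \<psi> \<phi> x * char_shift chi s (inverse x))"
    and "(LINT x:shell j|mult_measure \<mu>. pi_kernel \<mu> D \<psi> \<phi> x * char_shift chi s (inverse x))
      = (LINT g|gl_measure \<mu>. phase_cut \<psi> (shifted_coefficient chi \<phi> s) j (matrix_lattice (- int (2 * l))) g)"
proof -
  define L where "L = max (2 * l) (nat (- j))"
  have L: "2 * l \<le> L" "- j \<le> int L" by (auto simp: L_def)
  let ?\<eta> = "shifted_coefficient chi \<phi> s" and ?W = "matrix_lattice (- int L) :: ('f^'n^'n) set"
  let ?u = "phase_cut \<psi> ?\<eta> j ?W" and ?f = "\<lambda>x. pi_kernel \<mu> D \<psi> \<phi> x * char_shift chi s (inverse x)"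
  have \<eta>: "right_invariant l ?\<eta>" by (rule shifted_coefficient_right_invariant[OF chi \<phi> l triv])
  have sb: "schwartz_bruhat ?u"
    by (rule phase_cut_schwartz_bruhat[OF \<psi> \<eta> compact_matrix_lattice open_matrix_lattice])
  have eq: "?f x = (LINT g|D x. ?u g)" if x: "x \<in> shell j" for x
  proof -
    let ?c = "complex_of_real (nabs x powr (real CARD('n) / 2)) * char_shift chi s (inverse x)"
    have x0: "x \<noteq> 0" using x by (rule mem_shell_nonzero)
    have "(LINT g|D x. ?u g) = (LINT g|D x. ?c * (indicator ?W g * (\<psi> (trace g) * \<phi> g)))"
    proof (rule Bochner_Integration.integral_cong[OF refl])
      fix g assume g: "g \<in> space (D x)"
      then have "det g = x" by (simp add: det_fibre_space[OF D x0])
      then show "?u g = ?c * (indicator ?W g * (\<psi> (trace g) * \<phi> g))"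
        by (simp add: phase_cut_fibre[OF D x g] shifted_coefficient_def mult_ac)
    qed
    also have "\<dots> = ?c * (LINT g|D x. indicator ?W g * (\<psi> (trace g) * \<phi> g))" by (rule integral_mult_right_zero)
    finally show ?thesis by (simp add: pi_kernel_on_shell[OF \<psi> \<mu> D \<phi> l x L] mult_ac)
  qed
  have z: "(LINT g|D x. ?u g) = 0" if x: "x \<noteq> 0" "x \<notin> shell j" for x
  proof -
    have "?u g = 0" if "g \<in> space (D x)" for g
      using that x by (simp add: phase_cut_def det_shell_def det_fibre_space[OF D x(1)])
    then show ?thesis by (subst Bochner_Integration.integral_cong[OF refl, of _ _ "\<lambda>_. 0"]) auto
  qed
  have "continuous_on (UNIV - {0}) (\<lambda>x. LINT g|D x. ?u g)"
  proof (rule det_fibre_continuous[OF D sb])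
    fix g :: "'f^'n^'n" assume "g \<notin> GL"
    then show "?u g = 0" using phase_cut_support[of \<psi> ?\<eta> j ?W g] det_shell_subset_GL by blast
  qed
  then have "set_integrable (mult_measure \<mu>) (shell j) (\<lambda>x. LINT g|D x. ?u g)" by (rule shell_integrable[OF \<mu>])
  also have "?this \<longleftrightarrow> set_integrable (mult_measure \<mu>) (shell j) ?f"
    by (rule set_integrable_cong) (simp_all add: eq)
  finally show "set_integrable (mult_measure \<mu>) (shell j) ?f" .
  have "(LINT x:shell j|mult_measure \<mu>. ?f x) = (LINT x|mult_measure \<mu>. (LINT g|D x. ?u g))"
    unfolding set_lebesgue_integral_def
  proof (rule Bochner_Integration.integral_cong[OF refl])
    fix x assume "x \<in> space (mult_measure \<mu>)"
    then have "x \<noteq> 0" by simp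
    then show "indicator (shell j) x *\<^sub>R ?f x = (LINT g|D x. ?u g)"
      using eq[of x] z[of x] by (cases "x \<in> shell j") auto
  qed
  also have "\<dots> = (LINT g|gl_measure \<mu>. ?u g)"
    using det_fibre_integral(3)[OF \<mu> D sb phase_cut_support] by simp
  also have "\<dots> = (LINT g|gl_measure \<mu>. phase_cut \<psi> ?\<eta> j (matrix_lattice (- int (2 * l))) g)"
    by (rule phase_shell_stable[OF \<psi> \<mu> D \<eta> l order_refl L(1)])
  finally show "(LINT x:shell j|mult_measure \<mu>. ?f x)
      = (LINT g|gl_measure \<mu>. phase_cut \<psi> ?\<eta> j (matrix_lattice (- int (2 * l))) g)" .
qed

lemma matrix_lattice_det_shell:
  fixes g :: "'f::nonarch_local_field^'n^'n::finite"
  assumes "g \<in> matrix_lattice (- int L)" "g \<in> det_shell j"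
  shows "- int (CARD('n) * L) \<le> j"
proof -
  have "det g \<in> prime_power (- int (CARD('n) * L))" using det_in_prime_power[OF assms(1)] by simp
  moreover have "nabs (det g) = resq TYPE('f) powi (- j)" using assms(2) by (simp add: det_shell_def nabs_shell)
  ultimately show ?thesis using resq_powi_le_iff[where 'f='f, of "- j" "int (CARD('n) * L)"]
    by (simp add: prime_power_def del: power_int_of_nat)
qed

text \<open>On \<open>M\<^sub>n(\<pp>\<^sup>-\<^sup>L)\<close> only determinant shells of index at least \<open>-n L\<close> occur, so the decomposition into shells
  is a series indexed by natural numbers; it converges by dominated convergence.\<close>
lemma phase_integral_shell_sums:
  fixes \<mu> :: "'f::nonarch_local_field measure" and \<eta> :: "'f^'n^'n::finite \<Rightarrow> complex"
  assumes "integrable (gl_measure \<mu>) (\<lambda>g. indicator (matrix_lattice (- int L)) g * (\<psi> (trace g) * \<eta> g))"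
  shows "(\<lambda>i. LINT g|gl_measure \<mu>. phase_cut \<psi> \<eta> (int i - int (CARD('n) * L)) (matrix_lattice (- int L)) g)
    sums (LINT g|gl_measure \<mu>. indicator (matrix_lattice (- int L)) g * (\<psi> (trace g) * \<eta> g))"
proof -
  define N where "N = int (CARD('n) * L)"
  let ?W = "matrix_lattice (- int L) :: ('f^'n^'n) set"
  let ?H = "\<lambda>g. indicator ?W g * (\<psi> (trace g) * \<eta> g)" and ?p = "\<lambda>i. phase_cut \<psi> \<eta> (int i - N) ?W"
  have p: "?p i g = indicator (det_shell (int i - N)) g *\<^sub>R ?H g" for i g
    by (simp add: phase_cut_def indicator_def)
  have ds: "det_shell j \<in> sets (gl_measure \<mu> :: ('f^'n^'n) measure)" for j
    using borel_open[OF open_det_shell, of j] det_shell_subset_GL[of j]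
    by (auto simp: sets_gl_measure sets_restrict_space intro!: image_eqI[of _ _ "det_shell j"])
  have int: "integrable (gl_measure \<mu>) (?p i)" for i
    unfolding p using integrable_mult_indicator[OF ds assms] .
  have part: "(\<Sum>i<k. ?p i g) = (if \<exists>i<k. g \<in> det_shell (int i - N) then ?H g else 0)" for k g
  proof (cases "\<exists>i<k. g \<in> det_shell (int i - N)")
    case True
    then obtain i where i: "i < k" "g \<in> det_shell (int i - N)" by blast
    have "(\<Sum>i'<k. ?p i' g) = (\<Sum>i'<k. if i' = i then ?H g else 0)"
    proof (rule sum.cong[OF refl])
      fix i'
      have "g \<in> det_shell (int i' - N) \<longleftrightarrow> i' = i"
        using i(2) shell_disjoint[of "det g" "int i - N" "int i' - N"] by (auto simp: det_shell_def)
      then show "?p i' g = (if i' = i then ?H g else 0)" using i(2) by (cases "i' = i") (simp_all add: p)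
    qed
    then show ?thesis using True i(1) by simp
  next
    case False
    then show ?thesis by (auto simp: p intro!: sum.neutral)
  qed
  have "(\<lambda>k. LINT g|gl_measure \<mu>. (\<Sum>i<k. ?p i g)) \<longlonglongrightarrow> (LINT g|gl_measure \<mu>. ?H g)"
  proof (rule integral_dominated_convergence[where w="\<lambda>g. norm (?H g)"])
    show "?H \<in> borel_measurable (gl_measure \<mu>)" using assms by (rule borel_measurable_integrable)
    show "(\<lambda>g. \<Sum>i<k. ?p i g) \<in> borel_measurable (gl_measure \<mu>)" for k
      by (intro borel_measurable_integrable Bochner_Integration.integrable_sum int)
    show "integrable (gl_measure \<mu>) (\<lambda>g. norm (?H g))" using assms by (rule integrable_norm)
    show "AE g in gl_measure \<mu>. norm (\<Sum>i<k. ?p i g) \<le> norm (?H g)" for k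
      by (intro AE_I2) (simp add: part)
    show "AE g in gl_measure \<mu>. (\<lambda>k. \<Sum>i<k. ?p i g) \<longlonglongrightarrow> ?H g"
    proof (rule AE_I2)
      fix g :: "'f^'n^'n" assume "g \<in> space (gl_measure \<mu>)"
      then have "det g \<noteq> 0" by (simp add: GL_iff_det)
      then obtain j where j: "g \<in> det_shell j" using mem_some_shell[of "det g"] by (auto simp: det_shell_def)
      have "(\<Sum>i<k. ?p i g) = ?H g" if k: "nat (j + N) < k" for k
      proof (cases "g \<in> ?W")
        case True
        then have "int (nat (j + N)) - N = j" using matrix_lattice_det_shell[OF True j] by (simp add: N_def)
        then have "g \<in> det_shell (int (nat (j + N)) - N)" using j by simp
        then show ?thesis using k unfolding part by auto
      qed (simp add: part)
      then show "(\<lambda>k. \<Sum>i<k. ?p i g) \<longlonglongrightarrow> ?H g"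
        by (intro tendsto_eventually eventually_sequentiallyI[of "Suc (nat (j + N))"]) simp
    qed
  qed
  moreover have "(LINT g|gl_measure \<mu>. (\<Sum>i<k. ?p i g)) = (\<Sum>i<k. LINT g|gl_measure \<mu>. ?p i g)" for k
    by (rule Bochner_Integration.integral_sum) (rule int)
  ultimately have "(\<lambda>i. LINT g|gl_measure \<mu>. ?p i g) sums (LINT g|gl_measure \<mu>. ?H g)" by (simp add: sums_def)
  then show ?thesis unfolding N_def .
qed


section \<open>The zeta integrals of congruence subgroups\<close>

lemma c_fun_schwartz_bruhat:
  fixes \<mu> :: "'f::nonarch_local_field measure"
  shows "schwartz_bruhat (c_fun \<mu> l :: 'f^'n^'n::finite \<Rightarrow> complex)"
proof -
  let ?K = "K_sub l :: ('f^'n^'n) set"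
  let ?v = "complex_of_real (inverse (measure (gl_measure \<mu>) ?K))"
  have K: "?K = {h. h - mat 1 \<in> matrix_lattice (int l)}" by (auto simp: K_sub_iff)
  have "open ?K" unfolding K by (rule open_matrix_coset)
  moreover have "compact ?K"
  proof -
    have "?K = matrix_lattice 0 \<inter> ?K" using K_sub_integral by blast
    moreover have "closed ?K" unfolding K by (rule closed_matrix_coset)
    ultimately show ?thesis using compact_Int_closed[OF compact_matrix_lattice] by metis
  qed
  moreover have "locally_const_on UNIV (\<lambda>_::'f^'n^'n. ?v)" by (auto simp: locally_const_on_def)
  ultimately have "schwartz_bruhat (\<lambda>g. if g \<in> ?K then ?v else 0)" by (intro schwartz_bruhat_restrict) auto
  moreover have "c_fun \<mu> l = (\<lambda>g. if g \<in> ?K then ?v else 0)" by (auto simp: c_fun_def)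
  ultimately show ?thesis by simp
qed

lemma zeta_integral_c_fun:
  fixes \<mu> :: "'f::nonarch_local_field measure" and \<phi> :: "'f^'n^'n::finite \<Rightarrow> complex"
  assumes \<mu>: "haar_measure \<mu>" and \<phi>: "right_invariant l \<phi>" "\<phi> (mat 1) = 1" and l: "1 \<le> l" "l \<le> L"
    and triv: "\<And>x. x - 1 \<in> prime_power (int l) \<Longrightarrow> chi x = 1"
  shows "(LINT g|gl_measure \<mu>. zeta_integrand (c_fun \<mu> L) (twisted_coefficient chi \<phi>) s g) = 1"
proof -
  let ?K = "K_sub L :: ('f^'n^'n) set"
  define v where "v = measure (gl_measure \<mu>) ?K"
  have L: "1 \<le> L" using l by simp
  have v: "0 < v" unfolding v_def by (rule K_sub_volume(3)[OF \<mu> L])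
  have "zeta_integrand (c_fun \<mu> L) (twisted_coefficient chi \<phi>) s g = of_real (inverse v) * indicator ?K g" for g
  proof (cases "g \<in> ?K")
    case True
    then have g: "g \<in> GL" "g \<in> K_sub l" using K_sub_subset_GL[OF L] K_sub_antimono[OF l(2)] by auto
    have "\<phi> (matrix_inv g ** g) = \<phi> (matrix_inv g)"
      using \<phi>(1) GL_matrix_inv[OF g(1)] g(2) unfolding right_invariant_def by blast
    then have "\<phi> (matrix_inv g) = 1" using \<phi>(2) GL_inv(2)[OF g(1)] by simp
    moreover have "chi (det g) = 1" by (rule triv[OF K_sub_det[OF g(2)]])
    ultimately show ?thesis using True K_sub_nabs_det[OF True L]
      by (simp add: zeta_integrand_def twisted_coefficient_def c_fun_def v_def)
  qed (simp add: zeta_integrand_def c_fun_def)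
  then have "(LINT g|gl_measure \<mu>. zeta_integrand (c_fun \<mu> L) (twisted_coefficient chi \<phi>) s g)
    = of_real (inverse v) * (LINT g|gl_measure \<mu>. indicator ?K g)" by (simp only: integral_mult_right_zero)
  also have "(LINT g|gl_measure \<mu>. indicator ?K g :: complex) = of_real v"
  proof -
    have "?K \<subseteq> GL" by (rule K_sub_subset_GL[OF L])
    then show ?thesis by (simp add: integral_complex_indicator v_def Int_absorb2)
  qed
  finally show ?thesis using v by simp
qed

text \<open>At \<open>1/2 - s = 1 - (s + 1/2)\<close> the exponent of \<open>|det g|\<close> in the zeta integral is \<open>n/2 - s\<close>: the \<open>n/2\<close> is the
  power in \<open>\<Phi>\<^sub>G\<^sub>J\<close> and the \<open>-s\<close> is that of \<open>\<chi>\<^sub>s(det g)\<^sup>-\<^sup>1\<close>.\<close>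
lemma zeta_integrand_fourier_c_fun:
  fixes \<mu> :: "'f::nonarch_local_field measure" and \<phi> :: "'f^'n^'n::finite \<Rightarrow> complex"
  assumes \<psi>: "additive_character \<psi>" "conductor_integers \<psi>" and \<mu>: "haar_measure \<mu>"
    and l: "1 \<le> L" and g: "g \<in> GL"
  shows "zeta_integrand (matrix_fourier \<mu> \<psi> (c_fun \<mu> L)) (vee (twisted_coefficient chi \<phi>)) (1/2 - s) g
    = indicator (matrix_lattice (- int L)) g * (\<psi> (trace g) * shifted_coefficient chi \<phi> s g)"
proof -
  let ?d = "nabs (det g)" and ?n = "real CARD('n)"
  have d: "0 < ?d" using g by (intro nabs_pos) (simp add: GL_iff_det)
  have "of_real ?d powr ((1/2 - s) + (of_nat CARD('n) - 1) / 2) = exp ((of_real ?n / 2 - s) * of_real (ln ?d))"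
    using d by (simp add: of_real_powr_exp field_simps)
  also have "\<dots> = exp (of_real (?n / 2 * ln ?d)) * exp (s * of_real (ln (inverse ?d)))"
    using d by (simp add: exp_add[symmetric] ln_inverse left_diff_distrib)
  also have "exp (complex_of_real (?n / 2 * ln ?d)) = of_real (exp (?n / 2 * ln ?d))" by (rule exp_of_real)
  also have "exp (?n / 2 * ln ?d) = ?d powr (?n / 2)" using d by (auto simp: powr_def)
  also have "exp (s * of_real (ln (inverse ?d))) = of_real (nabs (inverse (det g))) powr s"
    using d by (simp only: nabs_inverse of_real_powr_exp positive_imp_inverse_positive)
  finally have "of_real ?d powr ((1/2 - s) + (of_nat CARD('n) - 1) / 2)
    = of_real (?d powr (?n / 2)) * of_real (nabs (inverse (det g))) powr s" .
  then show ?thesis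
    unfolding zeta_integrand_def matrix_fourier_c_fun[OF \<psi> \<mu> l]
    by (simp add: vee_def twisted_coefficient_def matrix_inv_matrix_inv[OF g] det_matrix_inv[OF g]
        shifted_coefficient_def char_shift_def mult_ac)
qed


section \<open>Meromorphic continuation\<close>

text \<open>A series in \<open>q\<^sup>s\<close> with finitely many negative powers is, up to a monomial, a power series in
  \<open>w = q\<^sup>s\<close>; the half-plane \<open>Re s < c\<close> corresponds to the punctured disc of radius \<open>q\<^sup>c\<close>.\<close>
lemma laurent_series_holomorphic:
  fixes a :: "nat \<Rightarrow> complex" and b c :: real and N :: int
  assumes b: "0 < b"
    and sums: "\<And>s. Re s < c \<Longrightarrow> (\<lambda>i. exp (s * of_real (of_int (int i - N) * b)) * a i) sums I s"
  shows "I holomorphic_on {s. Re s < c}"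
proof -
  define A where "A w = (\<Sum>i. a i * w ^ i)" for w
  have split: "exp (s * of_real (of_int (int i - N) * b)) = exp (- (s * of_real (of_int N * b))) * exp (s * of_real b) ^ i"
    for s :: complex and i
    by (simp add: exp_of_nat_mult[symmetric] exp_add[symmetric] algebra_simps)
  have eq: "exp (s * of_real (of_int N * b)) * (exp (s * of_real (of_int (int i - N) * b)) * a i)
    = a i * exp (s * of_real b) ^ i" for s i
    unfolding split[of s i] by (simp add: exp_minus)
  have S: "(\<lambda>i. a i * exp (s * of_real b) ^ i) sums (exp (s * of_real (of_int N * b)) * I s)" if "Re s < c" for s
    using sums_mult[OF sums[OF that], of "exp (s * of_real (of_int N * b))"] unfolding eq .
  have "A holomorphic_on ball 0 (exp (c * b))"
  proof (rule power_series_holomorphic[where a=a])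
    fix w :: complex assume w: "w \<in> ball 0 (exp (c * b))"
    have "summable (\<lambda>i. a i * w ^ i)"
    proof (cases "w = 0")
      case True
      then show ?thesis by (simp add: summable_0_powser)
    next
      case False
      define s where "s = Ln w / of_real b"
      have e: "exp (s * of_real b) = w" using False b by (simp add: s_def)
      have "ln (norm w) < ln (exp (c * b))" using w False by (subst ln_less_cancel_iff) auto
      then have "ln (norm w) < c * b" by simp
      then have "Re s < c" using False b by (simp add: s_def Re_divide_of_real divide_less_eq)
      then show ?thesis using S[of s] e sums_summable by metis
    qed
    then show "(\<lambda>i. a i * (w - 0) ^ i) sums A w" unfolding A_def by (simp add: summable_sums)
  qed
  then have "(\<lambda>s. exp (- (s * of_real (of_int N * b))) * A (exp (s * of_real b))) holomorphic_on {s. Re s < c}"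
    using b by (intro holomorphic_intros holomorphic_on_compose_gen[of "\<lambda>s. exp (s * of_real b)" _ A, unfolded comp_def]) auto
  moreover have "exp (- (s * of_real (of_int N * b))) * A (exp (s * of_real b)) = I s" if "s \<in> {s. Re s < c}" for s
    using sums_unique[OF S[of s], symmetric] that by (simp add: A_def exp_minus)
  ultimately show ?thesis by (rule holomorphic_transform)
qed

text \<open>The holomorphic function provides a finite limit, which rules out poles and hence fixes the value.\<close>
lemma nicely_meromorphic_eq_holomorphic:
  assumes f: "f nicely_meromorphic_on UNIV" and g: "g holomorphic_on S" "open S"
    and ev: "\<forall>\<^sub>\<approx>z\<in>UNIV. z \<in> S \<longrightarrow> f z = g z" and z: "z \<in> S"
  shows "f z = g z"
proof -
  have "eventually (\<lambda>w. w \<in> S \<longrightarrow> f w = g w) (at z)"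
    by (rule eventually_cosparse_imp_eventually_at[OF ev]) simp
  moreover have "eventually (\<lambda>w. w \<in> S) (at z)" using eventually_at_in_open'[OF g(2) z] .
  ultimately have e: "eventually (\<lambda>w. g w = f w) (at z)" by eventually_elim auto
  have "isCont g z" using holomorphic_on_imp_continuous_on[OF g(1)] g(2) z continuous_on_eq_continuous_at by blast
  then have "g \<midarrow>z\<rightarrow> g z" by (simp add: isCont_def)
  then have lim: "f \<midarrow>z\<rightarrow> g z" using e by (rule Lim_transform_eventually)
  then have "\<not> is_pole f z" unfolding is_pole_def using not_tendsto_and_filterlim_at_infinity[of "at z" f] by auto
  then have "f \<midarrow>z\<rightarrow> f z" using f unfolding nicely_meromorphic_on_def by blast
  then show ?thesis using lim LIM_unique by blast
qed

lemma meromorphic_eq_const_if_eq_on_halfplane: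
  assumes Z: "Z meromorphic_on UNIV" and c: "\<And>s. Re s > c \<Longrightarrow> Z s = a"
  shows "\<forall>\<^sub>\<approx>s\<in>UNIV. Z s = a"
proof -
  let ?z = "complex_of_real (c + 1)"
  have R: "remove_sings Z nicely_meromorphic_on UNIV" by (rule remove_sings_nicely_meromorphic[OF Z])
  have eq: "\<forall>\<^sub>\<approx>s\<in>UNIV. remove_sings Z s = Z s" using Z by (rule eventually_remove_sings_eq)
  have "eventually (\<lambda>s. s \<in> {s. Re s > c}) (at ?z)"
    by (rule eventually_at_in_open') (auto simp: open_halfspace_Re_gt)
  moreover have "eventually (\<lambda>s. remove_sings Z s = Z s) (at ?z)"
    by (rule eventually_cosparse_imp_eventually_at[OF eq]) simp
  ultimately have "eventually (\<lambda>s. remove_sings Z s = a) (at ?z)" by eventually_elim (auto simp: c)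
  then have "frequently (\<lambda>s. remove_sings Z s = a) (at ?z)" by (intro eventually_frequently) auto
  then have "remove_sings Z s = a" for s
    by (rule frequently_eq_meromorphic_imp_constant[OF _ R open_UNIV connected_UNIV UNIV_I UNIV_I])
  then show ?thesis using eq by (auto elim: eventually_mono)
qed

lemma nicely_meromorphic_shift:
  assumes "f nicely_meromorphic_on UNIV"
  shows "(\<lambda>s. f (s + d)) nicely_meromorphic_on UNIV"
proof -
  have "f meromorphic_on UNIV" using assms by (simp add: nicely_meromorphic_on_def)
  then have "(\<lambda>s. f (s + d)) meromorphic_on UNIV"
    by (rule meromorphic_on_compose) (auto intro!: analytic_intros)
  moreover have "is_pole (\<lambda>s. f (s + d)) z \<longleftrightarrow> is_pole f (z + d)" for z
    using is_pole_shift_iff[of f d z] by (simp add: comp_def add.commute)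
  moreover have "(\<lambda>s. f (s + d)) \<midarrow>z\<rightarrow> f (z + d) \<longleftrightarrow> f \<midarrow>z + d\<rightarrow> f (z + d)" for z
    using filterlim_shift_iff[of f d "nhds (f (z + d))" "z + d"] by (simp add: comp_def add.commute)
  ultimately show ?thesis using assms unfolding nicely_meromorphic_on_def by simp
qed


section \<open>The gamma factor as a principal value integral\<close>

theorem theorem3p6:
  fixes \<mu> :: "'f::nonarch_local_field measure"
    and \<psi> chi :: "'f \<Rightarrow> complex"
    and D :: "'f \<Rightarrow> ('f^'n^'n::finite) measure"
    and smul :: "complex \<Rightarrow> 'v::ab_group_add \<Rightarrow> 'v"
    and \<pi> :: "'f^'n^'n \<Rightarrow> 'v \<Rightarrow> 'v"
    and \<phi> :: "'f^'n^'n \<Rightarrow> complex"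
    and \<gamma> :: "complex \<Rightarrow> complex"
  assumes "additive_character \<psi>" and "conductor_integers \<psi>"
    and "self_dual_haar \<psi> \<mu>"
    and "det_fibre_measures \<mu> D"
    and "irreducible_smooth_representation smul \<pi>"
    and "quasi_character chi"
    and "\<phi> \<in> contragredient_coefficients smul \<pi>" and "\<phi> (mat 1) = 1"
    and "godement_jacquet_gamma \<mu> \<psi> smul (twist smul chi \<pi>) \<gamma>"
  shows "\<exists>G c. G nicely_meromorphic_on UNIV \<and>
           G holomorphic_on {s. Re s < c} \<and>
           (\<forall>s. Re s < c \<longrightarrow>
              has_pv_integral \<mu> (\<lambda>x. pi_kernel \<mu> D \<psi> \<phi> x * char_shift chi s (inverse x)) (G s)) \<and>
           (\<forall>s. G s = \<gamma> (s + 1/2))"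
proof -
  note \<psi> = assms(1,2) and D = assms(4) and chi = assms(6)
  have \<mu>: "haar_measure \<mu>" using assms(3) by (simp add: self_dual_haar_def)
  have \<pi>: "smooth_representation smul \<pi>" using assms(5) by (simp add: irreducible_smooth_representation_def)
  obtain l0 where l0: "right_invariant l0 \<phi>" using contragredient_coefficient_right_invariant[OF \<pi> assms(7)] .
  obtain l1 where l1: "1 \<le> l1" "\<And>x. x - 1 \<in> prime_power (int l1) \<Longrightarrow> chi x = 1"
    using quasi_character_trivial_near_1[OF chi] by metis
  define l where "l = max l0 l1"
  have l: "1 \<le> l" using l1 by (simp add: l_def)
  have \<phi>: "right_invariant l \<phi>" using right_invariant_antimono[OF l0] by (simp add: l_def)
  have triv: "chi x = 1" if "x - 1 \<in> prime_power (int l)" for x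
    using that l1(2)[of x] prime_power_antimono[of "int l1" "int l"] by (auto simp: l_def)
  \<comment> \<open>the level from which the shell integrals of the truncated kernel are stable\<close>
  define L where "L = 2 * l"
  have L: "1 \<le> L" "l \<le> L" using l by (auto simp: L_def)
  \<comment> \<open>the order of the pole at \<open>q\<^sup>s = 0\<close> is at most \<open>N\<close>\<close>
  define N where "N = CARD('n) * L"
  let ?W = "matrix_lattice (- int L) :: ('f^'n^'n) set"
  define E where "E s j = (LINT g|gl_measure \<mu>. phase_cut \<psi> (shifted_coefficient chi \<phi> s) j ?W g)" for s j
  define I where "I s = (LINT g|gl_measure \<mu>. indicator ?W g * (\<psi> (trace g) * shifted_coefficient chi \<phi> s g))" for s

  have \<gamma>: "\<gamma> nicely_meromorphic_on UNIV" using assms(9) by (simp add: godement_jacquet_gamma_def)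
  let ?\<beta> = "twisted_coefficient chi \<phi>"
  obtain Z Z' where Z: "is_zeta_function \<mu> (c_fun \<mu> L) ?\<beta> Z"
    and Z': "is_zeta_function \<mu> (matrix_fourier \<mu> \<psi> (c_fun \<mu> L)) (vee ?\<beta>) Z'"
    and fe: "\<forall>\<^sub>\<approx>s\<in>UNIV. Z' (1 - s) = \<gamma> s * Z s"
    using assms(9) c_fun_schwartz_bruhat twisted_coefficient_mem[OF \<pi> chi assms(7)]
    unfolding godement_jacquet_gamma_def by blast
  have "\<forall>\<^sub>\<approx>s\<in>UNIV. Z s = 1"
  proof -
    obtain c where "\<And>s. Re s > c \<Longrightarrow> Z s = 1"
      using Z zeta_integral_c_fun[OF \<mu> \<phi> assms(8) l L(2) triv] unfolding is_zeta_function_def by auto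
    then show ?thesis using Z unfolding is_zeta_function_def by (intro meromorphic_eq_const_if_eq_on_halfplane) auto
  qed
  with fe have \<gamma>Z': "\<forall>\<^sub>\<approx>s\<in>UNIV. \<gamma> s = Z' (1 - s)" by eventually_elim simp
  obtain c0 where c0: "\<And>s. Re s > c0 \<Longrightarrow> integrable (gl_measure \<mu>)
        (zeta_integrand (matrix_fourier \<mu> \<psi> (c_fun \<mu> L)) (vee ?\<beta>) s) \<and>
      Z' s = (LINT g|gl_measure \<mu>. zeta_integrand (matrix_fourier \<mu> \<psi> (c_fun \<mu> L)) (vee ?\<beta>) s g)"
    using Z' unfolding is_zeta_function_def by blast
  define c where "c = 1/2 - c0"
  have zeta: "integrable (gl_measure \<mu>) (\<lambda>g. indicator ?W g * (\<psi> (trace g) * shifted_coefficient chi \<phi> s g))"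
    "Z' (1/2 - s) = I s" if s: "Re s < c" for s
  proof -
    let ?z = "zeta_integrand (matrix_fourier \<mu> \<psi> (c_fun \<mu> L)) (vee ?\<beta>) (1/2 - s)"
    have eq: "?z g = indicator ?W g * (\<psi> (trace g) * shifted_coefficient chi \<phi> s g)" if "g \<in> GL" for g
      by (rule zeta_integrand_fourier_c_fun[OF \<psi> \<mu> L(1) that])
    have "Re (1/2 - s) > c0" using s by (simp add: c_def)
    from c0[OF this] have z: "integrable (gl_measure \<mu>) ?z" "Z' (1/2 - s) = (LINT g|gl_measure \<mu>. ?z g)" by auto
    have "integrable (gl_measure \<mu>) ?z \<longleftrightarrow>
      integrable (gl_measure \<mu>) (\<lambda>g. indicator ?W g * (\<psi> (trace g) * shifted_coefficient chi \<phi> s g))"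
      by (rule Bochner_Integration.integrable_cong[OF refl]) (simp add: eq)
    with z(1) show "integrable (gl_measure \<mu>) (\<lambda>g. indicator ?W g * (\<psi> (trace g) * shifted_coefficient chi \<phi> s g))"
      by simp
    show "Z' (1/2 - s) = I s" unfolding z(2) I_def
      by (rule Bochner_Integration.integral_cong[OF refl]) (simp add: eq)
  qed

  have sums: "(\<lambda>i. E s (int i - int N)) sums I s" if "Re s < c" for s
    unfolding E_def I_def N_def by (rule phase_integral_shell_sums[OF zeta(1)[OF that]])
  have Es: "E s j = exp (s * of_real (of_int j * ln (resq TYPE('f)))) * E 0 j" for s j
    unfolding E_def phase_cut_shifted[of \<psi> chi \<phi> s] by (rule integral_mult_right_zero)
  have hol: "I holomorphic_on {s. Re s < c}"
  proof (rule laurent_series_holomorphic[where b="ln (resq TYPE('f))" and a="\<lambda>i. E 0 (int i - int N)"])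
    show "0 < ln (resq TYPE('f))" using resq_gt_1[where 'f='f] by simp
    show "(\<lambda>i. exp (s * of_real (of_int (int i - int N) * ln (resq TYPE('f)))) * E 0 (int i - int N)) sums I s"
      if "Re s < c" for s
      using sums[OF that] by (subst (asm) Es)
  qed

  \<comment> \<open>the functional equation gives this off a discrete set only\<close>
  have G: "\<gamma> (s + 1/2) = I s" if s: "Re s < c" for s
  proof -
    let ?S = "{z. Re z < c + 1/2}"
    have "(\<lambda>z. I (z - 1/2)) holomorphic_on ?S"
      by (rule holomorphic_on_compose_gen[OF _ hol, of "\<lambda>z. z - 1/2", unfolded comp_def])
        (auto intro!: holomorphic_intros)
    moreover have "\<forall>\<^sub>\<approx>z\<in>UNIV. z \<in> ?S \<longrightarrow> \<gamma> z = I (z - 1/2)"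
      using \<gamma>Z'
    proof (rule eventually_mono, intro impI)
      fix z assume "\<gamma> z = Z' (1 - z)" "z \<in> ?S"
      then show "\<gamma> z = I (z - 1/2)" using zeta(2)[of "z - 1/2"] by simp
    qed
    ultimately show ?thesis
      using nicely_meromorphic_eq_holomorphic[OF \<gamma>, of "\<lambda>z. I (z - 1/2)" ?S "s + 1/2"] s
      by (simp add: open_halfspace_Re_lt)
  qed

  have E0: "E s j = 0" if "j < - int N" for s j
  proof -
    have "phase_cut \<psi> (shifted_coefficient chi \<phi> s) j ?W g = 0" for g
      using matrix_lattice_det_shell[of g L j] that by (auto simp: phase_cut_def N_def)
    then show ?thesis by (simp add: E_def)
  qed
  have pv: "has_pv_integral \<mu> (\<lambda>x. pi_kernel \<mu> D \<psi> \<phi> x * char_shift chi s (inverse x)) (I s)" if s: "Re s < c" for s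
    unfolding has_pv_integral_def
  proof (intro conjI allI)
    have kE: "(LINT x:shell m|mult_measure \<mu>. pi_kernel \<mu> D \<psi> \<phi> x * char_shift chi s (inverse x)) = E s m" for m
      unfolding E_def L_def by (rule kernel_shell_integral(2)[OF \<psi> \<mu> D \<phi> l chi triv])
    show "set_integrable (mult_measure \<mu>) (shell m) (\<lambda>x. pi_kernel \<mu> D \<psi> \<phi> x * char_shift chi s (inverse x))" for m
      by (rule kernel_shell_integral(1)[OF \<psi> \<mu> D \<phi> l chi triv])
    have "(\<Sum>m\<in>{- int r..int r}. E s m) = (\<Sum>i<r + N + 1. E s (int i - int N))" if r: "N \<le> r" for r
    proof -
      have "(\<Sum>m\<in>{- int r..int r}. E s m) = (\<Sum>m\<in>{- int N..int r}. E s m)"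
        using r E0 by (intro sum.mono_neutral_right) auto
      also have "\<dots> = (\<Sum>i<r + N + 1. E s (int i - int N))"
        by (rule sum.reindex_bij_witness[of _ "\<lambda>i. int i - int N" "\<lambda>m. nat (m + int N)"]) auto
      finally show ?thesis .
    qed
    then have "eventually (\<lambda>r. (\<Sum>i<r + N + 1. E s (int i - int N)) = (\<Sum>m\<in>{- int r..int r}. E s m)) sequentially"
      by (intro eventually_sequentiallyI[of N]) simp
    moreover have "(\<lambda>r. \<Sum>i<r + (N + 1). E s (int i - int N)) \<longlonglongrightarrow> I s"
      using LIMSEQ_ignore_initial_segment[OF sums[OF s, unfolded sums_def]] .
    ultimately have "(\<lambda>r. \<Sum>m\<in>{- int r..int r}. E s m) \<longlonglongrightarrow> I s"
      by (simp add: add.assoc Lim_transform_eventually)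
    then show "(\<lambda>r::nat. \<Sum>m\<in>{- int r..int r}. LINT x:shell m|mult_measure \<mu>.
        pi_kernel \<mu> D \<psi> \<phi> x * char_shift chi s (inverse x)) \<longlonglongrightarrow> I s"
      by (simp only: kE)
  qed

  have "(\<lambda>s. \<gamma> (s + 1/2)) holomorphic_on {s. Re s < c}"
    using hol by (rule holomorphic_transform) (simp add: G)
  moreover have "\<forall>s. Re s < c \<longrightarrow>
      has_pv_integral \<mu> (\<lambda>x. pi_kernel \<mu> D \<psi> \<phi> x * char_shift chi s (inverse x)) (\<gamma> (s + 1/2))"
    using pv G by simp
  ultimately show ?thesis
    using nicely_meromorphic_shift[OF \<gamma>, of "1/2"] by (intro exI[of _ "\<lambda>s. \<gamma> (s + 1/2)"] exI[of _ c]) simp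
qed

end
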